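(* The stable abelianizations of the Lie algebras $\mathrm{Der}(T(H_n))$, $\mathrm{Der}(\mathcal{L}_n)$ (over $\mathbb{Z}$) and $\mathfrak{a}_g$ (over $\mathbb{Q}$) are given as follows: (i) $\displaystyle\lim_{n\to\infty} H_1(\mathrm{Der}(T(H_n)))\cong \mathbb{Z}$; (ii) $\displaystyle\lim_{n\to\infty} H_1(\mathrm{Der}(\mathcal{L}_n))\cong \mathbb{Z}$; (iii) $\displaystyle\lim_{g\to\infty} H_1(\mathfrak{a}_g)=0$.
   Context: For a Lie algebra $\mathfrak{g}$ (over $\mathbb{Z}$ or $\mathbb{Q}$), $H_1(\mathfrak{g})=\mathfrak{g}/[\mathfrak{g},\mathfrak{g}]$ is its abelianization, where $[\mathfrak{g},\mathfrak{g}]$ is the span of all brackets. $H_n$ is the free abelian group with basis $x_1,\dots,x_n$. $T(H_n)=\bigoplus_{i\ge 1}H_n^{\otimes i}$ is the tensor algebra without constant terms; $\mathcal{L}_n$ is the free Lie algebra over $\mathbb{Z}$ generated by $H_n$. $\mathrm{Der}(T(H_n))$ is the set of $\mathbb{Z}$-linear endomorphisms $D$ of $T(H_n)$ with $D(X\otimes Y)=D(X)\otimes Y+X\otimes D(Y)$; $\mathrm{Der}(\mathcal{L}_n)$ is the set of $\mathbb{Z}$-linear endomorphisms $D$ of $\mathcal{L}_n$ with $D([X,Y])=[D(X),Y]+[X,D(Y)]$. Both are Lie algebras over $\mathbb{Z}$ with bracket $[F,G]=F\circ G-G\circ F$. A derivation is determined by its restriction to $H_n$, and any homomorphism from $H_n$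 to $T(H_n)$ (resp. $\mathcal{L}_n$) extends to a unique derivation. Let $H_{\mathbb{Q}}$ be the $2g$-dimensional $\mathbb{Q}$-vector space with basis $a_1,\dots,a_g,b_1,\dots,b_g$, with the skew-symmetric form $\mu$ given by $\mu(a_i,a_j)=\mu(b_i,b_j)=0$, $\mu(a_i,b_j)=\delta_{ij}$, and let $\omega_0=\sum_{i=1}^g(a_i\otimes b_i-b_i\otimes a_i)\in H_{\mathbb{Q}}^{\otimes 2}$. $\mathfrak{a}_g$ is the Lie algebra over $\mathbb{Q}$ of all derivations $D$ of $T(H_{\mathbb{Q}})=\bigoplus_{i\ge1}H_{\mathbb{Q}}^{\otimes i}$ ($\mathbb{Q}$-linear, Leibniz rule) that are symplectic, i.e. $D(\omega_0)=0$, with the commutator bracket. The direct limits are taken along the embeddings induced by $H_n\subset H_{n+1}$ (resp. by the inclusion of symplectic bases for genus $g$ into genus $g+1$): a derivation is extended by declaring it to be $0$ on the new basis element $x_{n+1}$ (resp. on $a_{g+1},b_{g+1}$). *)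

theory Defs
  imports Complex_Main "HOL-Algebra.Module" "HOL-Algebra.QuotRing" "HOL-Algebra.Elementary_Groups" "HOL-Library.Poly_Mapping"
begin

text \<open>
  Every algebra below (associative without unit, Lie, or merely bilinear) over a ring \<open>R\<close> is a
  \<open>module\<close> record whose \<open>\<otimes>\<close> is the product of the algebra, i.e. the Lie bracket for a Lie algebra.
  These algebras have no unit, and the field \<open>\<one>\<close> of the record is left \<open>undefined\<close>.
\<close>

section \<open>Generalities on algebras\<close>

definition scalars :: "'r::comm_ring_1 ring" where
  "scalars = \<lparr>carrier = UNIV, mult = (*), one = 1, zero = 0, add = (+)\<rparr>"

definition module_span :: "('r, 's) ring_scheme \<Rightarrow> ('r, 'a, 't) module_scheme \<Rightarrow> 'a set \<Rightarrow> 'a set" where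
  "module_span R M S = \<Inter>{N. submodule N R M \<and> S \<subseteq> N}"

definition algebra_ideal :: "('r, 's) ring_scheme \<Rightarrow> ('r, 'a, 't) module_scheme \<Rightarrow> 'a set \<Rightarrow> bool" where
  "algebra_ideal R A I \<longleftrightarrow> submodule I R A \<and>
     (\<forall>x\<in>carrier A. \<forall>y\<in>I. x \<otimes>\<^bsub>A\<^esub> y \<in> I \<and> y \<otimes>\<^bsub>A\<^esub> x \<in> I)"

definition ideal_span :: "('r, 's) ring_scheme \<Rightarrow> ('r, 'a, 't) module_scheme \<Rightarrow> 'a set \<Rightarrow> 'a set" where
  "ideal_span R A S = \<Inter>{I. algebra_ideal R A I \<and> S \<subseteq> I}"

definition quotient_algebra :: "('r, 'a, 't) module_scheme \<Rightarrow> 'a set \<Rightarrow> ('r, 'a set) module" where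
  "quotient_algebra A I =
     \<lparr>carrier = a_rcosets\<^bsub>A\<^esub> I, mult = rcoset_mult A I, one = undefined, zero = I, add = set_add A,
      smult = (\<lambda>r X. \<Union>x\<in>X. I +>\<^bsub>A\<^esub> (r \<odot>\<^bsub>A\<^esub> x))\<rparr>"

subsection \<open>Derivations\<close>

definition derivations :: "('r, 's) ring_scheme \<Rightarrow> ('r, 'a, 't) module_scheme \<Rightarrow> ('a \<Rightarrow> 'a) set" where
  "derivations R A = {D \<in> carrier A \<rightarrow>\<^sub>E carrier A.
     (\<forall>x\<in>carrier A. \<forall>y\<in>carrier A. D (x \<oplus>\<^bsub>A\<^esub> y) = D x \<oplus>\<^bsub>A\<^esub> D y) \<and>
     (\<forall>r\<in>carrier R. \<forall>x\<in>carrier A. D (r \<odot>\<^bsub>A\<^esub> x) = r \<odot>\<^bsub>A\<^esub> D x) \<and>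
     (\<forall>x\<in>carrier A. \<forall>y\<in>carrier A. D (x \<otimes>\<^bsub>A\<^esub> y) = (D x \<otimes>\<^bsub>A\<^esub> y) \<oplus>\<^bsub>A\<^esub> (x \<otimes>\<^bsub>A\<^esub> D y))}"

definition Der :: "('r, 's) ring_scheme \<Rightarrow> ('r, 'a, 't) module_scheme \<Rightarrow> ('r, 'a \<Rightarrow> 'a) module" where
  "Der R A =
     \<lparr>carrier = derivations R A,
      mult = (\<lambda>F G. \<lambda>x\<in>carrier A. F (G x) \<ominus>\<^bsub>A\<^esub> G (F x)),
      one = undefined,
      zero = (\<lambda>x\<in>carrier A. \<zero>\<^bsub>A\<^esub>),
      add = (\<lambda>F G. \<lambda>x\<in>carrier A. F x \<oplus>\<^bsub>A\<^esub> G x),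
      smult = (\<lambda>r F. \<lambda>x\<in>carrier A. r \<odot>\<^bsub>A\<^esub> F x)\<rparr>"

text \<open>
  The extension of a derivation \<open>D\<close> of \<open>A\<close> along an inclusion \<open>\<iota>\<close> of \<open>A\<close> into \<open>B\<close>, when \<open>B\<close> is freely
  generated by the image of the generators of \<open>A\<close> together with the set \<open>N\<close> of new generators.
\<close>

definition extend_derivation ::
    "('r, 's) ring_scheme \<Rightarrow> ('r, 'a, 't) module_scheme \<Rightarrow> ('r, 'b, 'u) module_scheme
      \<Rightarrow> ('a \<Rightarrow> 'b) \<Rightarrow> 'b set \<Rightarrow> ('a \<Rightarrow> 'a) \<Rightarrow> ('b \<Rightarrow> 'b)" where
  "extend_derivation R A B \<iota> N D =
     (THE D'. D' \<in> derivations R B \<and> (\<forall>x\<in>carrier A. D' (\<iota> x) = \<iota> (D x)) \<and> (\<forall>y\<in>N. D' y = \<zero>\<^bsub>B\<^esub>))"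

subsection \<open>Abelianization\<close>

definition derived_algebra :: "('r, 's) ring_scheme \<Rightarrow> ('r, 'a, 't) module_scheme \<Rightarrow> 'a set" where
  "derived_algebra R L = module_span R L {x \<otimes>\<^bsub>L\<^esub> y | x y. x \<in> carrier L \<and> y \<in> carrier L}"

text \<open>
  \<open>H1 R L\<close> is the underlying abelian group of \<open>L/[L, L]\<close>, written multiplicatively as a
  \<open>monoid\<close> record; \<open>H1_map R L' f\<close> is the homomorphism into \<open>H1 R L'\<close> induced by \<open>f\<close>.
\<close>

definition H1 :: "('r, 's) ring_scheme \<Rightarrow> ('r, 'a, 't) module_scheme \<Rightarrow> 'a set monoid" where
  "H1 R L = L A_Mod derived_algebra R L"

definition H1_map :: "('r, 's) ring_scheme \<Rightarrow> ('r, 'b, 't) module_scheme \<Rightarrow> ('a \<Rightarrow> 'b) \<Rightarrow> 'a set \<Rightarrow> 'b set" where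
  "H1_map R L' f X = (\<Union>x\<in>X. derived_algebra R L' +>\<^bsub>L'\<^esub> f x)"

section \<open>Direct limits of sequences of groups\<close>

text \<open>For \<open>f n : G n \<rightarrow> G (n + 1)\<close>, the composite \<open>G m \<rightarrow> G n\<close> for \<open>m \<le> n\<close>.\<close>

definition transition :: "(nat \<Rightarrow> 'a \<Rightarrow> 'a) \<Rightarrow> nat \<Rightarrow> nat \<Rightarrow> 'a \<Rightarrow> 'a" where
  "transition f m n = fold f [m..<n]"

definition limit_rel :: "(nat \<Rightarrow> ('a, 'b) monoid_scheme) \<Rightarrow> (nat \<Rightarrow> 'a \<Rightarrow> 'a) \<Rightarrow> ((nat \<times> 'a) \<times> (nat \<times> 'a)) set" where
  "limit_rel G f = {((m, x), (n, y)). x \<in> carrier (G m) \<and> y \<in> carrier (G n) \<and>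
     (\<exists>k. m \<le> k \<and> n \<le> k \<and> transition f m k x = transition f n k y)}"

definition direct_limit :: "(nat \<Rightarrow> ('a, 'b) monoid_scheme) \<Rightarrow> (nat \<Rightarrow> 'a \<Rightarrow> 'a) \<Rightarrow> (nat \<times> 'a) set monoid" where
  "direct_limit G f =
     \<lparr>carrier = (SIGMA n:UNIV. carrier (G n)) // limit_rel G f,
      mult = (\<lambda>X Y. \<Union>(m, x)\<in>X. \<Union>(n, y)\<in>Y. limit_rel G f ``
        {(max m n, transition f m (max m n) x \<otimes>\<^bsub>G (max m n)\<^esub> transition f n (max m n) y)}),
      one = limit_rel G f `` {(0, \<one>\<^bsub>G 0\<^esub>)}\<rparr>"

section \<open>Tensor algebras and free Lie algebras\<close>

text \<open>The free module on a set \<open>S\<close>, with the bilinear extension of an operation on \<open>S\<close>.\<close>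

definition magma_algebra :: "'w set \<Rightarrow> ('w \<Rightarrow> 'w \<Rightarrow> 'w) \<Rightarrow> ('r::comm_ring_1, 'w \<Rightarrow>\<^sub>0 'r) module" where
  "magma_algebra S opr =
     \<lparr>carrier = {p. Poly_Mapping.keys p \<subseteq> S},
      mult = (\<lambda>p q. \<Sum>u\<in>Poly_Mapping.keys p. \<Sum>v\<in>Poly_Mapping.keys q. Poly_Mapping.single (opr u v) (Poly_Mapping.lookup p u * Poly_Mapping.lookup q v)),
      one = undefined, zero = 0, add = (+),
      smult = (\<lambda>r. Poly_Mapping.map ((*) r))\<rparr>"

text \<open>
  If \<open>H\<close> is free with basis \<open>B\<close>, then the \<open>i\<close>-th tensor power of \<open>H\<close> is free on the words of length
  \<open>i\<close> in \<open>B\<close>, the word \<open>[w\<^sub>1, \<dots>, w\<^sub>i]\<close> standing for the tensor \<open>w\<^sub>1 \<otimes> \<dots> \<otimes> w\<^sub>i\<close>; the product of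
  the tensor algebra concatenates words. There are no constant terms, hence no empty word.
\<close>

definition tensor_algebra :: "'b set \<Rightarrow> ('r::comm_ring_1, 'b list \<Rightarrow>\<^sub>0 'r) module" where
  "tensor_algebra B = magma_algebra {w. w \<noteq> [] \<and> set w \<subseteq> B} (@)"

definition tensor_gen :: "'b \<Rightarrow> ('b list \<Rightarrow>\<^sub>0 'r::comm_ring_1)" where
  "tensor_gen b = Poly_Mapping.single [b] 1"

text \<open>Nonassociative words, i.e. the elements of the free magma.\<close>

datatype 'b bracketing = Gen 'b | Br "'b bracketing" "'b bracketing"

definition free_nonassoc :: "'b set \<Rightarrow> ('r::comm_ring_1, 'b bracketing \<Rightarrow>\<^sub>0 'r) module" where
  "free_nonassoc B = magma_algebra {t. set_bracketing t \<subseteq> B} Br"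

definition lie_relators :: "('r, 'a, 't) module_scheme \<Rightarrow> 'a set" where
  "lie_relators A = {x \<otimes>\<^bsub>A\<^esub> x | x. x \<in> carrier A} \<union>
     {(x \<otimes>\<^bsub>A\<^esub> (y \<otimes>\<^bsub>A\<^esub> z)) \<oplus>\<^bsub>A\<^esub> (y \<otimes>\<^bsub>A\<^esub> (z \<otimes>\<^bsub>A\<^esub> x)) \<oplus>\<^bsub>A\<^esub> (z \<otimes>\<^bsub>A\<^esub> (x \<otimes>\<^bsub>A\<^esub> y)) | x y z.
        x \<in> carrier A \<and> y \<in> carrier A \<and> z \<in> carrier A}"

definition lie_ideal :: "'b set \<Rightarrow> ('b bracketing \<Rightarrow>\<^sub>0 'r::comm_ring_1) set" where
  "lie_ideal B = ideal_span scalars (free_nonassoc B) (lie_relators (free_nonassoc B :: ('r, _) module))"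

definition free_lie :: "'b set \<Rightarrow> ('r::comm_ring_1, ('b bracketing \<Rightarrow>\<^sub>0 'r) set) module" where
  "free_lie B = quotient_algebra (free_nonassoc B) (lie_ideal B)"

definition lie_gen :: "'b set \<Rightarrow> 'b \<Rightarrow> ('b bracketing \<Rightarrow>\<^sub>0 'r::comm_ring_1) set" where
  "lie_gen B b = lie_ideal B +>\<^bsub>(free_nonassoc B :: ('r, _) module)\<^esub> Poly_Mapping.single (Gen b) 1"

text \<open>The map into \<open>free_lie B'\<close> induced by the inclusion of a subset of \<open>B'\<close>.\<close>

definition lie_incl :: "'b set \<Rightarrow> ('b bracketing \<Rightarrow>\<^sub>0 'r::comm_ring_1) set \<Rightarrow> ('b bracketing \<Rightarrow>\<^sub>0 'r) set" where
  "lie_incl B' X = (\<Union>x\<in>X. lie_ideal B' +>\<^bsub>(free_nonassoc B' :: ('r, _) module)\<^esub> x)"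

section \<open>The three sequences of Lie algebras\<close>

abbreviation Z_ring :: "int ring" where "Z_ring \<equiv> scalars"
abbreviation Q_ring :: "rat ring" where "Q_ring \<equiv> scalars"

text \<open>The basis element \<open>x\<^sub>i\<close> of \<open>H\<^sub>n\<close> is indexed by \<open>i \<in> {1..n}\<close>.\<close>

definition T :: "nat \<Rightarrow> (int, nat list \<Rightarrow>\<^sub>0 int) module" where
  "T n = tensor_algebra {1..n}"

definition Der_T :: "nat \<Rightarrow> (int, (nat list \<Rightarrow>\<^sub>0 int) \<Rightarrow> (nat list \<Rightarrow>\<^sub>0 int)) module" where
  "Der_T n = Der Z_ring (T n)"

definition Der_T_embed :: "nat \<Rightarrow> ((nat list \<Rightarrow>\<^sub>0 int) \<Rightarrow> (nat list \<Rightarrow>\<^sub>0 int))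
    \<Rightarrow> ((nat list \<Rightarrow>\<^sub>0 int) \<Rightarrow> (nat list \<Rightarrow>\<^sub>0 int))" where
  "Der_T_embed n = extend_derivation Z_ring (T n) (T (Suc n)) (\<lambda>x. x) {tensor_gen (Suc n)}"

type_synonym lie_elem = "(nat bracketing \<Rightarrow>\<^sub>0 int) set"

definition Lie :: "nat \<Rightarrow> (int, lie_elem) module" where
  "Lie n = free_lie {1..n}"

definition Der_Lie :: "nat \<Rightarrow> (int, lie_elem \<Rightarrow> lie_elem) module" where
  "Der_Lie n = Der Z_ring (Lie n)"

definition Der_Lie_embed :: "nat \<Rightarrow> (lie_elem \<Rightarrow> lie_elem) \<Rightarrow> (lie_elem \<Rightarrow> lie_elem)" where
  "Der_Lie_embed n = extend_derivation Z_ring (Lie n) (Lie (Suc n))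
     (lie_incl {1..Suc n}) {lie_gen {1..Suc n} (Suc n)}"

datatype symp_index = a_ix nat | b_ix nat

definition symp_basis :: "nat \<Rightarrow> symp_index set" where
  "symp_basis g = a_ix ` {1..g} \<union> b_ix ` {1..g}"

type_synonym symp_tensor = "symp_index list \<Rightarrow>\<^sub>0 rat"

definition TQ :: "nat \<Rightarrow> (rat, symp_tensor) module" where
  "TQ g = tensor_algebra (symp_basis g)"

definition omega0 :: "nat \<Rightarrow> symp_tensor" where
  "omega0 g = (\<Sum>i=1..g. tensor_gen (a_ix i) \<otimes>\<^bsub>TQ g\<^esub> tensor_gen (b_ix i)
                       - tensor_gen (b_ix i) \<otimes>\<^bsub>TQ g\<^esub> tensor_gen (a_ix i))"

definition symp_der :: "nat \<Rightarrow> (rat, symp_tensor \<Rightarrow> symp_tensor) module" where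
  "symp_der g = (Der Q_ring (TQ g))
     \<lparr>carrier := {D \<in> derivations Q_ring (TQ g). D (omega0 g) = \<zero>\<^bsub>TQ g\<^esub>}\<rparr>"

definition symp_der_embed :: "nat \<Rightarrow> (symp_tensor \<Rightarrow> symp_tensor) \<Rightarrow> (symp_tensor \<Rightarrow> symp_tensor)" where
  "symp_der_embed g = extend_derivation Q_ring (TQ g) (TQ (Suc g)) (\<lambda>x. x)
     {tensor_gen (a_ix (Suc g)), tensor_gen (b_ix (Suc g))}"

end

theory Submission
  imports Defs "HOL-Library.Function_Algebras"
begin

text \<open>
  The derivations for all \<open>n\<close> live in one space, the derivations of a free algebra on infinitely many
  generators, where the embeddings become inclusions; the question is which derivations are eventually
  sums of brackets.

  For (i) and (ii), let \<open>E i y\<close> send \<open>x\<^sub>i\<close> to \<open>y\<close> and the other generators to \<open>0\<close>. With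
  \<open>F = E (n + 1) y\<close> and \<open>G = E i (x\<^sub>n\<^sub>+\<^sub>1 z)\<close> one has \<open>E i (y z) = [F, G] + E (n + 1) (G y)\<close>, and the last
  term is, by a similar trick with \<open>x\<^sub>n\<^sub>+\<^sub>2\<close>, a sum of brackets. So only the linear part of a derivation
  matters, that is an element of \<open>gl\<^sub>n\<close>, whose abelianization is given by the trace.

  For (iii), symplectic derivations are combinations of derivations \<open>N w\<close> attached to cyclic words, and
  \<open>[N U, N V]\<close> is the sum over pairs of letters \<open>u\<close> of \<open>U\<close> and \<open>v\<close> of \<open>V\<close> of \<open>\<mu> u v\<close> times the \<open>N\<close> of the
  cyclic word obtained by cutting out \<open>u\<close> and \<open>v\<close> and joining \<open>U\<close> to \<open>V\<close>. It suffices that a function of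
  cyclic words that vanishes on all brackets is zero. Modulo brackets, every word is a combination of
  chord diagrams whose chords form a path, each crossing only the next, and their values depend only on
  the number of chords. Sliding chords along such a path shows that its value is \<open>0\<close> if the number of
  chords is odd, and equal to its own negative if it is even.
\<close>

section \<open>Direct limits\<close>

text \<open>The correction term is what calls for two spare generators in (i) and (ii). One argument
  serves both: derivations of the free Lie algebra are induced from the free nonassociative algebra,
  since derivations there preserve the ideal of Lie relations, and this ideal has no linear part, so
  the trace survives. In (iii) rational coefficients enter three times: a rotation-invariant tensor
  is averaged over the rotations of its words, which divides by their length; an element outside the
  derived algebras is separated from them by a linear functional; and a value equal to its own
  negative is zero.\<close>

lemma transition_refl [simp]: "transition f n n x = x"
  by (simp add: transition_def)

lemma transition_Suc: "m \<le> n \<Longrightarrow> transition f m (Suc n) x = f n (transition f m n x)"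
  by (simp add: transition_def)

lemma transition_trans:
  assumes "m \<le> n" "n \<le> k"
  shows "transition f n k (transition f m n x) = transition f m k x"
  using assms(2,1) by (induction k rule: dec_induct) (simp_all add: transition_Suc)

text \<open>These hypotheses make \<open>K\<close> the colimit: the \<open>t n\<close> form a
  cocone, are jointly onto, and anything they kill already dies at a finite stage. The limit is then
  computed by exhibiting \<open>t\<close>.\<close>

locale direct_system =
  fixes G :: "nat \<Rightarrow> ('a, 'b) monoid_scheme" and f :: "nat \<Rightarrow> 'a \<Rightarrow> 'a"
    and K :: "('k, 'c) monoid_scheme" and t :: "nat \<Rightarrow> 'a \<Rightarrow> 'k"
  assumes group_G: "group (G n)"
    and group_K: "group K"
    and f_hom: "f n \<in> hom (G n) (G (Suc n))"
    and t_hom: "t n \<in> hom (G n) K"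
    and t_f: "x \<in> carrier (G n) \<Longrightarrow> t (Suc n) (f n x) = t n x"
    and t_onto: "k \<in> carrier K \<Longrightarrow> \<exists>n x. x \<in> carrier (G n) \<and> t n x = k"
    and t_kernel: "x \<in> carrier (G n) \<Longrightarrow> t n x = \<one>\<^bsub>K\<^esub> \<Longrightarrow> \<exists>m\<ge>n. transition f n m x = \<one>\<^bsub>G m\<^esub>"
begin

lemma transition_hom: "m \<le> n \<Longrightarrow> transition f m n \<in> hom (G m) (G n)"
proof (induction n rule: dec_induct)
  case base
  then show ?case by (simp add: hom_def)
next
  case (step n)
  then show ?case
    using f_hom[of n] by (auto simp: hom_def transition_Suc Pi_iff)
qed

lemma transition_closed: "m \<le> n \<Longrightarrow> x \<in> carrier (G m) \<Longrightarrow> transition f m n x \<in> carrier (G n)"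
  using transition_hom[of m n] by (auto simp: hom_def)

lemma t_transition: "m \<le> n \<Longrightarrow> x \<in> carrier (G m) \<Longrightarrow> t n (transition f m n x) = t m x"
  by (induction n rule: dec_induct) (simp_all add: transition_Suc t_f transition_closed)

lemma t_closed: "x \<in> carrier (G n) \<Longrightarrow> t n x \<in> carrier K"
  using t_hom[of n] by (auto simp: hom_def)

text \<open>Turns the relation, which asks for a common later stage, into the kernel pair of
  \<open>t\<close>, so that the classes are the fibres \<open>cls k\<close>. For the converse both
  elements are moved to one stage and \<open>t_kernel\<close> is applied to their quotient.\<close>

lemma limit_rel_iff:
  "((m, x), (n, y)) \<in> limit_rel G f \<longleftrightarrow>
     x \<in> carrier (G m) \<and> y \<in> carrier (G n) \<and> t m x = t n y"
proof
  assume "((m, x), (n, y)) \<in> limit_rel G f"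
  then show "x \<in> carrier (G m) \<and> y \<in> carrier (G n) \<and> t m x = t n y"
    unfolding limit_rel_def using t_transition by clarsimp metis
next
  assume H: "x \<in> carrier (G m) \<and> y \<in> carrier (G n) \<and> t m x = t n y"
  define k where "k = max m n"
  define x' where "x' = transition f m k x"
  define y' where "y' = transition f n k y"
  have k: "m \<le> k" "n \<le> k" by (auto simp: k_def)
  have x': "x' \<in> carrier (G k)" and y': "y' \<in> carrier (G k)"
    using H k by (auto simp: x'_def y'_def transition_closed)
  interpret Gk: group "G k" by (rule group_G)
  interpret tk: group_hom "G k" K "t k"
    using group_G group_K t_hom by (simp add: group_hom_def group_hom_axioms_def)
  have "t k x' = t k y'"
    using H k by (simp add: x'_def y'_def t_transition)
  then have "t k (x' \<otimes>\<^bsub>G k\<^esub> inv\<^bsub>G k\<^esub> y') = \<one>\<^bsub>K\<^esub>"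
    using x' y' by simp
  then obtain l where l: "k \<le> l" "transition f k l (x' \<otimes>\<^bsub>G k\<^esub> inv\<^bsub>G k\<^esub> y') = \<one>\<^bsub>G l\<^esub>"
    using t_kernel[of "x' \<otimes>\<^bsub>G k\<^esub> inv\<^bsub>G k\<^esub> y'" k] x' y' by auto
  interpret Gl: group "G l" by (rule group_G)
  interpret T: group_hom "G k" "G l" "transition f k l"
    using group_G l(1) transition_hom by (simp add: group_hom_def group_hom_axioms_def)
  have "transition f k l x' = transition f k l y'"
    using l(2) x' y' Gl.inv_equality[of "transition f k l x'" "inv\<^bsub>G l\<^esub> (transition f k l y')"]
    by simp
  then have "transition f m l x = transition f n l y"
    using k l(1) by (simp add: x'_def y'_def transition_trans)
  then show "((m, x), (n, y)) \<in> limit_rel G f"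
    using H k l(1) unfolding limit_rel_def by (auto intro!: exI[of _ l])
qed

definition cls :: "'k \<Rightarrow> (nat \<times> 'a) set" where
  "cls k = {(n, x). x \<in> carrier (G n) \<and> t n x = k}"

lemma limit_rel_Image: "x \<in> carrier (G n) \<Longrightarrow> limit_rel G f `` {(n, x)} = cls (t n x)"
  by (auto simp: cls_def limit_rel_iff)

lemma cls_nonempty: "k \<in> carrier K \<Longrightarrow> \<exists>n x. (n, x) \<in> cls k"
  using t_onto by (fastforce simp: cls_def)

lemma carrier_direct_limit: "carrier (direct_limit G f) = cls ` carrier K"
proof -
  have "carrier (direct_limit G f) = (\<lambda>p. limit_rel G f `` {p}) ` (SIGMA n:UNIV. carrier (G n))"
    by (auto simp: direct_limit_def quotient_def)
  also have "\<dots> = (\<lambda>(n, x). cls (t n x)) ` (SIGMA n:UNIV. carrier (G n))"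
    by (intro image_cong) (auto simp: cls_def limit_rel_iff)
  also have "\<dots> = cls ` carrier K"
    using t_closed t_onto by (fastforce simp: image_iff)
  finally show ?thesis .
qed

lemma mult_direct_limit:
  assumes "a \<in> carrier K" "b \<in> carrier K"
  shows "cls a \<otimes>\<^bsub>direct_limit G f\<^esub> cls b = cls (a \<otimes>\<^bsub>K\<^esub> b)"
proof -
  have "limit_rel G f `` {(max m n, transition f m (max m n) x \<otimes>\<^bsub>G (max m n)\<^esub>
      transition f n (max m n) y)} = cls (a \<otimes>\<^bsub>K\<^esub> b)"
    if "(m, x) \<in> cls a" "(n, y) \<in> cls b" for m n x y
  proof -
    let ?k = "max m n"
    interpret group_hom "G ?k" K "t ?k"
      using group_G group_K t_hom by (simp add: group_hom_def group_hom_axioms_def)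
    show ?thesis
      using that by (auto simp: cls_def limit_rel_Image transition_closed t_transition)
  qed
  then have "cls a \<otimes>\<^bsub>direct_limit G f\<^esub> cls b = (\<Union>(m, x)\<in>cls a. \<Union>(n, y)\<in>cls b. cls (a \<otimes>\<^bsub>K\<^esub> b))"
    by (fastforce simp: direct_limit_def)
  then show ?thesis
    using cls_nonempty[OF assms(1)] cls_nonempty[OF assms(2)] by auto
qed

lemma cls_hom: "cls \<in> hom K (direct_limit G f)"
  by (auto simp: hom_def carrier_direct_limit mult_direct_limit)

lemma cls_one: "cls \<one>\<^bsub>K\<^esub> = \<one>\<^bsub>direct_limit G f\<^esub>"
proof -
  interpret group_hom "G 0" K "t 0"
    using group_G group_K t_hom by (simp add: group_hom_def group_hom_axioms_def)
  show ?thesis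
    by (simp add: direct_limit_def limit_rel_Image)
qed

lemma group_direct_limit: "group (direct_limit G f)"
proof -
  \<comment> \<open>The image of \<open>K\<close> under \<open>cls\<close> is a group for the
    updated carrier and unit; by \<open>carrier_direct_limit\<close> and \<open>cls_one\<close> both
    updates change nothing.\<close>
  have "group (direct_limit G f
      \<lparr>carrier := cls ` carrier K, one := cls \<one>\<^bsub>K\<^esub>\<rparr>)"
    using group.hom_imp_img_group[OF group_K cls_hom] .
  then show ?thesis
    by (simp add: cls_one carrier_direct_limit[symmetric])
qed

lemma iso_direct_limit: "K \<cong> direct_limit G f"
proof -
  have "inj_on cls (carrier K)"
  proof (rule inj_onI)
    fix a b assume "a \<in> carrier K" "b \<in> carrier K" and ab: "cls a = cls b"
    then obtain n x where "(n, x) \<in> cls a" using cls_nonempty by blast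
    then show "a = b" using ab by (auto simp: cls_def)
  qed
  then have "cls \<in> iso K (direct_limit G f)"
    using cls_hom by (auto simp: iso_def bij_betw_def carrier_direct_limit)
  then show ?thesis
    by (auto simp: is_iso_def)
qed

end

section \<open>Stable abelianizations\<close>

lemma cring_scalars: "cring (scalars :: 'r::comm_ring_1 ring)"
  by (rule cringI; (rule abelian_groupI comm_monoidI)?)
    (auto simp: scalars_def algebra_simps intro: exI[of _ "- x" for x :: 'r])

lemma carrier_scalars [simp]: "carrier scalars = UNIV"
  by (simp add: scalars_def)

text \<open>The algebra records below are presented as images of type-class groups; their group laws
  are inherited along the surjection instead of being checked in the record.\<close>

lemma
  fixes h :: "'a::ab_group_add \<Rightarrow> 'b" and G :: "('b, 'c) ring_scheme"
  assumes S: "0 \<in> S" "\<And>a b. a \<in> S \<Longrightarrow> b \<in> S \<Longrightarrow> a + b \<in> S" "\<And>a. a \<in> S \<Longrightarrow> - a \<in> S"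
    and onto: "h ` S = carrier G"
    and zero: "h 0 = \<zero>\<^bsub>G\<^esub>"
    and add: "\<And>a b. a \<in> S \<Longrightarrow> b \<in> S \<Longrightarrow> h (a + b) = h a \<oplus>\<^bsub>G\<^esub> h b"
  shows abelian_group_image: "abelian_group G"
    and abelian_group_image_neg: "a \<in> S \<Longrightarrow> h (- a) = \<ominus>\<^bsub>G\<^esub> h a"
proof -
  have closed: "h a \<in> carrier G" if "a \<in> S" for a using that onto by blast
  have inv: "h (- a) \<oplus>\<^bsub>G\<^esub> h a = \<zero>\<^bsub>G\<^esub>" if "a \<in> S" for a
    using that S(3) by (simp add: add[symmetric] zero)
  show "abelian_group G"
  proof (rule abelian_groupI)
    show "\<zero>\<^bsub>G\<^esub> \<in> carrier G"
      using closed S(1) by (simp add: zero[symmetric])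
  qed (use S inv in \<open>force simp: onto[symmetric] zero[symmetric] add[symmetric] add.commute add.left_commute add.assoc\<close>)+
  then interpret abelian_group G .
  show "h (- a) = \<ominus>\<^bsub>G\<^esub> h a" if "a \<in> S" for a
    using that minus_equality[OF inv] closed S(3) by auto
qed

lemma submodule_module_span:
  assumes "Module.module R M" "S \<subseteq> carrier M"
  shows "submodule (module_span R M S) R M"
proof -
  interpret Module.module R M by fact
  show ?thesis
  proof (rule submoduleI)
    show "module_span R M S \<subseteq> carrier M"
      unfolding module_span_def using carrier_is_submodule assms(2) by blast
    show "\<zero>\<^bsub>M\<^esub> \<in> module_span R M S"
      unfolding module_span_def
      by (auto simp: submodule_def dest!: subgroup.one_closed)
  qed (auto simp: module_span_def submoduleE)
qed

lemma module_span_incl: "S \<subseteq> module_span R M S"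
  by (auto simp: module_span_def)

lemma module_span_minimal: "submodule N R M \<Longrightarrow> S \<subseteq> N \<Longrightarrow> module_span R M S \<subseteq> N"
  by (auto simp: module_span_def)

text \<open>All ranks share one ambient module, so that \<open>e n\<close> corresponds to the
  inclusion of \<open>D n\<close> in \<open>D (Suc n)\<close>. The map \<open>\<Phi> n\<close> may
  have a kernel: different derivations of the free nonassociative algebra can induce the same
  derivation of the free Lie algebra.\<close>

locale derivation_system = Modules.module sc
  for sc :: "'r::comm_ring_1 \<Rightarrow> 'd::ab_group_add \<Rightarrow> 'd" +
  fixes D :: "nat \<Rightarrow> 'd set" and br :: "'d \<Rightarrow> 'd \<Rightarrow> 'd"
    and L :: "nat \<Rightarrow> ('r, 'x, 't) module_scheme" and e :: "nat \<Rightarrow> 'x \<Rightarrow> 'x"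
    and \<Phi> :: "nat \<Rightarrow> 'd \<Rightarrow> 'x"
  assumes subspace_D: "subspace (D n)"
    and br_closed: "F \<in> D n \<Longrightarrow> H \<in> D n \<Longrightarrow> br F H \<in> D n"
    and D_Suc: "D n \<subseteq> D (Suc n)"
    and \<Phi>_onto: "\<Phi> n ` D n = carrier (L n)"
    and \<Phi>_zero: "\<Phi> n 0 = \<zero>\<^bsub>L n\<^esub>"
    and \<Phi>_add: "F \<in> D n \<Longrightarrow> H \<in> D n \<Longrightarrow> \<Phi> n (F + H) = \<Phi> n F \<oplus>\<^bsub>L n\<^esub> \<Phi> n H"
    and \<Phi>_scale: "F \<in> D n \<Longrightarrow> \<Phi> n (sc r F) = r \<odot>\<^bsub>L n\<^esub> \<Phi> n F"
    and \<Phi>_br: "F \<in> D n \<Longrightarrow> H \<in> D n \<Longrightarrow> \<Phi> n (br F H) = \<Phi> n F \<otimes>\<^bsub>L n\<^esub> \<Phi> n H"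
    and e_\<Phi>: "F \<in> D n \<Longrightarrow> e n (\<Phi> n F) = \<Phi> (Suc n) F"
begin

lemma D_closed:
  shows D_zero: "0 \<in> D n"
    and D_add: "F \<in> D n \<Longrightarrow> H \<in> D n \<Longrightarrow> F + H \<in> D n"
    and D_scale: "F \<in> D n \<Longrightarrow> sc r F \<in> D n"
    and D_neg: "F \<in> D n \<Longrightarrow> - F \<in> D n"
    and D_diff: "F \<in> D n \<Longrightarrow> H \<in> D n \<Longrightarrow> F - H \<in> D n"
  using subspace_D[of n] by (auto simp: subspace_0 subspace_add subspace_scale subspace_neg subspace_diff)

lemma D_mono: "m \<le> n \<Longrightarrow> D m \<subseteq> D n"
  using D_Suc by (rule lift_Suc_mono_le)

lemma \<Phi>_closed: "F \<in> D n \<Longrightarrow> \<Phi> n F \<in> carrier (L n)"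
  using \<Phi>_onto by blast

lemma carrierE:
  assumes "x \<in> carrier (L n)"
  obtains F where "F \<in> D n" "x = \<Phi> n F"
  using assms \<Phi>_onto[of n] by blast

lemma module_L: "Module.module scalars (L n)"
proof (rule moduleI)
  show "cring (scalars :: 'r ring)" by (rule cring_scalars)
  show "abelian_group (L n)"
    using D_zero D_add D_neg \<Phi>_onto \<Phi>_zero \<Phi>_add by (rule abelian_group_image)
next
  fix a x assume "x \<in> carrier (L n)"
  then obtain F where F: "F \<in> D n" "x = \<Phi> n F" by (rule carrierE)
  show "a \<odot>\<^bsub>L n\<^esub> x \<in> carrier (L n)"
    using F by (simp add: \<Phi>_scale[symmetric] \<Phi>_closed D_scale)
next
  fix a b x assume "x \<in> carrier (L n)"
  then obtain F where F: "F \<in> D n" "x = \<Phi> n F" by (rule carrierE)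
  show "(a \<oplus>\<^bsub>scalars\<^esub> b) \<odot>\<^bsub>L n\<^esub> x = a \<odot>\<^bsub>L n\<^esub> x \<oplus>\<^bsub>L n\<^esub> b \<odot>\<^bsub>L n\<^esub> x"
    using F by (simp add: \<Phi>_scale[symmetric] \<Phi>_add[symmetric] D_scale scale_left_distrib[symmetric] scalars_def)
  show "a \<otimes>\<^bsub>scalars\<^esub> b \<odot>\<^bsub>L n\<^esub> x = a \<odot>\<^bsub>L n\<^esub> (b \<odot>\<^bsub>L n\<^esub> x)"
    using F by (simp add: \<Phi>_scale[symmetric] D_scale scalars_def)
next
  fix a x y assume "x \<in> carrier (L n)" "y \<in> carrier (L n)"
  then obtain F H where "F \<in> D n" "x = \<Phi> n F" "H \<in> D n" "y = \<Phi> n H"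
    by (meson carrierE)
  then show "a \<odot>\<^bsub>L n\<^esub> (x \<oplus>\<^bsub>L n\<^esub> y) = a \<odot>\<^bsub>L n\<^esub> x \<oplus>\<^bsub>L n\<^esub> a \<odot>\<^bsub>L n\<^esub> y"
    by (simp add: \<Phi>_scale[symmetric] \<Phi>_add[symmetric] D_add D_scale scale_right_distrib)
next
  fix x assume "x \<in> carrier (L n)"
  then obtain F where F: "F \<in> D n" "x = \<Phi> n F" by (rule carrierE)
  have "1 \<odot>\<^bsub>L n\<^esub> \<Phi> n F = \<Phi> n F"
    using F(1) by (simp add: \<Phi>_scale[symmetric])
  then show "\<one>\<^bsub>scalars\<^esub> \<odot>\<^bsub>L n\<^esub> x = x"
    using F by (simp add: scalars_def)
qed

lemma \<Phi>_neg: "F \<in> D n \<Longrightarrow> \<Phi> n (- F) = \<ominus>\<^bsub>L n\<^esub> \<Phi> n F"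
  using D_zero D_add D_neg \<Phi>_onto \<Phi>_zero \<Phi>_add by (rule abelian_group_image_neg)

abbreviation derived :: "nat \<Rightarrow> 'x set" where
  "derived n \<equiv> derived_algebra scalars (L n)"

text \<open>A preimage rather than a span of brackets, so that the kernel of \<open>\<Phi> n\<close>
  is included and cosets in \<open>L n\<close> can be compared by differences in
  \<open>D n\<close>.\<close>

definition D' :: "nat \<Rightarrow> 'd set" where
  "D' n = {F \<in> D n. \<Phi> n F \<in> derived n}"

lemma brackets_subset:
  "{x \<otimes>\<^bsub>L n\<^esub> y | x y. x \<in> carrier (L n) \<and> y \<in> carrier (L n)} \<subseteq> carrier (L n)"
  by (auto elim!: carrierE simp: \<Phi>_br[symmetric] \<Phi>_closed br_closed)

lemma submodule_derived: "submodule (derived n) scalars (L n)"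
  unfolding derived_algebra_def
  using submodule_module_span[OF module_L brackets_subset] .

lemma derived_closed:
  shows derived_subset: "derived n \<subseteq> carrier (L n)"
    and derived_add: "x \<in> derived n \<Longrightarrow> y \<in> derived n \<Longrightarrow> x \<oplus>\<^bsub>L n\<^esub> y \<in> derived n"
    and derived_scale: "x \<in> derived n \<Longrightarrow> r \<odot>\<^bsub>L n\<^esub> x \<in> derived n"
  using Module.module.submoduleE[OF module_L submodule_derived] by auto

lemma derived_zero: "\<zero>\<^bsub>L n\<^esub> \<in> derived n"
  using submodule_derived[of n] by (auto simp: submodule_def dest!: subgroup.one_closed)

lemma subspace_D': "subspace (D' n)"
  by (auto simp: subspace_def D'_def D_zero D_add D_scale \<Phi>_zero \<Phi>_add \<Phi>_scale
      derived_zero derived_add derived_scale)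

lemma br_in_D': "F \<in> D n \<Longrightarrow> H \<in> D n \<Longrightarrow> br F H \<in> D' n"
  unfolding D'_def derived_algebra_def
  using module_span_incl
  by (fastforce simp: br_closed \<Phi>_br \<Phi>_closed)

lemma derived_minimal:
  assumes "submodule N scalars (L n)"
    and "\<And>F H. F \<in> D n \<Longrightarrow> H \<in> D n \<Longrightarrow> \<Phi> n (br F H) \<in> N"
  shows "derived n \<subseteq> N"
  unfolding derived_algebra_def
  using assms by (intro module_span_minimal) (auto elim!: carrierE simp: \<Phi>_br)

text \<open>The image of \<open>D n \<inter> S\<close> is a submodule that contains all brackets,
  hence the derived algebra; an element of \<open>D' n\<close> then differs from one in
  \<open>S\<close> by the kernel of \<open>\<Phi> n\<close>, which lies in \<open>S\<close>.\<close>

lemma D'_span: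
  assumes "subspace S" and S: "\<And>F. F \<in> D n \<Longrightarrow> \<Phi> n F = \<zero>\<^bsub>L n\<^esub> \<Longrightarrow> F \<in> S"
    and br: "\<And>F H. F \<in> D n \<Longrightarrow> H \<in> D n \<Longrightarrow> br F H \<in> S"
  shows "D' n \<subseteq> S"
proof -
  interpret Module.module scalars "L n" by (rule module_L)
  have "submodule (\<Phi> n ` (D n \<inter> S)) scalars (L n)"
  proof (rule submoduleI)
    show "\<Phi> n ` (D n \<inter> S) \<subseteq> carrier (L n)" using \<Phi>_closed by blast
    show "\<zero>\<^bsub>L n\<^esub> \<in> \<Phi> n ` (D n \<inter> S)"
      using D_zero subspace_0[OF assms(1)] by (auto simp: \<Phi>_zero[symmetric])
  next
    fix a assume "a \<in> \<Phi> n ` (D n \<inter> S)"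
    then show "\<ominus>\<^bsub>L n\<^esub> a \<in> \<Phi> n ` (D n \<inter> S)"
      using D_neg subspace_neg[OF assms(1)] by (auto simp: \<Phi>_neg[symmetric])
  next
    fix a b assume "a \<in> \<Phi> n ` (D n \<inter> S)" "b \<in> \<Phi> n ` (D n \<inter> S)"
    then show "a \<oplus>\<^bsub>L n\<^esub> b \<in> \<Phi> n ` (D n \<inter> S)"
      using D_add subspace_add[OF assms(1)] by (auto simp: \<Phi>_add[symmetric])
  next
    fix r x assume "x \<in> \<Phi> n ` (D n \<inter> S)"
    then show "r \<odot>\<^bsub>L n\<^esub> x \<in> \<Phi> n ` (D n \<inter> S)"
      using D_scale subspace_scale[OF assms(1)] by (auto simp: \<Phi>_scale[symmetric])
  qed
  then have sub: "derived n \<subseteq> \<Phi> n ` (D n \<inter> S)"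
    by (rule derived_minimal) (auto simp: br_closed br)
  show ?thesis
  proof
    fix F assume "F \<in> D' n"
    then have F: "F \<in> D n" "\<Phi> n F \<in> derived n" by (auto simp: D'_def)
    then obtain H where H: "H \<in> D n" "H \<in> S" "\<Phi> n F = \<Phi> n H" using sub by blast
    have "\<Phi> n (F + - H) = \<zero>\<^bsub>L n\<^esub>"
      using F H \<Phi>_add[of F n "- H"] by (simp add: D_neg \<Phi>_neg \<Phi>_closed r_neg del: add_uminus_conv_diff)
    then have "F + - H \<in> S" using S F H D_add D_neg by metis
    then show "F \<in> S" using subspace_add[OF assms(1) _ H(2)] by fastforce
  qed
qed

lemma D'_Suc: "D' n \<subseteq> D' (Suc n)"
proof (rule D'_span[OF subspace_D'])
  fix F assume F: "F \<in> D n" "\<Phi> n F = \<zero>\<^bsub>L n\<^esub>"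
  \<comment> \<open>\<open>e n\<close> is known only on images of derivations, so its value at zero
    is read off from the zero derivation; thus the kernels of the \<open>\<Phi> n\<close> are
    nested.\<close>
  then have "\<Phi> (Suc n) F = e n (\<Phi> n 0)"
    by (metis e_\<Phi> \<Phi>_zero)
  also have "\<dots> = \<zero>\<^bsub>L (Suc n)\<^esub>"
    using e_\<Phi> D_zero \<Phi>_zero by metis
  finally show "F \<in> D' (Suc n)"
    using F D_Suc by (auto simp: D'_def derived_zero)
next
  fix F H assume "F \<in> D n" "H \<in> D n"
  then show "br F H \<in> D' (Suc n)"
    using D_Suc by (intro br_in_D') auto
qed

lemma D'_mono: "m \<le> n \<Longrightarrow> D' m \<subseteq> D' n"
  using D'_Suc by (rule lift_Suc_mono_le)

section \<open>Cosets of the derived algebra\<close>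

definition h1 :: "nat \<Rightarrow> 'd \<Rightarrow> 'x set" where
  "h1 n F = derived n +>\<^bsub>L n\<^esub> \<Phi> n F"

lemma abelian_subgroup_derived: "abelian_subgroup (derived n) (L n)"
  using submodule_derived[of n] module_L[of n]
  by (intro abelian_subgroupI3 additive_subgroup.intro) (auto simp: submodule_def Module.module_def)

lemma h1_eq_iff:
  assumes "F \<in> D n" "H \<in> D n"
  shows "h1 n F = h1 n H \<longleftrightarrow> F - H \<in> D' n"
proof -
  interpret abelian_subgroup "derived n" "L n" by (rule abelian_subgroup_derived)
  have *: "\<Phi> n (F - H) = \<Phi> n F \<oplus>\<^bsub>L n\<^esub> \<ominus>\<^bsub>L n\<^esub> \<Phi> n H"
    using assms \<Phi>_add[of F n "- H"] by (simp add: D_neg \<Phi>_neg)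
  have "\<Phi> n F \<ominus>\<^bsub>L n\<^esub> \<Phi> n H \<in> derived n \<longleftrightarrow> F - H \<in> D' n"
    using assms by (simp add: D'_def D_diff * a_minus_def)
  moreover have "h1 n F = h1 n H \<longleftrightarrow> \<Phi> n F \<in> h1 n H"
    unfolding h1_def
    using assms \<Phi>_closed a_repr_independence[OF _ _ a_subgroup] a_rcos_self by metis
  moreover have "\<dots> \<longleftrightarrow> \<Phi> n F \<ominus>\<^bsub>L n\<^esub> \<Phi> n H \<in> derived n"
    unfolding h1_def a_minus_def
    using assms \<Phi>_closed a_rcos_module by metis
  ultimately show ?thesis by simp
qed

lemma carrier_H1: "carrier (H1 scalars (L n)) = h1 n ` D n"
  by (auto simp: H1_def A_FactGroup_def' A_RCOSETS_def' h1_def elim!: carrierE intro: \<Phi>_closed)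

lemma group_H1: "group (H1 scalars (L n))"
  unfolding H1_def
  using abelian_subgroup.a_factorgroup_is_group[OF abelian_subgroup_derived] .

lemma mult_H1:
  assumes "F \<in> D n" "H \<in> D n"
  shows "h1 n F \<otimes>\<^bsub>H1 scalars (L n)\<^esub> h1 n H = h1 n (F + H)"
proof -
  interpret abelian_subgroup "derived n" "L n" by (rule abelian_subgroup_derived)
  show ?thesis
    using assms a_rcos_sum[of "\<Phi> n F" "\<Phi> n H"] by (simp add: H1_def h1_def \<Phi>_add \<Phi>_closed)
qed

lemma one_H1: "\<one>\<^bsub>H1 scalars (L n)\<^esub> = h1 n 0"
proof -
  interpret abelian_subgroup "derived n" "L n" by (rule abelian_subgroup_derived)
  show ?thesis
    by (simp add: H1_def A_FactGroup_def' h1_def \<Phi>_zero a_coset_join2 derived_zero a_subgroup)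
qed

text \<open>The union defining \<open>H1_map\<close> collapses to one coset: representatives of a
  coset come from derivations that differ by an element of \<open>D' n\<close>, which lies in
  \<open>D' (Suc n)\<close>.\<close>

lemma H1_map_h1:
  assumes F: "F \<in> D n"
  shows "H1_map scalars (L (Suc n)) (e n) (h1 n F) = h1 (Suc n) F"
proof -
  interpret abelian_subgroup "derived n" "L n" by (rule abelian_subgroup_derived)
  have "derived (Suc n) +>\<^bsub>L (Suc n)\<^esub> e n x = h1 (Suc n) F" if x: "x \<in> h1 n F" for x
  proof -
    have "x \<in> carrier (L n)"
      using x F derived_subset \<Phi>_closed unfolding h1_def
      by (meson a_r_coset_subset_G subsetD)
    then obtain H where H: "H \<in> D n" "x = \<Phi> n H" by (rule carrierE)
    then have "h1 n H = h1 n F"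
      using x F \<Phi>_closed unfolding h1_def by (metis a_repr_independence[OF _ _ a_subgroup])
    then have "H - F \<in> D' (Suc n)"
      using F H h1_eq_iff D'_Suc by blast
    then have "h1 (Suc n) H = h1 (Suc n) F"
      using F H D_Suc h1_eq_iff by blast
    then show ?thesis
      using H by (simp add: h1_def e_\<Phi>)
  qed
  moreover have "h1 n F \<noteq> {}"
    using a_rcos_self[of "\<Phi> n F"] F \<Phi>_closed unfolding h1_def by blast
  ultimately show ?thesis
    by (auto simp: H1_map_def)
qed

text \<open>Reduces each limit to an additive invariant \<open>\<tau>\<close> of derivations: the
  trace in the two integral cases, a constant map in the symplectic one.\<close>

theorem direct_system_H1:
  fixes K :: "('k, 'c) monoid_scheme" and \<tau> :: "nat \<Rightarrow> 'd \<Rightarrow> 'k"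
  assumes K: "group K"
    and closed: "\<And>n F. F \<in> D n \<Longrightarrow> \<tau> n F \<in> carrier K"
    and add: "\<And>n F H. F \<in> D n \<Longrightarrow> H \<in> D n \<Longrightarrow> \<tau> n (F + H) = \<tau> n F \<otimes>\<^bsub>K\<^esub> \<tau> n H"
    and D': "\<And>n F. F \<in> D' n \<Longrightarrow> \<tau> n F = \<one>\<^bsub>K\<^esub>"
    and Suc: "\<And>n F. F \<in> D n \<Longrightarrow> \<tau> (Suc n) F = \<tau> n F"
    and onto: "\<And>k. k \<in> carrier K \<Longrightarrow> \<exists>n. \<exists>F\<in>D n. \<tau> n F = k"
    and kernel: "\<And>n F. F \<in> D n \<Longrightarrow> \<tau> n F = \<one>\<^bsub>K\<^esub> \<Longrightarrow> \<exists>m\<ge>n. F \<in> D' m"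
  shows "\<exists>t. direct_system (\<lambda>n. H1 scalars (L n)) (\<lambda>n. H1_map scalars (L (Suc n)) (e n)) K t"
proof -
  \<comment> \<open>The choice of representative is immaterial: two of them differ by an element of
    \<open>D' n\<close>, where \<open>\<tau> n\<close> is trivial.\<close>
  define t where "t n X = \<tau> n (SOME F. F \<in> D n \<and> h1 n F = X)" for n X
  have t: "t n (h1 n F) = \<tau> n F" if F: "F \<in> D n" for n F
  proof -
    define H where "H = (SOME H. H \<in> D n \<and> h1 n H = h1 n F)"
    have H: "H \<in> D n" "h1 n H = h1 n F"
      using someI[of "\<lambda>H. H \<in> D n \<and> h1 n H = h1 n F" F] F by (auto simp: H_def)
    have "\<tau> n H = \<tau> n ((H - F) + F)" by simp
    also have "\<dots> = \<tau> n (H - F) \<otimes>\<^bsub>K\<^esub> \<tau> n F"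
      using F H by (intro add) (auto simp: D_diff)
    also have "\<tau> n (H - F) = \<one>\<^bsub>K\<^esub>"
      using F H h1_eq_iff by (intro D') auto
    finally show ?thesis
      using F K closed by (simp add: t_def H_def group.is_monoid monoid.l_one)
  qed
  have tr: "transition (\<lambda>n. H1_map scalars (L (Suc n)) (e n)) m n (h1 m F) = h1 n F"
    if "F \<in> D m" "m \<le> n" for m n F
    using that(2,1) D_mono
    by (induction n rule: dec_induct) (auto simp: transition_Suc intro!: H1_map_h1)
  have "direct_system (\<lambda>n. H1 scalars (L n)) (\<lambda>n. H1_map scalars (L (Suc n)) (e n)) K t"
  proof (rule direct_system.intro)
    fix n
    show "H1_map scalars (L (Suc n)) (e n) \<in> hom (H1 scalars (L n)) (H1 scalars (L (Suc n)))"
      using D_Suc[of n] by (auto simp: hom_def carrier_H1 H1_map_h1 mult_H1 D_add subset_iff)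
    show "t n \<in> hom (H1 scalars (L n)) K"
      by (auto simp: hom_def carrier_H1 mult_H1 t D_add closed add)
  next
    fix n x assume x: "x \<in> carrier (H1 scalars (L n))"
    then obtain F where F: "F \<in> D n" "x = h1 n F" by (auto simp: carrier_H1)
    show "t (Suc n) (H1_map scalars (L (Suc n)) (e n) x) = t n x"
      using F D_Suc[of n] by (auto simp: H1_map_h1 t Suc subset_iff)
    assume "t n x = \<one>\<^bsub>K\<^esub>"
    then obtain m where m: "m \<ge> n" "F \<in> D' m"
      using F kernel by (auto simp: t)
    then have "h1 m F = h1 m 0"
      by (subst h1_eq_iff) (auto simp: D'_def D_zero)
    then show "\<exists>m\<ge>n. transition (\<lambda>n. H1_map scalars (L (Suc n)) (e n)) n m x = \<one>\<^bsub>H1 scalars (L m)\<^esub>"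
      using F m tr by (auto simp: one_H1)
  next
    fix k assume "k \<in> carrier K"
    then show "\<exists>n x. x \<in> carrier (H1 scalars (L n)) \<and> t n x = k"
      using onto t by (force simp: carrier_H1)
  qed (rule group_H1 K)+
  then show ?thesis by (rule exI[of _ t])
qed

end

section \<open>Derivations of free algebras and of their quotients\<close>

definition is_derivation :: "('r \<Rightarrow> 'a \<Rightarrow> 'a) \<Rightarrow> ('a \<Rightarrow> 'a \<Rightarrow> 'a) \<Rightarrow> ('a::plus \<Rightarrow> 'a) \<Rightarrow> bool" where
  "is_derivation sc m F \<longleftrightarrow> (\<forall>u v. F (u + v) = F u + F v) \<and> (\<forall>r u. F (sc r u) = sc r (F u)) \<and>
     (\<forall>u v. F (m u v) = m (F u) v + m u (F v))"

text \<open>Freeness is encoded by its effect on derivations: values on the generators can be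
  prescribed and determine them. The product is merely bilinear, which covers both concatenation of
  words and pairing of trees.\<close>

locale free_algebra = Modules.module sc
  for sc :: "'r::comm_ring_1 \<Rightarrow> 'a::ab_group_add \<Rightarrow> 'a" +
  fixes m :: "'a \<Rightarrow> 'a \<Rightarrow> 'a" (infixl \<open>\<star>\<close> 70) and x :: "'i \<Rightarrow> 'a"
  assumes m_add_left: "(u + v) \<star> w = u \<star> w + v \<star> w"
    and m_add_right: "w \<star> (u + v) = w \<star> u + w \<star> v"
    and m_scale_left: "sc r u \<star> w = sc r (u \<star> w)"
    and m_scale_right: "w \<star> sc r u = sc r (w \<star> u)"
    and deriv_exists: "\<exists>F. is_derivation sc m F \<and> (\<forall>i. F (x i) = f i)"
    and deriv_unique: "is_derivation sc m F \<Longrightarrow> (\<And>i. F (x i) = 0) \<Longrightarrow> F = 0"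
begin

abbreviation deriv :: "('a \<Rightarrow> 'a) \<Rightarrow> bool" where
  "deriv \<equiv> is_derivation sc m"

lemma m_zero_left [simp]: "0 \<star> u = 0" and m_zero_right [simp]: "u \<star> 0 = 0"
  using m_scale_left[of 0 0 u] m_scale_right[of u 0 0] by simp_all

lemma m_neg_left: "(- u) \<star> v = - (u \<star> v)" and m_neg_right: "u \<star> (- v) = - (u \<star> v)"
  using m_scale_left[of "- 1" u v] m_scale_right[of u "- 1" v] by simp_all

lemma m_diff_left: "(u - v) \<star> w = u \<star> w - v \<star> w" and m_diff_right: "w \<star> (u - v) = w \<star> u - w \<star> v"
  using m_add_left[of u "- v" w] m_add_right[of w u "- v"] by (simp_all add: m_neg_left m_neg_right)

lemma deriv_add: "deriv F \<Longrightarrow> F (u + v) = F u + F v"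
  and deriv_scale: "deriv F \<Longrightarrow> F (sc r u) = sc r (F u)"
  and deriv_m: "deriv F \<Longrightarrow> F (u \<star> v) = F u \<star> v + u \<star> F v"
  by (auto simp: is_derivation_def)

lemma deriv_zero: "deriv F \<Longrightarrow> F 0 = 0"
  using deriv_scale[of F 0 0] by simp

lemma deriv_neg: "deriv F \<Longrightarrow> F (- u) = - F u"
  using deriv_scale[of F "- 1" u] by simp

lemma deriv_diff: "deriv F \<Longrightarrow> F (u - v) = F u - F v"
  using deriv_add[of F u "- v"] by (simp add: deriv_neg)

definition scF :: "'r \<Rightarrow> ('a \<Rightarrow> 'a) \<Rightarrow> 'a \<Rightarrow> 'a" where
  "scF r F = (\<lambda>u. sc r (F u))"

definition br :: "('a \<Rightarrow> 'a) \<Rightarrow> ('a \<Rightarrow> 'a) \<Rightarrow> 'a \<Rightarrow> 'a" where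
  "br F H = (\<lambda>u. F (H u) - H (F u))"

definition d :: "('i \<Rightarrow> 'a) \<Rightarrow> 'a \<Rightarrow> 'a" where
  "d f = (SOME F. deriv F \<and> (\<forall>i. F (x i) = f i))"

lemma deriv_d: "deriv (d f)" and d_x [simp]: "d f (x i) = f i"
  using someI_ex[OF deriv_exists[of f]] by (auto simp: d_def)

lemma module_scF: "Modules.module scF"
  by standard (auto simp: scF_def fun_eq_iff scale_right_distrib scale_left_distrib)

sublocale F: Modules.module scF
  by (rule module_scF)

lemma deriv_closed:
  shows deriv_0: "deriv 0"
    and deriv_plus: "deriv F \<Longrightarrow> deriv H \<Longrightarrow> deriv (F + H)"
    and deriv_minus: "deriv F \<Longrightarrow> deriv H \<Longrightarrow> deriv (F - H)"
    and deriv_scF: "deriv F \<Longrightarrow> deriv (scF r F)"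
    and deriv_br: "deriv F \<Longrightarrow> deriv H \<Longrightarrow> deriv (br F H)"
  by (auto simp: is_derivation_def scF_def br_def m_add_left m_add_right m_diff_left m_diff_right
      m_scale_left m_scale_right scale_right_distrib scale_right_diff_distrib mult.commute)

lemma deriv_eqI: "deriv F \<Longrightarrow> deriv H \<Longrightarrow> (\<And>i. F (x i) = H (x i)) \<Longrightarrow> F = H"
  using deriv_unique[of "F - H"] by (simp add: deriv_minus)

section \<open>Subalgebras generated by part of the generators\<close>

inductive_set gen :: "'i set \<Rightarrow> 'a set" for B where
  gen_zero: "0 \<in> gen B"
| gen_x: "i \<in> B \<Longrightarrow> x i \<in> gen B"
| gen_add: "u \<in> gen B \<Longrightarrow> v \<in> gen B \<Longrightarrow> u + v \<in> gen B"
| gen_scale: "u \<in> gen B \<Longrightarrow> sc r u \<in> gen B"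
| gen_m: "u \<in> gen B \<Longrightarrow> v \<in> gen B \<Longrightarrow> u \<star> v \<in> gen B"

lemma gen_neg: "u \<in> gen B \<Longrightarrow> - u \<in> gen B"
  using gen_scale[of u B "- 1"] by simp

lemma gen_diff: "u \<in> gen B \<Longrightarrow> v \<in> gen B \<Longrightarrow> u - v \<in> gen B"
  using gen_add[of u B "- v"] by (simp add: gen_neg)

lemma gen_mono: "B \<subseteq> C \<Longrightarrow> gen B \<subseteq> gen C"
proof
  fix u assume "B \<subseteq> C" "u \<in> gen B"
  from this(2,1) show "u \<in> gen C" by induction (auto intro: gen.intros)
qed

lemma deriv_gen:
  assumes "deriv F" "\<And>i. i \<in> B \<Longrightarrow> F (x i) \<in> gen B" "u \<in> gen B"
  shows "F u \<in> gen B"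
  using assms(3) by induction (auto simp: assms deriv_zero deriv_add deriv_scale deriv_m intro: gen.intros)

lemma deriv_gen_cong:
  assumes "deriv F" "deriv H" "\<And>i. i \<in> B \<Longrightarrow> F (x i) = H (x i)" "u \<in> gen B"
  shows "F u = H u"
  using assms(4) by induction (auto simp: assms deriv_zero deriv_add deriv_scale deriv_m)

lemma deriv_gen_zero: "deriv F \<Longrightarrow> (\<And>i. i \<in> B \<Longrightarrow> F (x i) = 0) \<Longrightarrow> u \<in> gen B \<Longrightarrow> F u = 0"
  using deriv_gen_cong[of F 0 B u] by (simp add: deriv_0)

text \<open>Derivations of the subalgebra on \<open>B\<close>, extended by zero to the other
  generators; in this form the embedding into a larger rank is the inclusion
  \<open>DD_mono\<close>.\<close>

definition DD :: "'i set \<Rightarrow> ('a \<Rightarrow> 'a) set" where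
  "DD B = {F. deriv F \<and> (\<forall>i\<in>B. F (x i) \<in> gen B) \<and> (\<forall>i. i \<notin> B \<longrightarrow> F (x i) = 0)}"

lemma DD_deriv: "F \<in> DD B \<Longrightarrow> deriv F"
  by (simp add: DD_def)

lemma DD_gen:
  assumes F: "F \<in> DD B" and BC: "B \<subseteq> C" and u: "u \<in> gen C"
  shows "F u \<in> gen C"
proof (rule deriv_gen[OF DD_deriv[OF F] _ u])
  fix i assume "i \<in> C"
  show "F (x i) \<in> gen C"
    using F gen_mono[OF BC] by (cases "i \<in> B") (auto simp: DD_def gen_zero)
qed

lemma DD_mono: "B \<subseteq> C \<Longrightarrow> DD B \<subseteq> DD C"
  using gen_mono[of B C] by (auto simp: DD_def gen_zero subset_iff)

lemma subspace_DD: "F.subspace (DD B)"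
  by (auto simp: F.subspace_def DD_def deriv_closed intro: gen.intros) (auto simp: scF_def intro: gen.intros)

lemma br_DD:
  assumes F: "F \<in> DD B" and H: "H \<in> DD B"
  shows "br F H \<in> DD B"
proof -
  have "br F H (x i) \<in> gen B" if "i \<in> B" for i
    unfolding br_def
    by (intro gen_diff DD_gen[OF F order.refl] DD_gen[OF H order.refl] gen_x that)
  moreover have "br F H (x i) = 0" if "i \<notin> B" for i
    using that F H by (simp add: br_def DD_def deriv_zero)
  ultimately show ?thesis
    using F H by (simp add: DD_def deriv_br)
qed

lemma d_DD: "(\<And>i. i \<in> B \<Longrightarrow> f i \<in> gen B) \<Longrightarrow> (\<And>i. i \<notin> B \<Longrightarrow> f i = 0) \<Longrightarrow> d f \<in> DD B"
  by (simp add: DD_def deriv_d)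

end

text \<open>Presents the algebra of rank \<open>n\<close> as an image of \<open>gen (B n)\<close>:
  for tensors \<open>\<pi> n\<close> is the identity, for the free Lie algebra it takes cosets of
  the Lie ideal. The assumption \<open>\<pi>_deriv\<close> amounts to derivations preserving the
  kernel.\<close>

locale free_quotients = free_algebra sc m x
  for sc :: "'r::comm_ring_1 \<Rightarrow> 'a::ab_group_add \<Rightarrow> 'a" and m (infixl \<open>\<star>\<close> 70) and x :: "'i \<Rightarrow> 'a" +
  fixes B :: "nat \<Rightarrow> 'i set" and A :: "nat \<Rightarrow> ('r, 'b, 't) module_scheme"
    and \<pi> :: "nat \<Rightarrow> 'a \<Rightarrow> 'b" and \<iota> :: "nat \<Rightarrow> 'b \<Rightarrow> 'b"
  assumes B_Suc: "B n \<subseteq> B (Suc n)"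
    and \<pi>_onto: "\<pi> n ` gen (B n) = carrier (A n)"
    and \<pi>_zero: "\<pi> n 0 = \<zero>\<^bsub>A n\<^esub>"
    and \<pi>_add: "u \<in> gen (B n) \<Longrightarrow> v \<in> gen (B n) \<Longrightarrow> \<pi> n (u + v) = \<pi> n u \<oplus>\<^bsub>A n\<^esub> \<pi> n v"
    and \<pi>_m: "u \<in> gen (B n) \<Longrightarrow> v \<in> gen (B n) \<Longrightarrow> \<pi> n (u \<star> v) = \<pi> n u \<otimes>\<^bsub>A n\<^esub> \<pi> n v"
    and \<pi>_scale: "u \<in> gen (B n) \<Longrightarrow> \<pi> n (sc r u) = r \<odot>\<^bsub>A n\<^esub> \<pi> n u"
    and \<pi>_deriv: "F \<in> DD (B n) \<Longrightarrow> u \<in> gen (B n) \<Longrightarrow> v \<in> gen (B n) \<Longrightarrow> \<pi> n u = \<pi> n v \<Longrightarrow> \<pi> n (F u) = \<pi> n (F v)"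
    and \<iota>_\<pi>: "u \<in> gen (B n) \<Longrightarrow> \<iota> n (\<pi> n u) = \<pi> (Suc n) u"
begin

lemma \<pi>_closed: "u \<in> gen (B n) \<Longrightarrow> \<pi> n u \<in> carrier (A n)"
  using \<pi>_onto by blast

lemma ball_A: "(\<forall>X\<in>carrier (A n). P X) \<longleftrightarrow> (\<forall>u\<in>gen (B n). P (\<pi> n u))"
  by (simp add: \<pi>_onto[symmetric])

lemma \<pi>_diff:
  assumes "u \<in> gen (B n)" "v \<in> gen (B n)"
  shows "\<pi> n (u - v) = \<pi> n u \<ominus>\<^bsub>A n\<^esub> \<pi> n v"
proof -
  have "\<pi> n (- v) = \<ominus>\<^bsub>A n\<^esub> \<pi> n v"
    by (rule abelian_group_image_neg[where S = "gen (B n)"])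
      (simp_all add: gen_zero gen_add gen_neg \<pi>_onto \<pi>_zero \<pi>_add assms(2))
  then show ?thesis
    using \<pi>_add[OF assms(1) gen_neg[OF assms(2)]] by (simp add: a_minus_def)
qed

text \<open>The derivation induced on the quotient; the chosen preimage is immaterial by
  \<open>\<pi>_deriv\<close>. The restriction to the carrier matches the extensional functions in
  \<open>derivations\<close>.\<close>

definition \<Phi> :: "nat \<Rightarrow> ('a \<Rightarrow> 'a) \<Rightarrow> 'b \<Rightarrow> 'b" where
  "\<Phi> n F = (\<lambda>X\<in>carrier (A n). \<pi> n (F (SOME u. u \<in> gen (B n) \<and> \<pi> n u = X)))"

lemma \<Phi>_\<pi>:
  assumes "F \<in> DD (B n)" "u \<in> gen (B n)"
  shows "\<Phi> n F (\<pi> n u) = \<pi> n (F u)"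
proof -
  define v where "v = (SOME v. v \<in> gen (B n) \<and> \<pi> n v = \<pi> n u)"
  have v: "v \<in> gen (B n) \<and> \<pi> n v = \<pi> n u"
    unfolding v_def using assms(2) by (rule someI[of _ u, OF conjI]) simp
  have "\<pi> n (F v) = \<pi> n (F u)"
    using \<pi>_deriv[OF assms(1) conjunct1[OF v] assms(2) conjunct2[OF v]] .
  then show ?thesis
    using assms by (simp add: \<Phi>_def v_def \<pi>_closed)
qed

lemma \<Phi>_extensional: "\<Phi> n F \<in> extensional (carrier (A n))"
  by (simp add: \<Phi>_def)

lemma extensional_A_eqI:
  assumes "f \<in> extensional (carrier (A n))" "g \<in> extensional (carrier (A n))"
    "\<And>u. u \<in> gen (B n) \<Longrightarrow> f (\<pi> n u) = g (\<pi> n u)"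
  shows "f = g"
proof -
  have "\<forall>X\<in>carrier (A n). f X = g X"
    unfolding ball_A using assms(3) by simp
  then show ?thesis
    using extensionalityI[OF assms(1,2)] by blast
qed

lemma \<Phi>_derivation:
  assumes F: "F \<in> DD (B n)"
  shows "\<Phi> n F \<in> derivations scalars (A n)"
proof -
  note dF = DD_deriv[OF F] and gF = DD_gen[OF F order.refl]
  show ?thesis
    by (simp add: derivations_def PiE_def Pi_iff ball_A \<Phi>_extensional \<Phi>_\<pi>[OF F] gF \<pi>_closed
        \<pi>_add[symmetric] \<pi>_scale[symmetric] \<pi>_m[symmetric] gen_add gen_scale gen_m
        deriv_add[OF dF] deriv_scale[OF dF] deriv_m[OF dF])
qed

lemma derivations_cong:
  assumes D: "D \<in> derivations scalars (A n)" "D' \<in> derivations scalars (A n)"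
    and eq: "\<And>i. i \<in> B n \<Longrightarrow> D (\<pi> n (x i)) = D' (\<pi> n (x i))"
  shows "D = D'"
proof -
  have scale0: "0 \<odot>\<^bsub>A n\<^esub> \<pi> n v = \<zero>\<^bsub>A n\<^esub>" if "v \<in> gen (B n)" for v
    using that by (simp add: \<pi>_scale[symmetric] \<pi>_zero)
  have zero: "E (\<pi> n 0) = \<zero>\<^bsub>A n\<^esub>" if E: "E \<in> derivations scalars (A n)" for E
  proof -
    have *: "\<pi> n 0 \<in> carrier (A n)" using \<pi>_closed[OF gen_zero] .
    then have "E (\<pi> n 0) \<in> carrier (A n)" using E by (auto simp: derivations_def)
    moreover have "\<forall>X\<in>carrier (A n). 0 \<odot>\<^bsub>A n\<^esub> X = \<zero>\<^bsub>A n\<^esub>"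
      unfolding ball_A using scale0 by simp
    ultimately have "0 \<odot>\<^bsub>A n\<^esub> E (\<pi> n 0) = \<zero>\<^bsub>A n\<^esub>"
      by blast
    moreover have "E (0 \<odot>\<^bsub>A n\<^esub> \<pi> n 0) = 0 \<odot>\<^bsub>A n\<^esub> E (\<pi> n 0)"
      using E * by (simp add: derivations_def)
    ultimately show ?thesis using scale0[OF gen_zero] by (simp add: \<pi>_zero)
  qed
  have "D (\<pi> n u) = D' (\<pi> n u)" if "u \<in> gen (B n)" for u
    using that
  proof induction
    case gen_zero
    then show ?case using D by (simp add: zero)
  next
    case (gen_add u v)
    then show ?case using D by (simp add: \<pi>_add \<pi>_closed derivations_def)
  next
    case (gen_scale u r)
    then show ?case using D by (simp add: \<pi>_scale \<pi>_closed derivations_def)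
  next
    case (gen_m u v)
    then show ?case using D by (simp add: \<pi>_m \<pi>_closed derivations_def)
  qed (rule eq)
  then show ?thesis
    using D by (intro extensional_A_eqI) (auto simp: derivations_def PiE_def)
qed

text \<open>Any preimages of the values on the generators extend to a derivation of the free
  algebra, and \<open>derivations_cong\<close> compares the result with \<open>D\<close> on
  generators.\<close>

lemma derivation_lift:
  assumes D: "D \<in> derivations scalars (A n)"
  obtains F where "F \<in> DD (B n)" "\<Phi> n F = D"
proof -
  have "\<forall>i\<in>B n. \<exists>u. u \<in> gen (B n) \<and> \<pi> n u = D (\<pi> n (x i))"
  proof
    fix i assume "i \<in> B n"
    then have "D (\<pi> n (x i)) \<in> carrier (A n)"
      using D \<pi>_closed[OF gen_x] by (auto simp: derivations_def)
    then show "\<exists>u. u \<in> gen (B n) \<and> \<pi> n u = D (\<pi> n (x i))"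
      unfolding \<pi>_onto[symmetric] by auto
  qed
  then obtain f where f: "\<And>i. i \<in> B n \<Longrightarrow> f i \<in> gen (B n) \<and> \<pi> n (f i) = D (\<pi> n (x i))"
    by metis
  define F where "F = d (\<lambda>i. if i \<in> B n then f i else 0)"
  have F: "F \<in> DD (B n)"
    unfolding F_def using f by (intro d_DD) auto
  have "\<Phi> n F = D"
    using \<Phi>_derivation[OF F] D
  proof (rule derivations_cong)
    fix i assume "i \<in> B n"
    then show "\<Phi> n F (\<pi> n (x i)) = D (\<pi> n (x i))"
      using f by (simp add: \<Phi>_\<pi>[OF F] gen_x) (simp add: F_def)
  qed
  with F show thesis by (rule that)
qed

lemma \<Phi>_onto: "\<Phi> n ` DD (B n) = derivations scalars (A n)"
  by (auto simp: \<Phi>_derivation) (metis derivation_lift imageI)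

abbreviation e :: "nat \<Rightarrow> ('b \<Rightarrow> 'b) \<Rightarrow> 'b \<Rightarrow> 'b" where
  "e n \<equiv> extend_derivation scalars (A n) (A (Suc n)) (\<iota> n) ((\<lambda>i. \<pi> (Suc n) (x i)) ` (B (Suc n) - B n))"

text \<open>Resolves the definite description: the images of the old generators together with the
  new ones generate the larger algebra, so \<open>derivations_cong\<close> gives uniqueness.\<close>

lemma extend_\<Phi>:
  assumes F: "F \<in> DD (B n)"
  shows "e n (\<Phi> n F) = \<Phi> (Suc n) F"
  unfolding extend_derivation_def
proof (rule the_equality)
  have F': "F \<in> DD (B (Suc n))" using F DD_mono[OF B_Suc] by blast
  note gF = DD_gen[OF F order.refl] and B' = gen_mono[OF B_Suc, THEN subsetD]
  let ?P = "\<lambda>D'. D' \<in> derivations scalars (A (Suc n)) \<and>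
      (\<forall>X\<in>carrier (A n). D' (\<iota> n X) = \<iota> n (\<Phi> n F X)) \<and>
      (\<forall>Y\<in>(\<lambda>i. \<pi> (Suc n) (x i)) ` (B (Suc n) - B n). D' Y = \<zero>\<^bsub>A (Suc n)\<^esub>)"
  show P: "?P (\<Phi> (Suc n) F)"
    using F by (simp add: ball_A \<Phi>_derivation[OF F'] \<iota>_\<pi> \<Phi>_\<pi>[OF F] \<Phi>_\<pi>[OF F'] gF B' gen_x)
      (simp add: DD_def \<pi>_zero)
  fix D' assume D': "?P D'"
  show "D' = \<Phi> (Suc n) F"
  proof (rule derivations_cong)
    fix i assume i: "i \<in> B (Suc n)"
    show "D' (\<pi> (Suc n) (x i)) = \<Phi> (Suc n) F (\<pi> (Suc n) (x i))"
    proof (cases "i \<in> B n")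
      case True
      then have X: "\<pi> n (x i) \<in> carrier (A n)" by (simp add: \<pi>_closed gen_x)
      have "D' (\<iota> n (\<pi> n (x i))) = \<Phi> (Suc n) F (\<iota> n (\<pi> n (x i)))"
        using D' P X by simp
      then show ?thesis using True by (simp add: \<iota>_\<pi> gen_x)
    next
      case False
      then show ?thesis using D' P i by simp
    qed
  qed (use D' P in auto)
qed

text \<open>A general family \<open>S\<close> is allowed so that one construction yields both the
  full derivation algebras and the symplectic ones.\<close>

lemma derivation_system_restrict:
  assumes "\<And>n. F.subspace (S n)" "\<And>n. S n \<subseteq> DD (B n)" "\<And>n. S n \<subseteq> S (Suc n)"
    and "\<And>n F H. F \<in> S n \<Longrightarrow> H \<in> S n \<Longrightarrow> br F H \<in> S n"
  shows "derivation_system scF S br (\<lambda>n. Der scalars (A n)\<lparr>carrier := \<Phi> n ` S n\<rparr>) e \<Phi>"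
proof -
  note S = assms(2)[THEN subsetD]
  have * : "(\<lambda>X\<in>carrier (A n). g X) \<in> extensional (carrier (A n))" for g :: "'b \<Rightarrow> 'b" and n
    by simp
  have gF: "F u \<in> gen (B n)" if "F \<in> S n" "u \<in> gen (B n)" for F n u
    using that S DD_gen by blast
  have SS: "0 \<in> S n" "F \<in> S n \<Longrightarrow> H \<in> S n \<Longrightarrow> F + H \<in> S n" "F \<in> S n \<Longrightarrow> scF r F \<in> S n" for n F H r
    using assms(1)[of n] by (auto simp: F.subspace_def)
  show ?thesis
  proof unfold_locales
    fix n
    show "F.subspace (S n)" by fact
    show "S n \<subseteq> S (Suc n)" by fact
    show "\<Phi> n ` S n = carrier (Der scalars (A n)\<lparr>carrier := \<Phi> n ` S n\<rparr>)" by simp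
    show "\<Phi> n 0 = \<zero>\<^bsub>Der scalars (A n)\<lparr>carrier := \<Phi> n ` S n\<rparr>\<^esub>"
      using S[OF SS(1)] by (intro extensional_A_eqI[where n = n])
        (auto simp: Der_def \<Phi>_extensional \<Phi>_\<pi> \<pi>_closed \<pi>_zero)
  next
    fix n F H assume FH: "F \<in> S n" "H \<in> S n"
    then show "br F H \<in> S n" by fact
    then show "\<Phi> n (br F H) = \<Phi> n F \<otimes>\<^bsub>Der scalars (A n)\<lparr>carrier := \<Phi> n ` S n\<rparr>\<^esub> \<Phi> n H"
      using FH by (intro extensional_A_eqI[where n = n])
        (auto simp: Der_def \<Phi>_extensional \<Phi>_\<pi> S \<pi>_closed br_def gF \<pi>_diff)
    show "\<Phi> n (F + H) = \<Phi> n F \<oplus>\<^bsub>Der scalars (A n)\<lparr>carrier := \<Phi> n ` S n\<rparr>\<^esub> \<Phi> n H"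
      using FH SS(2)[OF FH] by (intro extensional_A_eqI[where n = n])
        (auto simp: Der_def \<Phi>_extensional \<Phi>_\<pi> S \<pi>_closed gF \<pi>_add)
  next
    fix n F r assume F: "F \<in> S n"
    show "\<Phi> n (scF r F) = r \<odot>\<^bsub>Der scalars (A n)\<lparr>carrier := \<Phi> n ` S n\<rparr>\<^esub> \<Phi> n F"
      using F SS(3)[OF F] by (intro extensional_A_eqI[where n = n])
        (auto simp: Der_def \<Phi>_extensional \<Phi>_\<pi> S \<pi>_closed gF \<pi>_scale scF_def)
    show "e n (\<Phi> n F) = \<Phi> (Suc n) F"
      using F S by (intro extend_\<Phi>) auto
  qed
qed

lemma derivation_system_Der: "derivation_system scF (\<lambda>n. DD (B n)) br (\<lambda>n. Der scalars (A n)) e \<Phi>"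
proof -
  have "Der scalars (A n)\<lparr>carrier := \<Phi> n ` DD (B n)\<rparr> = Der scalars (A n)" for n
    by (simp add: \<Phi>_onto Der_def)
  then show ?thesis
    using derivation_system_restrict[of "\<lambda>n. DD (B n)"] subspace_DD DD_mono[OF B_Suc] br_DD by simp
qed

end

section \<open>Derivations of free algebras over the integers\<close>

lemma sum_fun_apply: "(\<Sum>i\<in>I. f i) u = (\<Sum>i\<in>I. f i u)"
  for f :: "'i \<Rightarrow> 'a \<Rightarrow> 'b::comm_monoid_add"
  by (induction I rule: infinite_finite_induct) simp_all

text \<open>\<open>lc i\<close> reads off the coefficient of \<open>x i\<close> in the linear part of an element.\<close>

locale integral_free_quotients = free_quotients sc m x "\<lambda>n. {1..n}" A \<pi> \<iota>
  for sc :: "int \<Rightarrow> 'a::ab_group_add \<Rightarrow> 'a" and m (infixl \<open>\<star>\<close> 70) and x :: "nat \<Rightarrow> 'a"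
    and A :: "nat \<Rightarrow> (int, 'b, 't) module_scheme" and \<pi> \<iota> +
  fixes lc :: "nat \<Rightarrow> 'a \<Rightarrow> int"
  assumes lc_add: "lc i (u + v) = lc i u + lc i v"
    and lc_scale: "lc i (sc r u) = r * lc i u"
    and lc_m: "u \<in> gen B \<Longrightarrow> v \<in> gen B \<Longrightarrow> lc i (u \<star> v) = 0"
    and lc_x: "lc i (x j) = (if i = j then 1 else 0)"
    and lc_\<pi>: "u \<in> gen {1..n} \<Longrightarrow> i \<in> {1..n} \<Longrightarrow> \<pi> n u = \<zero>\<^bsub>A n\<^esub> \<Longrightarrow> lc i u = 0"
begin

declare One_nat_def [simp del]

lemma lc_zero [simp]: "lc i 0 = 0"
  using lc_scale[of i 0 0] by simp

lemma lc_diff: "lc i (u - v) = lc i u - lc i v"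
  using lc_add[of i "u - v" v] by simp

definition E :: "nat \<Rightarrow> 'a \<Rightarrow> 'a \<Rightarrow> 'a" where
  "E i y = d (\<lambda>j. if j = i then y else 0)"

lemma deriv_E: "deriv (E i y)" and E_x [simp]: "E i y (x j) = (if j = i then y else 0)"
  by (simp_all add: E_def deriv_d)

lemma E_gen: "i \<notin> B \<Longrightarrow> u \<in> gen B \<Longrightarrow> E i y u = 0"
  by (rule deriv_gen_zero[OF deriv_E]) auto

lemma E_DD: "i \<in> B \<Longrightarrow> y \<in> gen B \<Longrightarrow> E i y \<in> DD B"
  by (auto simp: DD_def deriv_E gen_zero)

lemma E_add: "E i (y + z) = E i y + E i z"
  by (rule deriv_eqI) (auto simp: deriv_E deriv_plus)

lemma E_scale: "E i (sc r y) = scF r (E i y)"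
  by (intro deriv_eqI deriv_scF deriv_E) (simp add: scF_def)

lemma E_zero: "E i 0 = 0"
  by (rule deriv_eqI) (auto simp: deriv_E deriv_0)

lemma DD_eq_sum:
  assumes F: "F \<in> DD {1..n}"
  shows "F = (\<Sum>i\<in>{1..n}. E i (F (x i)))"
proof (rule deriv_eqI)
  show "deriv F" using F by (rule DD_deriv)
  have "F.subspace (Collect deriv)"
    by (auto simp: F.subspace_def deriv_closed)
  then have "(\<Sum>i\<in>{1..n}. E i (F (x i))) \<in> Collect deriv"
    by (rule F.subspace_sum) (simp add: deriv_E)
  then show "deriv (\<Sum>i\<in>{1..n}. E i (F (x i)))" by simp
  show "F (x j) = (\<Sum>i\<in>{1..n}. E i (F (x i))) (x j)" for j
    using F by (auto simp: sum_fun_apply DD_def)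
qed

section \<open>Derivations of rank n modulo brackets of rank n + 2\<close>

context
  fixes n :: nat and S :: "('a \<Rightarrow> 'a) set"
  assumes S: "F.subspace S"
    and br_S: "F \<in> DD {1..Suc (Suc n)} \<Longrightarrow> H \<in> DD {1..Suc (Suc n)} \<Longrightarrow> br F H \<in> S"
begin

lemma zero_S: "(\<lambda>u. 0) \<in> S"
  using F.subspace_0[OF S] by (simp only: zero_fun_def)

lemma gen_two_more: "u \<in> gen {1..n} \<Longrightarrow> u \<in> gen {1..Suc (Suc n)}" "u \<in> gen {1..Suc n} \<Longrightarrow> u \<in> gen {1..Suc (Suc n)}"
    "u \<in> gen {1..n} \<Longrightarrow> u \<in> gen {1..Suc n}"
  using gen_mono[of "{1..n}" "{1..Suc (Suc n)}"] gen_mono[of "{1..Suc n}" "{1..Suc (Suc n)}"]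
    gen_mono[of "{1..n}" "{1..Suc n}"] by auto

text \<open>Bracket \<open>F = E (n + 2) a\<close> with
  \<open>E (n + 1) (x (n + 2) \<star> b)\<close>, or with the factors in the other order. No
  correction term appears: \<open>F\<close> kills \<open>b\<close>, which does not involve
  \<open>x (n + 2)\<close>, and the second derivation kills \<open>a\<close>, which does not involve
  \<open>x (n + 1)\<close>.\<close>

lemma E_product_one_new:
  assumes a: "a \<in> gen {1..n}" and b: "b \<in> gen {1..Suc n}"
  shows "E (Suc n) (a \<star> b) \<in> S" "E (Suc n) (b \<star> a) \<in> S"
proof -
  define F where "F = E (Suc (Suc n)) a"
  have F: "F \<in> DD {1..Suc (Suc n)}" "deriv F"
    unfolding F_def by (intro E_DD gen_two_more(1)[OF a], simp) (rule deriv_E)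
  have q: "x (Suc (Suc n)) \<in> gen {1..Suc (Suc n)}" by (rule gen_x) simp
  have Fb: "E (Suc (Suc n)) a b = 0" by (rule E_gen[OF _ b]) simp
  have ga: "E (Suc n) c a = 0" for c by (rule E_gen[OF _ a]) simp
  have "br F (E (Suc n) (x (Suc (Suc n)) \<star> b)) \<in> S"
    by (intro br_S F E_DD gen_m q gen_two_more(2)[OF b]) simp
  moreover have "br F (E (Suc n) (x (Suc (Suc n)) \<star> b)) = E (Suc n) (a \<star> b)"
  proof (rule deriv_eqI)
    show "br F (E (Suc n) (x (Suc (Suc n)) \<star> b)) (x j) = E (Suc n) (a \<star> b) (x j)" for j
      by (cases "j = Suc n") (simp_all add: br_def F_def deriv_m[OF deriv_E] Fb deriv_zero[OF deriv_E] ga)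
  qed (intro deriv_br F deriv_E)+
  ultimately show "E (Suc n) (a \<star> b) \<in> S" by simp
  have "br F (E (Suc n) (b \<star> x (Suc (Suc n)))) \<in> S"
    by (intro br_S F E_DD gen_m q gen_two_more(2)[OF b]) simp
  moreover have "br F (E (Suc n) (b \<star> x (Suc (Suc n)))) = E (Suc n) (b \<star> a)"
  proof (rule deriv_eqI)
    show "br F (E (Suc n) (b \<star> x (Suc (Suc n)))) (x j) = E (Suc n) (b \<star> a) (x j)" for j
      by (cases "j = Suc n") (simp_all add: br_def F_def deriv_m[OF deriv_E] Fb deriv_zero[OF deriv_E] ga)
  qed (intro deriv_br F deriv_E)+
  ultimately show "E (Suc n) (b \<star> a) \<in> S" by simp
qed

lemma E_product:
  assumes i: "i \<in> {1..n}" and y: "y \<in> gen {1..n}" and z: "z \<in> gen {1..n}"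
  shows "E i (y \<star> z) \<in> S"
proof -
  define F where "F = E (Suc n) y"
  define H where "H = E i (x (Suc n) \<star> z)"
  have p: "x (Suc n) \<in> gen {1..Suc n}" by (rule gen_x) simp
  have d: "deriv F" "deriv H" by (simp_all add: F_def H_def deriv_E)
  have HD: "H \<in> DD {1..Suc n}"
    unfolding H_def using i by (intro E_DD gen_m p gen_two_more(3)[OF z]) simp
  have FD: "F \<in> DD {1..Suc (Suc n)}" "H \<in> DD {1..Suc (Suc n)}"
    unfolding F_def using E_DD[OF _ gen_two_more(1)[OF y]] HD DD_mono[of "{1..Suc n}" "{1..Suc (Suc n)}"] by auto
  have Fz: "F z = 0" unfolding F_def by (rule E_gen[OF _ z]) simp
  have Fx: "F (x j) = (if j = Suc n then y else 0)" and Hx: "H (x j) = (if j = i then x (Suc n) \<star> z else 0)" for j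
    by (simp_all add: F_def H_def)
  have Fm: "F (x (Suc n) \<star> z) = y \<star> z"
    by (simp add: deriv_m[OF d(1)] Fx Fz)
  have "E i (y \<star> z) = br F H + E (Suc n) (H y)"
  proof (rule deriv_eqI)
    have "i \<noteq> Suc n" using i by simp
    then show "E i (y \<star> z) (x j) = (br F H + E (Suc n) (H y)) (x j)" for j
      by (cases "j = i"; cases "j = Suc n") (simp_all add: br_def Fx Hx Fm deriv_zero[OF d(1)] deriv_zero[OF d(2)])
  qed (intro deriv_plus deriv_br d deriv_E)+
  \<comment> \<open>\<open>H\<close> replaces one generator by \<open>x (Suc n) \<star> z\<close>,
    so by the Leibniz rule \<open>H v\<close> is a combination of products with one factor in the
    old generators; \<open>E_product_one_new\<close> handles each.\<close>
  moreover have "E (Suc n) (H v) \<in> S" if "v \<in> gen {1..n}" for v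
    using that
  proof induction
    case gen_zero
    then show ?case using S by (simp add: deriv_zero[OF d(2)] E_zero zero_S)
  next
    case (gen_x j)
    then show ?case
      using E_product_one_new[OF z p] by (simp add: Hx E_zero zero_S)
  next
    case (gen_add u v)
    show ?case unfolding deriv_add[OF d(2)] E_add by (intro F.subspace_add[OF S] gen_add.IH)
  next
    case (gen_scale u r)
    show ?case unfolding deriv_scale[OF d(2)] E_scale by (intro F.subspace_scale[OF S] gen_scale.IH)
  next
    case (gen_m u v)
    then have "H u \<in> gen {1..Suc n}" "H v \<in> gen {1..Suc n}"
      using DD_gen[OF HD order.refl] gen_two_more by auto
    then show ?case
      unfolding deriv_m[OF d(2)] E_add by (intro F.subspace_add[OF S] E_product_one_new gen_m.hyps)
  qed
  ultimately show ?thesis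
    using F.subspace_add[OF S br_S[OF FD]] y by (simp only:)
qed

text \<open>On linear parts \<open>E i (x j)\<close> is an elementary matrix, and an off-diagonal
  elementary matrix is a commutator with a diagonal one.\<close>

lemma E_x_off_diagonal:
  assumes "i \<in> {1..n}" "j \<in> {1..n}" "i \<noteq> j"
  shows "E i (x j) \<in> S"
proof -
  have "br (E j (x j)) (E i (x j)) \<in> S"
    using assms by (intro br_S E_DD gen_x) auto
  also have "br (E j (x j)) (E i (x j)) = E i (x j)"
    using assms by (intro deriv_eqI deriv_br deriv_E) (auto simp: br_def deriv_zero[OF deriv_E])
  finally show ?thesis .
qed

text \<open>The commutator of two opposite elementary matrices is a difference of diagonal ones; all
  diagonal ones are thus compared with the reference \<open>E 1 (x 1)\<close>.\<close>

lemma E_x_diagonal: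
  assumes i: "i \<in> {1..n}"
  shows "E i (x i) - E 1 (x 1) \<in> S"
proof (cases "i = 1")
  case True
  then show ?thesis by (simp only: diff_self F.subspace_0[OF S])
next
  case False
  have "br (E 1 (x i)) (E i (x 1)) \<in> S"
    using i by (intro br_S E_DD gen_x) auto
  also have "br (E 1 (x i)) (E i (x 1)) = E i (x i) - E 1 (x 1)"
    using False by (intro deriv_eqI deriv_br deriv_minus deriv_E) (auto simp: br_def deriv_zero[OF deriv_E])
  finally show ?thesis .
qed

lemma E_modulo_S:
  assumes i: "i \<in> {1..n}" and y: "y \<in> gen {1..n}"
  shows "E i y - scF (lc i y) (E 1 (x 1)) \<in> S"
  using y
proof induction
  case gen_zero
  then show ?case using S by (simp add: E_zero zero_S)
next
  case (gen_x j)
  show ?case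
  proof (cases "i = j")
    case True
    then show ?thesis using E_x_diagonal[OF i] by (simp only: lc_x simp_thms if_True F.scale_one)
  next
    case False
    then show ?thesis
      using E_x_off_diagonal[OF i gen_x False]
      by (simp only: lc_x if_False F.scale_zero_left diff_0_right)
  qed
next
  case (gen_add u v)
  have "E i (u + v) - scF (lc i (u + v)) (E 1 (x 1)) =
      (E i u - scF (lc i u) (E 1 (x 1))) + (E i v - scF (lc i v) (E 1 (x 1)))"
    by (simp add: E_add lc_add F.scale_left_distrib)
  then show ?case using F.subspace_add[OF S gen_add.IH] by (simp only:)
next
  case (gen_scale u r)
  have "E i (sc r u) - scF (lc i (sc r u)) (E 1 (x 1)) = scF r (E i u - scF (lc i u) (E 1 (x 1)))"
    by (simp add: E_scale lc_scale F.scale_right_diff_distrib)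
  then show ?case using F.subspace_scale[OF S gen_scale.IH] by (simp only:)
next
  case (gen_m u v)
  then show ?case using E_product[OF i] by (simp add: lc_m[where B = "{1..n}"])
qed

end

section \<open>The trace and the integral limits\<close>

definition tr :: "nat \<Rightarrow> ('a \<Rightarrow> 'a) \<Rightarrow> int" where
  "tr n F = (\<Sum>i\<in>{1..n}. lc i (F (x i)))"

lemma tr_modulo:
  assumes S: "F.subspace S"
    and br_S: "\<And>F H. F \<in> DD {1..Suc (Suc n)} \<Longrightarrow> H \<in> DD {1..Suc (Suc n)} \<Longrightarrow> br F H \<in> S"
    and F: "F \<in> DD {1..n}"
  shows "F - scF (tr n F) (E 1 (x 1)) \<in> S"
proof -
  have "F - scF (tr n F) (E 1 (x 1)) = (\<Sum>i\<in>{1..n}. E i (F (x i)) - scF (lc i (F (x i))) (E 1 (x 1)))"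
    by (subst DD_eq_sum[OF F]) (simp add: tr_def F.scale_sum_left sum_subtractf)
  also have "\<dots> \<in> S"
    using F by (intro F.subspace_sum[OF S] E_modulo_S[OF S br_S]) (auto simp: DD_def)
  finally show ?thesis .
qed

text \<open>The linear part of \<open>F u\<close> depends only on the linear part of
  \<open>u\<close>, through the matrix of \<open>F\<close>: in the absence of constant terms,
  derivations send products to sums of products.\<close>

lemma lc_deriv:
  assumes F: "F \<in> DD {1..n}" and u: "u \<in> gen {1..n}"
  shows "lc i (F u) = (\<Sum>j\<in>{1..n}. lc j u * lc i (F (x j)))"
  using u
proof induction
  case (gen_x k)
  have "(\<Sum>j\<in>{1..n}. lc j (x k) * lc i (F (x j))) = (\<Sum>j\<in>{1..n}. if j = k then lc i (F (x j)) else 0)"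
    by (intro sum.cong) (auto simp: lc_x)
  also have "\<dots> = lc i (F (x k))" using gen_x by simp
  finally show ?case by simp
next
  case (gen_m u v)
  then show ?case
    using DD_gen[OF F order.refl]
    by (simp add: deriv_m[OF DD_deriv[OF F]] lc_add lc_m[where B = "{1..n}"])
qed (simp_all add: deriv_zero[OF DD_deriv[OF F]] deriv_add[OF DD_deriv[OF F]] deriv_scale[OF DD_deriv[OF F]]
      lc_add lc_scale sum.distrib distrib_right sum_distrib_left mult.assoc)

text \<open>The identity tr(AB) = tr(BA) for the matrices of \<open>F\<close> and \<open>H\<close>,
  as an exchange of summations.\<close>

lemma tr_br:
  assumes F: "F \<in> DD {1..n}" and H: "H \<in> DD {1..n}"
  shows "tr n (br F H) = 0"
proof -
  have *: "lc i (P (Q (x i))) = (\<Sum>j\<in>{1..n}. lc j (Q (x i)) * lc i (P (x j)))"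
    if "P \<in> DD {1..n}" "Q \<in> DD {1..n}" "i \<in> {1..n}" for P Q i
    using that by (intro lc_deriv) (auto simp: DD_def)
  have "tr n (br F H) = (\<Sum>i\<in>{1..n}. \<Sum>j\<in>{1..n}. lc j (H (x i)) * lc i (F (x j)))
      - (\<Sum>i\<in>{1..n}. \<Sum>j\<in>{1..n}. lc j (F (x i)) * lc i (H (x j)))"
    by (simp add: tr_def br_def lc_diff sum_subtractf *[OF F H] *[OF H F])
  also have "(\<Sum>i\<in>{1..n}. \<Sum>j\<in>{1..n}. lc j (F (x i)) * lc i (H (x j))) =
      (\<Sum>i\<in>{1..n}. \<Sum>j\<in>{1..n}. lc j (H (x i)) * lc i (F (x j)))"
    by (subst sum.swap) (simp add: mult.commute)
  finally show ?thesis by simp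
qed

theorem direct_limit_Der:
  "direct_limit (\<lambda>n. H1 scalars (Der scalars (A n)))
     (\<lambda>n. H1_map scalars (Der scalars (A (Suc n))) (e n)) \<cong> integer_group"
proof -
  interpret DS: derivation_system scF "\<lambda>n. DD {1..n}" br "\<lambda>n. Der scalars (A n)" e \<Phi>
    by (rule derivation_system_Der)
  have "\<exists>t. direct_system (\<lambda>n. H1 scalars (Der scalars (A n)))
      (\<lambda>n. H1_map scalars (Der scalars (A (Suc n))) (e n)) integer_group t"
  proof (rule DS.direct_system_H1[where \<tau> = tr])
    show "tr n (F + H) = tr n F \<otimes>\<^bsub>integer_group\<^esub> tr n H" for n F H
      by (simp add: tr_def lc_add sum.distrib)
    show "tr (Suc n) F = tr n F" if "F \<in> DD {1..n}" for n F
      using that by (simp add: tr_def DD_def)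
    show "tr n F = \<one>\<^bsub>integer_group\<^esub>" if "F \<in> DS.D' n" for n F
    proof -
      have sub: "F.subspace {F. tr n F = 0}"
        by (auto simp: F.subspace_def tr_def lc_add lc_scale sum.distrib scF_def sum_distrib_left[symmetric])
      \<comment> \<open>A derivation in the kernel of \<open>\<Phi> n\<close> sends generators into
        the kernel of \<open>\<pi> n\<close>, which has no linear part.\<close>
      have "tr n F = 0" if F: "F \<in> DD {1..n}" "\<Phi> n F = \<zero>\<^bsub>Der scalars (A n)\<^esub>" for F
      proof -
        have "lc i (F (x i)) = 0" if i: "i \<in> {1..n}" for i
        proof (rule lc_\<pi>[OF _ i])
          show "F (x i) \<in> gen {1..n}" using F i by (simp add: DD_def)
          have "\<pi> n (F (x i)) = \<Phi> n F (\<pi> n (x i))"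
            using F(1) i by (intro \<Phi>_\<pi>[symmetric] gen_x)
          then show "\<pi> n (F (x i)) = \<zero>\<^bsub>A n\<^esub>"
            using F i by (simp add: Der_def \<pi>_closed gen_x)
        qed
        then show ?thesis by (simp add: tr_def)
      qed
      then have "DS.D' n \<subseteq> {F. tr n F = 0}"
        by (intro DS.D'_span[OF sub]) (auto simp: tr_br)
      with that show ?thesis by auto
    qed
    show "\<exists>n. \<exists>F\<in>DD {1..n}. tr n F = k" if "k \<in> carrier integer_group" for k
    proof (intro exI bexI)
      show "scF k (E 1 (x 1)) \<in> DD {1..1}"
        by (intro F.subspace_scale[OF subspace_DD] E_DD gen_x) auto
      show "tr 1 (scF k (E 1 (x 1))) = k"
        by (simp add: tr_def scF_def lc_scale lc_x)
    qed
    show "\<exists>m\<ge>n. F \<in> DS.D' m" if "F \<in> DD {1..n}" "tr n F = \<one>\<^bsub>integer_group\<^esub>" for n F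
    proof (intro exI conjI)
      \<comment> \<open>Two further generators are the room that \<open>tr_modulo\<close> asks for;
        with trace zero nothing is subtracted from \<open>F\<close>.\<close>
      show "F \<in> DS.D' (Suc (Suc n))"
        using tr_modulo[OF DS.subspace_D' DS.br_in_D' that(1)] that(2) by simp
    qed simp
  qed simp_all
  then obtain t where "direct_system (\<lambda>n. H1 scalars (Der scalars (A n)))
      (\<lambda>n. H1_map scalars (Der scalars (A (Suc n))) (e n)) integer_group t" ..
  then have "integer_group \<cong> direct_limit (\<lambda>n. H1 scalars (Der scalars (A n)))
      (\<lambda>n. H1_map scalars (Der scalars (A (Suc n))) (e n))"
    by (rule direct_system.iso_direct_limit)
  then show ?thesis
    by (rule group.iso_sym[OF group_integer_group])
qed

end

section \<open>Linear extension\<close>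

definition pscale :: "'r::comm_ring_1 \<Rightarrow> ('w \<Rightarrow>\<^sub>0 'r) \<Rightarrow> ('w \<Rightarrow>\<^sub>0 'r)" where
  "pscale r = Poly_Mapping.map ((*) r)"

abbreviation word :: "'w \<Rightarrow> ('w \<Rightarrow>\<^sub>0 'r::comm_ring_1)" where
  "word w \<equiv> Poly_Mapping.single w 1"

lemma lookup_pscale [simp]: "Poly_Mapping.lookup (pscale r p) w = r * Poly_Mapping.lookup p w"
  by (simp add: pscale_def map.rep_eq when_def)

lemma pscale_single [simp]: "pscale r (Poly_Mapping.single w c) = Poly_Mapping.single w (r * c)"
  by (rule poly_mapping_eqI) (simp add: lookup_single when_def)

lemma keys_pscale: "Poly_Mapping.keys (pscale r p) \<subseteq> Poly_Mapping.keys p"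
  by (auto simp: in_keys_iff)

interpretation pscale: Modules.module "pscale :: 'r::comm_ring_1 \<Rightarrow> ('w \<Rightarrow>\<^sub>0 'r) \<Rightarrow> _"
  by standard (auto intro!: poly_mapping_eqI simp: lookup_add algebra_simps)

definition lin :: "('w \<Rightarrow> ('v \<Rightarrow>\<^sub>0 'r)) \<Rightarrow> ('w \<Rightarrow>\<^sub>0 'r::comm_ring_1) \<Rightarrow> ('v \<Rightarrow>\<^sub>0 'r)" where
  "lin h p = (\<Sum>w\<in>Poly_Mapping.keys p. pscale (Poly_Mapping.lookup p w) (h w))"

lemma lin_superset:
  assumes "finite S" "Poly_Mapping.keys p \<subseteq> S"
  shows "lin h p = (\<Sum>w\<in>S. pscale (Poly_Mapping.lookup p w) (h w))"
  unfolding lin_def using assms by (intro sum.mono_neutral_left) (auto simp: in_keys_iff)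

lemma lin_single [simp]: "lin h (Poly_Mapping.single w c) = pscale c (h w)"
  by (subst lin_superset[of "{w}"]) auto

lemma lin_zero [simp]: "lin h 0 = 0"
  by (simp add: lin_def)

lemma lin_add: "lin h (p + q) = lin h p + lin h q"
  unfolding lin_def by (rule setsum_keys_plus_distrib) (simp_all add: pscale.scale_left_distrib)

lemma lin_pscale: "lin h (pscale r p) = pscale r (lin h p)"
  by (subst lin_superset[OF _ keys_pscale])
    (simp_all only: finite_keys lin_def pscale.scale_sum_right lookup_pscale pscale.scale_scale)

lemma lin_fun_add: "lin (\<lambda>w. h w + k w) p = lin h p + lin k p"
  by (simp add: lin_def pscale.scale_right_distrib sum.distrib)

lemma lin_fun_pscale: "lin (\<lambda>w. pscale r (h w)) p = pscale r (lin h p)"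
  by (simp add: lin_def pscale.scale_sum_right mult.commute)

lemma lin_word: "lin word p = p"
proof (rule poly_mapping_eqI)
  fix w
  have "Poly_Mapping.lookup (lin word p) w =
      (\<Sum>v\<in>Poly_Mapping.keys p. if v = w then Poly_Mapping.lookup p v else 0)"
    by (auto simp: lin_def lookup_sum lookup_single when_def intro!: sum.cong)
  then show "Poly_Mapping.lookup (lin word p) w = Poly_Mapping.lookup p w"
    by (simp add: in_keys_iff)
qed

lemma word_induct [consumes 1, case_names zero add scale word]:
  assumes "Poly_Mapping.keys p \<subseteq> S"
    and "P 0" "\<And>p q. P p \<Longrightarrow> P q \<Longrightarrow> P (p + q)" "\<And>r p. P p \<Longrightarrow> P (pscale r p)"
    and "\<And>w. w \<in> S \<Longrightarrow> P (word w)"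
  shows "P p"
proof -
  have "P (\<Sum>w\<in>I. pscale (c w) (word w))" if "finite I" "I \<subseteq> S" for c I
    using that by (induction I rule: finite_induct) (auto intro!: assms(2-5) simp del: pscale_single)
  then have "P (lin word p)"
    using assms(1) by (simp add: lin_def del: pscale_single)
  then show ?thesis by (simp add: lin_word)
qed

text \<open>The product of \<open>magma_algebra S opr\<close> does not mention \<open>S\<close>, so
  one product on the whole type serves all ranks.\<close>

definition magma_mult :: "('w \<Rightarrow> 'w \<Rightarrow> 'w) \<Rightarrow> ('w \<Rightarrow>\<^sub>0 'r) \<Rightarrow> ('w \<Rightarrow>\<^sub>0 'r) \<Rightarrow> ('w \<Rightarrow>\<^sub>0 'r::comm_ring_1)" where
  "magma_mult opr p q = p \<otimes>\<^bsub>magma_algebra UNIV opr\<^esub> q"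

lemma magma_mult_lin: "magma_mult opr p q = lin (\<lambda>u. lin (\<lambda>v. word (opr u v)) q) p"
  by (simp add: magma_mult_def magma_algebra_def lin_def pscale.scale_sum_right)

lemma magma_mult_word [simp]: "magma_mult opr (word u) (word v) = word (opr u v)"
  by (simp add: magma_mult_lin)

lemma magma_mult_add_left: "magma_mult opr (p + q) r = magma_mult opr p r + magma_mult opr q r"
  and magma_mult_add_right: "magma_mult opr r (p + q) = magma_mult opr r p + magma_mult opr r q"
  and magma_mult_scale_left: "magma_mult opr (pscale c p) q = pscale c (magma_mult opr p q)"
  and magma_mult_scale_right: "magma_mult opr p (pscale c q) = pscale c (magma_mult opr p q)"
  by (simp_all add: magma_mult_lin lin_add lin_fun_add lin_pscale lin_fun_pscale)

lemma magma_mult_zero: "magma_mult opr 0 p = 0" "magma_mult opr p 0 = 0"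
  using magma_mult_scale_left[of opr 0 0 p] magma_mult_scale_right[of opr p 0 0] by simp_all

lemma magma_algebra_sel:
  "carrier (magma_algebra S opr) = {p. Poly_Mapping.keys p \<subseteq> S}"
  "p \<otimes>\<^bsub>magma_algebra S opr\<^esub> q = magma_mult opr p q"
  "p \<oplus>\<^bsub>magma_algebra S opr\<^esub> q = p + q"
  "\<zero>\<^bsub>magma_algebra S opr\<^esub> = 0"
  "r \<odot>\<^bsub>magma_algebra S opr\<^esub> p = pscale r p"
  by (simp_all add: magma_algebra_def magma_mult_def pscale_def)

section \<open>Tensor algebras\<close>

text \<open>With concatenation as addition of words, the tensor algebra with unit is a ring.\<close>

instantiation list :: (type) monoid_add
begin

definition "0 = []"
definition "u + v = u @ v"

instance
  by standard (simp_all add: zero_list_def plus_list_def)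

end

lemma word_mult [simp]: "word u * word v = (word (u @ v) :: 'b list \<Rightarrow>\<^sub>0 'r::comm_ring_1)"
  by (simp add: mult_single plus_list_def)

lemma word_Nil: "word [] = (1 :: 'b list \<Rightarrow>\<^sub>0 'r::comm_ring_1)"
  by (simp add: zero_list_def[symmetric])

lemma times_eq_magma_mult: "p * q = magma_mult (@) p (q :: 'b list \<Rightarrow>\<^sub>0 'r::comm_ring_1)"
proof -
  have sum_words: "p = (\<Sum>w\<in>Poly_Mapping.keys p. Poly_Mapping.single w (Poly_Mapping.lookup p w))"
    for p :: "'b list \<Rightarrow>\<^sub>0 'r"
  proof -
    have "lin word p = (\<Sum>w\<in>Poly_Mapping.keys p. Poly_Mapping.single w (Poly_Mapping.lookup p w))"
      by (simp add: lin_def)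
    then show ?thesis by (simp only: lin_word)
  qed
  have "p * q = (\<Sum>w\<in>Poly_Mapping.keys p. Poly_Mapping.single w (Poly_Mapping.lookup p w)) *
      (\<Sum>w\<in>Poly_Mapping.keys q. Poly_Mapping.single w (Poly_Mapping.lookup q w))"
    by (rule arg_cong2[where f = "(*)", OF sum_words sum_words])
  then show ?thesis
    by (simp add: magma_mult_def magma_algebra_def sum_product mult_single plus_list_def)
qed

lemma pscale_times_left: "pscale c p * q = pscale c (p * q)"
  and pscale_times_right: "p * pscale c q = pscale c (p * q)"
  for p q :: "'b list \<Rightarrow>\<^sub>0 'r::comm_ring_1"
  by (simp_all add: times_eq_magma_mult magma_mult_scale_left magma_mult_scale_right)

primrec word_deriv :: "('b \<Rightarrow> ('b list \<Rightarrow>\<^sub>0 'r)) \<Rightarrow> 'b list \<Rightarrow> ('b list \<Rightarrow>\<^sub>0 'r::comm_ring_1)" where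
  "word_deriv f [] = 0"
| "word_deriv f (b # w) = f b * word w + word [b] * word_deriv f w"

lemma word_deriv_append:
  fixes f :: "'b \<Rightarrow> ('b list \<Rightarrow>\<^sub>0 'r::comm_ring_1)"
  shows "word_deriv f (u @ v) = word_deriv f u * word v + word u * word_deriv f v"
proof (induction u)
  case (Cons b u)
  have "word [b] * (word u * q) = word (b # u) * q" for q :: "'b list \<Rightarrow>\<^sub>0 'r"
    by (simp add: mult.assoc[symmetric])
  then show ?case
    using Cons by (simp add: algebra_simps)
qed (simp add: word_Nil)

lemma is_derivation_word_deriv:
  fixes f :: "'b \<Rightarrow> ('b list \<Rightarrow>\<^sub>0 'r::comm_ring_1)"
  shows "is_derivation pscale (*) (lin (word_deriv f))"
  unfolding is_derivation_def
proof (intro conjI allI)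
  fix p q :: "'b list \<Rightarrow>\<^sub>0 'r"
  have *: "lin (word_deriv f) (word u * q) = word_deriv f u * q + word u * lin (word_deriv f) q" for u
    by (induction q rule: word_induct[OF subset_UNIV])
      (auto simp: word_deriv_append lin_add lin_pscale pscale_times_right distrib_left pscale.scale_right_distrib)
  show "lin (word_deriv f) (p * q) = lin (word_deriv f) p * q + p * lin (word_deriv f) q"
    by (induction p rule: word_induct[OF subset_UNIV])
      (auto simp: * lin_add lin_pscale pscale_times_left distrib_right pscale.scale_right_distrib)
qed (simp_all add: lin_add lin_pscale)

interpretation words: free_algebra pscale "(*)" "\<lambda>b. word [b] :: 'b list \<Rightarrow>\<^sub>0 'r::comm_ring_1"
proof
  show "\<exists>F. is_derivation pscale (*) F \<and> (\<forall>b. F (word [b]) = f b)" for f :: "'b \<Rightarrow> ('b list \<Rightarrow>\<^sub>0 'r)"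
    by (rule exI[of _ "lin (word_deriv f)"]) (simp add: is_derivation_word_deriv word_Nil)
next
  fix F :: "('b list \<Rightarrow>\<^sub>0 'r) \<Rightarrow> _"
  assume F: "is_derivation pscale (*) F" "\<And>b. F (word [b]) = 0"
  have F1: "F (u + v) = F u + F v" "F (pscale r u) = pscale r (F u)" "F (u * v) = F u * v + u * F v" for u v r
    using F(1) by (auto simp: is_derivation_def)
  \<comment> \<open>The ambient ring has a unit, which lies outside the algebra generated by the
    letters; a derivation kills it since 1 = 1 * 1.\<close>
  have one: "F 1 = 0" using F1(3)[of 1 1] by simp
  have "F (word w) = 0" for w
  proof (induction w)
    case (Cons b w)
    have "F (word (b # w)) = F (word [b] * word w)" by simp
    then show ?case using Cons F(2) by (simp only: F1) simp
  qed (simp add: word_Nil one)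
  then have "F p = 0" for p
    using F1(2)[of 0 0] by (induction p rule: word_induct[OF subset_UNIV]) (auto simp: F1)
  then show "F = 0" by (simp add: fun_eq_iff)
qed (simp_all add: distrib_left distrib_right pscale_times_left pscale_times_right)

text \<open>The generated subalgebra excludes the unit of the ambient ring, so it is the tensor
  algebra without constant terms.\<close>

lemma gen_words:
  "words.gen B = {p :: 'b list \<Rightarrow>\<^sub>0 'r::comm_ring_1. Poly_Mapping.keys p \<subseteq> {w. w \<noteq> [] \<and> set w \<subseteq> B}}"
proof (rule equalityI; rule subsetI)
  fix p :: "'b list \<Rightarrow>\<^sub>0 'r"
  assume "p \<in> words.gen B"
  then have "Poly_Mapping.keys p \<subseteq> {w. w \<noteq> [] \<and> set w \<subseteq> B}"
  proof induction
    case (gen_add u v)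
    then show ?case using Poly_Mapping.keys_add[of u v] by blast
  next
    case (gen_scale u r)
    then show ?case using keys_pscale[of r u] by blast
  next
    case (gen_m u v)
    then show ?case using keys_mult[of u v] by (fastforce simp: plus_list_def)
  qed auto
  then show "p \<in> {p. Poly_Mapping.keys p \<subseteq> {w. w \<noteq> [] \<and> set w \<subseteq> B}}" by simp
next
  fix p :: "'b list \<Rightarrow>\<^sub>0 'r"
  assume "p \<in> {p. Poly_Mapping.keys p \<subseteq> {w. w \<noteq> [] \<and> set w \<subseteq> B}}"
  then have "Poly_Mapping.keys p \<subseteq> {w. w \<noteq> [] \<and> set w \<subseteq> B}" by simp
  then show "p \<in> words.gen B"
  proof (induction p rule: word_induct)
    case (word w)
    then have "w \<noteq> []" "set w \<subseteq> B" by auto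
    then show ?case
    proof (induction w rule: list_nonempty_induct)
      case (cons b w)
      have "(word [b] * word w :: 'b list \<Rightarrow>\<^sub>0 'r) \<in> words.gen B"
        using cons by (intro words.gen.intros) auto
      then show ?case by simp
    qed (auto intro: words.gen.intros)
  qed (auto intro: words.gen.intros)
qed

lemma free_quotients_words:
  assumes "\<And>n. B n \<subseteq> B (Suc n)"
  shows "free_quotients pscale (*) (\<lambda>b. word [b] :: 'b list \<Rightarrow>\<^sub>0 'r::comm_ring_1) B (\<lambda>n. tensor_algebra (B n))
    (\<lambda>n p. p) (\<lambda>n p. p)"
  by unfold_locales
    (use assms in \<open>auto simp: tensor_algebra_def magma_algebra_sel gen_words times_eq_magma_mult\<close>)

interpretation T: integral_free_quotients pscale "(*)" "\<lambda>i. word [i]" T "\<lambda>n p. p" "\<lambda>n p. p"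
  "\<lambda>i p. Poly_Mapping.lookup p [i]"
proof -
  interpret free_quotients pscale "(*)" "\<lambda>i. word [i] :: nat list \<Rightarrow>\<^sub>0 int" "\<lambda>n. {1..n}" T "\<lambda>n p. p" "\<lambda>n p. p"
    unfolding T_def by (rule free_quotients_words) auto
  show "integral_free_quotients pscale (*) (\<lambda>i. word [i]) T (\<lambda>n p. p) (\<lambda>n p. p) (\<lambda>i p. Poly_Mapping.lookup p [i])"
  proof unfold_locales
    fix u v :: "nat list \<Rightarrow>\<^sub>0 int" and B i
    assume uv: "u \<in> words.gen B" "v \<in> words.gen B"
    have "[i] \<notin> Poly_Mapping.keys (u * v)"
    proof
      assume "[i] \<in> Poly_Mapping.keys (u * v)"
      then obtain a b where "a \<in> Poly_Mapping.keys u" "b \<in> Poly_Mapping.keys v" "[i] = a @ b"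
        using keys_mult[of u v] by (auto simp: plus_list_def)
      then show False
        using uv by (cases a; cases b) (auto simp: gen_words)
    qed
    then show "Poly_Mapping.lookup (u * v) [i] = 0"
      by (simp add: in_keys_iff)
  qed (auto simp: lookup_add lookup_single when_def T_def tensor_algebra_def magma_algebra_sel)
qed

theorem direct_limit_Der_T:
  "direct_limit (\<lambda>n. H1 Z_ring (Der_T n)) (\<lambda>n. H1_map Z_ring (Der_T (Suc n)) (Der_T_embed n)) \<cong> integer_group"
proof -
  have "{1..Suc n} - {1..n} = {Suc n}" for n by auto
  then show ?thesis
    using T.direct_limit_Der by (simp add: Der_T_def Der_T_embed_def tensor_gen_def)
qed

section \<open>Free Lie algebras\<close>

abbreviation br_mult (infixl \<open>\<star>\<close> 70) where
  "br_mult \<equiv> magma_mult Br"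

primrec tree_deriv :: "('b \<Rightarrow> ('b bracketing \<Rightarrow>\<^sub>0 'r)) \<Rightarrow> 'b bracketing \<Rightarrow> ('b bracketing \<Rightarrow>\<^sub>0 'r::comm_ring_1)" where
  "tree_deriv f (Gen b) = f b"
| "tree_deriv f (Br s t) = tree_deriv f s \<star> word t + word s \<star> tree_deriv f t"

lemma is_derivation_tree_deriv:
  fixes f :: "'b \<Rightarrow> ('b bracketing \<Rightarrow>\<^sub>0 'r::comm_ring_1)"
  shows "is_derivation pscale (\<star>) (lin (tree_deriv f))"
  unfolding is_derivation_def
proof (intro conjI allI)
  fix p q :: "'b bracketing \<Rightarrow>\<^sub>0 'r"
  have *: "lin (tree_deriv f) (word s \<star> q) = tree_deriv f s \<star> q + word s \<star> lin (tree_deriv f) q" for s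
    by (induction q rule: word_induct[OF subset_UNIV])
      (auto simp: lin_add lin_pscale magma_mult_scale_right magma_mult_add_right pscale.scale_right_distrib magma_mult_zero)
  show "lin (tree_deriv f) (p \<star> q) = lin (tree_deriv f) p \<star> q + p \<star> lin (tree_deriv f) q"
    by (induction p rule: word_induct[OF subset_UNIV])
      (auto simp: * lin_add lin_pscale magma_mult_scale_left magma_mult_add_left pscale.scale_right_distrib magma_mult_zero)
qed (simp_all add: lin_add lin_pscale)

interpretation trees: free_algebra pscale "(\<star>)" "\<lambda>b. word (Gen b) :: 'b bracketing \<Rightarrow>\<^sub>0 'r::comm_ring_1"
proof
  show "\<exists>F. is_derivation pscale (\<star>) F \<and> (\<forall>b. F (word (Gen b)) = f b)" for f :: "'b \<Rightarrow> ('b bracketing \<Rightarrow>\<^sub>0 'r)"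
    by (rule exI[of _ "lin (tree_deriv f)"]) (simp add: is_derivation_tree_deriv)
next
  fix F :: "('b bracketing \<Rightarrow>\<^sub>0 'r) \<Rightarrow> _"
  assume F: "is_derivation pscale (\<star>) F" "\<And>b. F (word (Gen b)) = 0"
  have F1: "F (u + v) = F u + F v" "F (pscale r u) = pscale r (F u)" "F (u \<star> v) = F u \<star> v + u \<star> F v" for u v r
    using F(1) by (auto simp: is_derivation_def)
  have "F (word t) = 0" for t
  proof (induction t)
    case (Br s t)
    have "F (word (Br s t)) = F (word s \<star> word t)" by simp
    then show ?case using Br by (simp only: F1) (simp add: magma_mult_zero)
  qed (rule F(2))
  then have "F p = 0" for p
    using F1(2)[of 0 0] by (induction p rule: word_induct[OF subset_UNIV]) (auto simp: F1)
  then show "F = 0" by (simp add: fun_eq_iff)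
qed (simp_all add: magma_mult_add_left magma_mult_add_right magma_mult_scale_left magma_mult_scale_right)

lemma subspace_keys: "pscale.subspace {p. Poly_Mapping.keys p \<subseteq> S}"
  using keys_pscale by (fastforce simp: pscale.subspace_def dest: subsetD[OF Poly_Mapping.keys_add])

lemma keys_magma_mult:
  assumes "\<And>u v. u \<in> S \<Longrightarrow> v \<in> S \<Longrightarrow> opr u v \<in> S"
    and "Poly_Mapping.keys p \<subseteq> S" "Poly_Mapping.keys q \<subseteq> S"
  shows "Poly_Mapping.keys (magma_mult opr p q) \<subseteq> S"
proof -
  have "magma_mult opr p q \<in> {p. Poly_Mapping.keys p \<subseteq> S}"
    unfolding magma_mult_lin lin_def using assms
    by (intro pscale.subspace_sum pscale.subspace_scale subspace_keys) auto
  then show ?thesis by simp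
qed

lemma gen_trees:
  "trees.gen B = {p :: 'b bracketing \<Rightarrow>\<^sub>0 'r::comm_ring_1. Poly_Mapping.keys p \<subseteq> {t. set_bracketing t \<subseteq> B}}"
proof (rule equalityI; rule subsetI)
  fix p :: "'b bracketing \<Rightarrow>\<^sub>0 'r"
  assume "p \<in> trees.gen B"
  then show "p \<in> {p. Poly_Mapping.keys p \<subseteq> {t. set_bracketing t \<subseteq> B}}"
  proof induction
    case (gen_add u v)
    show ?case by (rule pscale.subspace_add[OF subspace_keys gen_add.IH])
  next
    case (gen_scale u r)
    show ?case by (rule pscale.subspace_scale[OF subspace_keys gen_scale.IH])
  next
    case (gen_m u v)
    then show ?case
      using keys_magma_mult[of "{t. set_bracketing t \<subseteq> B}" Br u v] by simp
  qed auto
next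
  fix p :: "'b bracketing \<Rightarrow>\<^sub>0 'r"
  assume "p \<in> {p. Poly_Mapping.keys p \<subseteq> {t. set_bracketing t \<subseteq> B}}"
  then have "Poly_Mapping.keys p \<subseteq> {t. set_bracketing t \<subseteq> B}" by simp
  then show "p \<in> trees.gen B"
  proof (induction p rule: word_induct)
    case (word t)
    then have "set_bracketing t \<subseteq> B" by simp
    then show ?case
    proof (induction t)
      case (Br s t)
      have "(word s \<star> word t :: 'b bracketing \<Rightarrow>\<^sub>0 'r) \<in> trees.gen B"
        using Br by (intro trees.gen.gen_m) auto
      then show ?case by simp
    qed (auto intro: trees.gen.intros)
  qed (auto intro: trees.gen.intros)
qed

lemma free_nonassoc_sel:
  fixes p q :: "'b bracketing \<Rightarrow>\<^sub>0 'r::comm_ring_1"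
  shows "carrier (free_nonassoc B) = (trees.gen B :: ('b bracketing \<Rightarrow>\<^sub>0 'r) set)"
    "p \<otimes>\<^bsub>free_nonassoc B\<^esub> q = p \<star> q" "p \<oplus>\<^bsub>free_nonassoc B\<^esub> q = p + q"
    "\<zero>\<^bsub>free_nonassoc B\<^esub> = (0 :: 'b bracketing \<Rightarrow>\<^sub>0 'r)" "r \<odot>\<^bsub>free_nonassoc B\<^esub> p = pscale r p"
  by (simp_all add: free_nonassoc_def magma_algebra_sel gen_trees)

lemma submodule_free_nonassoc:
  fixes I :: "('b bracketing \<Rightarrow>\<^sub>0 'r::comm_ring_1) set"
  shows "submodule I scalars (free_nonassoc B) \<longleftrightarrow> I \<subseteq> trees.gen B \<and> pscale.subspace I"
proof -
  let ?M = "free_nonassoc B :: ('r, _) module"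
  have ab: "abelian_group ?M" and neg: "\<And>a. a \<in> trees.gen B \<Longrightarrow> - a = \<ominus>\<^bsub>?M\<^esub> a"
    by (rule abelian_group_image[where h = "\<lambda>x. x" and S = "trees.gen B"],
        auto simp: free_nonassoc_sel trees.gen_neg intro: trees.gen.intros)
      (rule abelian_group_image_neg[where h = "\<lambda>x. x" and S = "trees.gen B"],
        auto simp: free_nonassoc_sel trees.gen_neg intro: trees.gen.intros)
  have mod: "Module.module scalars ?M"
    by (rule moduleI[OF cring_scalars ab])
      (auto simp: free_nonassoc_sel scalars_def trees.gen_scale pscale.scale_left_distrib pscale.scale_right_distrib)
  interpret Module.module scalars ?M by (rule mod)
  show ?thesis
  proof
    assume I: "submodule I scalars ?M"
    show "I \<subseteq> trees.gen B \<and> pscale.subspace I"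
      using submoduleE(1,4,5)[OF I] subgroup.one_closed[OF submodule.axioms(1)[OF I]]
      by (auto simp: pscale.subspace_def free_nonassoc_sel)
  next
    assume "I \<subseteq> trees.gen B \<and> pscale.subspace I"
    then show "submodule I scalars ?M"
      using neg by (intro submoduleI) (auto simp: pscale.subspace_def free_nonassoc_sel subset_iff
          neg[symmetric] dest: pscale.subspace_neg[rotated])
  qed
qed

context
  fixes B :: "'b set"
begin

private abbreviation (input) I :: "('b bracketing \<Rightarrow>\<^sub>0 'r::comm_ring_1) set" where
  "I \<equiv> lie_ideal B"

lemma lie_ideal_eq:
  "I = \<Inter>{J :: ('b bracketing \<Rightarrow>\<^sub>0 'r::comm_ring_1) set. (J \<subseteq> trees.gen B \<and> pscale.subspace J) \<and>
     (\<forall>u\<in>trees.gen B. \<forall>y\<in>J. u \<star> y \<in> J \<and> y \<star> u \<in> J) \<and>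
     (\<forall>u\<in>trees.gen B. u \<star> u \<in> J) \<and>
     (\<forall>u\<in>trees.gen B. \<forall>v\<in>trees.gen B. \<forall>w\<in>trees.gen B. u \<star> (v \<star> w) + v \<star> (w \<star> u) + w \<star> (u \<star> v) \<in> J)}"
proof -
  have squares: "{u \<star> u | u. u \<in> trees.gen B} \<subseteq> J \<longleftrightarrow> (\<forall>u\<in>trees.gen B. u \<star> u \<in> J)"
    for J :: "('b bracketing \<Rightarrow>\<^sub>0 'r) set"
    by auto
  have jacobi: "{u \<star> (v \<star> w) + v \<star> (w \<star> u) + w \<star> (u \<star> v) | u v w.
      u \<in> trees.gen B \<and> v \<in> trees.gen B \<and> w \<in> trees.gen B} \<subseteq> J \<longleftrightarrow>
    (\<forall>u\<in>trees.gen B. \<forall>v\<in>trees.gen B. \<forall>w\<in>trees.gen B. u \<star> (v \<star> w) + v \<star> (w \<star> u) + w \<star> (u \<star> v) \<in> J)"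
    for J :: "('b bracketing \<Rightarrow>\<^sub>0 'r) set"
    by auto
  show ?thesis
    unfolding lie_ideal_def ideal_span_def algebra_ideal_def submodule_free_nonassoc lie_relators_def
      free_nonassoc_sel Un_subset_iff squares jacobi
    by (simp only: conj_assoc)
qed

lemma lie_ideal_props:
  shows lie_ideal_subset: "I \<subseteq> (trees.gen B :: ('b bracketing \<Rightarrow>\<^sub>0 'r::comm_ring_1) set)"
    and subspace_lie_ideal: "pscale.subspace (I :: ('b bracketing \<Rightarrow>\<^sub>0 'r) set)"
    and lie_ideal_absorb: "\<And>u y :: 'b bracketing \<Rightarrow>\<^sub>0 'r. u \<in> trees.gen B \<Longrightarrow> y \<in> I \<Longrightarrow> u \<star> y \<in> I \<and> y \<star> u \<in> I"
    and lie_ideal_square: "\<And>u :: 'b bracketing \<Rightarrow>\<^sub>0 'r. u \<in> trees.gen B \<Longrightarrow> u \<star> u \<in> I"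
    and lie_ideal_jacobi: "\<And>u v w :: 'b bracketing \<Rightarrow>\<^sub>0 'r. u \<in> trees.gen B \<Longrightarrow> v \<in> trees.gen B \<Longrightarrow> w \<in> trees.gen B \<Longrightarrow>
      u \<star> (v \<star> w) + v \<star> (w \<star> u) + w \<star> (u \<star> v) \<in> I"
proof -
  have "pscale.subspace (trees.gen B :: ('b bracketing \<Rightarrow>\<^sub>0 'r) set)"
    by (auto simp: pscale.subspace_def intro: trees.gen.intros)
  then show "I \<subseteq> (trees.gen B :: ('b bracketing \<Rightarrow>\<^sub>0 'r) set)"
    unfolding lie_ideal_eq by (intro Inter_lower) (auto intro!: trees.gen.gen_m trees.gen.gen_add)
  show "pscale.subspace (I :: ('b bracketing \<Rightarrow>\<^sub>0 'r) set)"
    unfolding lie_ideal_eq by (rule pscale.subspace_Inter) auto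
qed (auto simp: lie_ideal_eq)

text \<open>Sharper than minimality: absorption may assume that \<open>y\<close> already lies in the
  ideal, since the set compared is \<open>J \<inter> I\<close>. The Leibniz rule in
  \<open>lie_ideal_deriv\<close> calls for this, as it produces \<open>F u \<star> y\<close> besides
  \<open>u \<star> F y\<close>.\<close>

lemma lie_ideal_minimal:
  fixes J :: "('b bracketing \<Rightarrow>\<^sub>0 'r::comm_ring_1) set"
  assumes J: "pscale.subspace J"
    and "\<And>u y. u \<in> trees.gen B \<Longrightarrow> y \<in> J \<Longrightarrow> y \<in> I \<Longrightarrow> u \<star> y \<in> J \<and> y \<star> u \<in> J"
    and "\<And>u. u \<in> trees.gen B \<Longrightarrow> u \<star> u \<in> J"
    and "\<And>u v w. u \<in> trees.gen B \<Longrightarrow> v \<in> trees.gen B \<Longrightarrow> w \<in> trees.gen B \<Longrightarrow>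
      u \<star> (v \<star> w) + v \<star> (w \<star> u) + w \<star> (u \<star> v) \<in> J"
  shows "I \<subseteq> J"
proof -
  have "I \<subseteq> J \<inter> I"
  proof (subst (1) lie_ideal_eq, rule Inter_lower, rule CollectI, intro conjI ballI)
    show "J \<inter> I \<subseteq> trees.gen B" using lie_ideal_subset by blast
    show "pscale.subspace (J \<inter> I)" by (rule pscale.subspace_inter[OF J subspace_lie_ideal])
  next
    fix u y :: "'b bracketing \<Rightarrow>\<^sub>0 'r"
    assume "u \<in> trees.gen B" "y \<in> J \<inter> I"
    then show "u \<star> y \<in> J \<inter> I" "y \<star> u \<in> J \<inter> I"
      using assms(2)[of u y] lie_ideal_absorb[of u y] by auto
  qed (simp_all add: assms(3,4) lie_ideal_square lie_ideal_jacobi)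
  then show ?thesis by blast
qed

end

lemma lie_ideal_mono: "B \<subseteq> C \<Longrightarrow> lie_ideal B \<subseteq> (lie_ideal C :: ('b bracketing \<Rightarrow>\<^sub>0 'r::comm_ring_1) set)"
  using trees.gen_mono[of B C]
  by (intro lie_ideal_minimal subspace_lie_ideal lie_ideal_absorb lie_ideal_square lie_ideal_jacobi) auto

text \<open>Differentiating a relator gives a combination of relators: a square yields its
  polarization, a Jacobi sum yields three Jacobi sums. Hence derivations descend to the free Lie
  algebra.\<close>

lemma lie_ideal_deriv:
  fixes F :: "('b bracketing \<Rightarrow>\<^sub>0 'r::comm_ring_1) \<Rightarrow> 'b bracketing \<Rightarrow>\<^sub>0 'r"
  assumes F: "F \<in> trees.DD B" and y: "y \<in> lie_ideal B"
  shows "F y \<in> lie_ideal B"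
proof -
  note I = subspace_lie_ideal[where 'r = 'r and B = B]
  note dF = trees.DD_deriv[OF F] and gF = trees.DD_gen[OF F order.refl]
  note simps = trees.deriv_add[OF dF] trees.deriv_scale[OF dF] trees.deriv_m[OF dF] trees.deriv_zero[OF dF]
  have "lie_ideal B \<subseteq> {y. F y \<in> lie_ideal B}"
  proof (rule lie_ideal_minimal)
    show "pscale.subspace {y. F y \<in> lie_ideal B}"
      using I by (auto simp: pscale.subspace_def simps)
  next
    fix u y :: "'b bracketing \<Rightarrow>\<^sub>0 'r"
    assume "u \<in> trees.gen B" "y \<in> {y. F y \<in> lie_ideal B}" "y \<in> lie_ideal B"
    then show "u \<star> y \<in> {y. F y \<in> lie_ideal B} \<and> y \<star> u \<in> {y. F y \<in> lie_ideal B}"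
      using lie_ideal_absorb[of u B y] lie_ideal_absorb[of u B "F y"] lie_ideal_absorb[of "F u" B y] gF[of u]
      by (simp add: simps pscale.subspace_add[OF I])
  next
    fix u :: "'b bracketing \<Rightarrow>\<^sub>0 'r"
    assume u: "u \<in> trees.gen B"
    have "(F u + u) \<star> (F u + u) - F u \<star> F u - u \<star> u \<in> lie_ideal B"
      by (intro pscale.subspace_diff[OF I] lie_ideal_square trees.gen.gen_add gF u)
    then show "u \<star> u \<in> {y. F y \<in> lie_ideal B}"
      by (simp add: simps magma_mult_add_left magma_mult_add_right algebra_simps)
  next
    fix u v w :: "'b bracketing \<Rightarrow>\<^sub>0 'r"
    assume uvw: "u \<in> trees.gen B" "v \<in> trees.gen B" "w \<in> trees.gen B"
    let ?J = "\<lambda>u v w. u \<star> (v \<star> w) + v \<star> (w \<star> u) + w \<star> (u \<star> v)"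
    have "?J (F u) v w + ?J u (F v) w + ?J u v (F w) \<in> lie_ideal B"
      by (intro pscale.subspace_add[OF I] lie_ideal_jacobi gF uvw)
    then show "?J u v w \<in> {y. F y \<in> lie_ideal B}"
      by (simp add: simps magma_mult_add_left magma_mult_add_right algebra_simps)
  qed
  with y show ?thesis by blast
qed

section \<open>Cosets of the Lie ideal\<close>

definition lie_proj :: "'b set \<Rightarrow> ('b bracketing \<Rightarrow>\<^sub>0 'r) \<Rightarrow> ('b bracketing \<Rightarrow>\<^sub>0 'r::comm_ring_1) set" where
  "lie_proj B u = lie_ideal B +>\<^bsub>(free_nonassoc B :: ('r, _) module)\<^esub> u"

lemma mem_lie_proj: "v \<in> lie_proj B u \<longleftrightarrow> v - u \<in> lie_ideal B"
  by (force simp: lie_proj_def a_r_coset_def' free_nonassoc_sel)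

lemma lie_proj_eq_iff: "lie_proj B u = lie_proj B v \<longleftrightarrow> u - v \<in> lie_ideal B"
proof
  note I = subspace_lie_ideal[of B]
  assume "lie_proj B u = lie_proj B v"
  then show "u - v \<in> lie_ideal B"
    using pscale.subspace_0[OF I] by (metis mem_lie_proj diff_self)
next
  note I = subspace_lie_ideal[of B]
  assume uv: "u - v \<in> lie_ideal B"
  have "w - u \<in> lie_ideal B \<longleftrightarrow> w - v \<in> lie_ideal B" for w
    using pscale.subspace_add[OF I _ uv, of "w - u"] pscale.subspace_diff[OF I _ uv, of "w - v"] by auto
  then show "lie_proj B u = lie_proj B v"
    by (auto simp: mem_lie_proj)
qed

lemma lie_proj_self: "u \<in> lie_proj B u"
  using pscale.subspace_0[OF subspace_lie_ideal] by (simp add: mem_lie_proj)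

lemma free_lie_sel:
  fixes u v :: "'b bracketing \<Rightarrow>\<^sub>0 'r::comm_ring_1"
  shows carrier_free_lie: "carrier (free_lie B) = (lie_proj B ` trees.gen B :: ('b bracketing \<Rightarrow>\<^sub>0 'r) set set)"
    and zero_free_lie: "\<zero>\<^bsub>free_lie B\<^esub> = lie_proj B (0 :: 'b bracketing \<Rightarrow>\<^sub>0 'r)"
    and add_free_lie: "u \<in> trees.gen B \<Longrightarrow> v \<in> trees.gen B \<Longrightarrow> lie_proj B u \<oplus>\<^bsub>free_lie B\<^esub> lie_proj B v = lie_proj B (u + v)"
    and mult_free_lie: "u \<in> trees.gen B \<Longrightarrow> v \<in> trees.gen B \<Longrightarrow> lie_proj B u \<otimes>\<^bsub>free_lie B\<^esub> lie_proj B v = lie_proj B (u \<star> v)"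
    and smult_free_lie: "u \<in> trees.gen B \<Longrightarrow> r \<odot>\<^bsub>free_lie B\<^esub> lie_proj B u = lie_proj B (pscale r u)"
proof -
  note I = subspace_lie_ideal[of B, where 'r = 'r]
  show "carrier (free_lie B) = (lie_proj B ` trees.gen B :: ('b bracketing \<Rightarrow>\<^sub>0 'r) set set)"
    unfolding free_lie_def quotient_algebra_def partial_object.select_convs A_RCOSETS_def' free_nonassoc_sel lie_proj_def
    by blast
  show "\<zero>\<^bsub>free_lie B\<^esub> = lie_proj B (0 :: 'b bracketing \<Rightarrow>\<^sub>0 'r)"
    by (rule Set.set_eqI) (simp add: free_lie_def quotient_algebra_def mem_lie_proj)
  show "lie_proj B u \<oplus>\<^bsub>free_lie B\<^esub> lie_proj B v = lie_proj B (u + v)"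
  proof -
    have "lie_proj B u \<oplus>\<^bsub>free_lie B\<^esub> lie_proj B v = {a + b | a b. a \<in> lie_proj B u \<and> b \<in> lie_proj B v}"
      unfolding free_lie_def quotient_algebra_def ring.select_convs set_add_def' free_nonassoc_sel by blast
    also have "\<dots> = lie_proj B (u + v)"
    proof (rule equalityI; rule subsetI)
      fix w assume "w \<in> {a + b | a b. a \<in> lie_proj B u \<and> b \<in> lie_proj B v}"
      then obtain a b where "w = a + b" "a - u \<in> lie_ideal B" "b - v \<in> lie_ideal B"
        by (auto simp: mem_lie_proj)
      then show "w \<in> lie_proj B (u + v)"
        using pscale.subspace_add[OF I, of "a - u" "b - v"] by (simp add: mem_lie_proj algebra_simps)
    next
      fix w assume "w \<in> lie_proj B (u + v)"
      then have "w - v \<in> lie_proj B u" by (simp add: mem_lie_proj algebra_simps)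
      moreover have "w = (w - v) + v" by simp
      ultimately show "w \<in> {a + b | a b. a \<in> lie_proj B u \<and> b \<in> lie_proj B v}"
        using lie_proj_self by blast
    qed
    finally show ?thesis .
  qed
  show "lie_proj B u \<otimes>\<^bsub>free_lie B\<^esub> lie_proj B v = lie_proj B (u \<star> v)"
    if uv: "u \<in> trees.gen B" "v \<in> trees.gen B"
  proof -
    have *: "lie_proj B (a \<star> b) = lie_proj B (u \<star> v)" if "a \<in> lie_proj B u" "b \<in> lie_proj B v" for a b
    proof -
      have ab: "a - u \<in> lie_ideal B" "b - v \<in> lie_ideal B" using that by (auto simp: mem_lie_proj)
      have "b - v + v \<in> trees.gen B"
        using ab(2) lie_ideal_subset uv by (intro trees.gen.gen_add) auto
      \<comment> \<open>This is \<open>a \<star> b - u \<star> v\<close>, split so that each summand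
        has one factor in the ideal.\<close>
      then have "(a - u) \<star> b + u \<star> (b - v) \<in> lie_ideal B"
        using ab uv lie_ideal_absorb by (intro pscale.subspace_add[OF I]) auto
      then show ?thesis
        by (simp add: lie_proj_eq_iff trees.m_diff_left trees.m_diff_right)
    qed
    have "lie_proj B u \<otimes>\<^bsub>free_lie B\<^esub> lie_proj B v = (\<Union>a\<in>lie_proj B u. \<Union>b\<in>lie_proj B v. lie_proj B (a \<star> b))"
      by (simp add: free_lie_def quotient_algebra_def rcoset_mult_def free_nonassoc_sel lie_proj_def)
    also have "\<dots> = (\<Union>a\<in>lie_proj B u. \<Union>b\<in>lie_proj B v. lie_proj B (u \<star> v))"
      by (intro SUP_cong refl *)
    also have "\<dots> = lie_proj B (u \<star> v)"
      using lie_proj_self[of u B] lie_proj_self[of v B] by blast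
    finally show ?thesis .
  qed
  show "r \<odot>\<^bsub>free_lie B\<^esub> lie_proj B u = lie_proj B (pscale r u)"
  proof -
    have *: "lie_proj B (pscale r a) = lie_proj B (pscale r u)" if "a \<in> lie_proj B u" for a
      using that pscale.subspace_scale[OF I, of "a - u" r]
      by (simp add: mem_lie_proj lie_proj_eq_iff pscale.scale_right_diff_distrib)
    have "r \<odot>\<^bsub>free_lie B\<^esub> lie_proj B u = (\<Union>a\<in>lie_proj B u. lie_proj B (pscale r a))"
      by (simp add: free_lie_def quotient_algebra_def free_nonassoc_sel lie_proj_def)
    also have "\<dots> = (\<Union>a\<in>lie_proj B u. lie_proj B (pscale r u))"
      by (intro SUP_cong refl *)
    also have "\<dots> = lie_proj B (pscale r u)"
      using lie_proj_self[of u B] by blast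
    finally show ?thesis .
  qed
qed

lemma lie_incl_lie_proj:
  fixes u :: "'b bracketing \<Rightarrow>\<^sub>0 'r::comm_ring_1"
  assumes "B \<subseteq> C"
  shows "lie_incl C (lie_proj B u) = lie_proj C u"
proof -
  have "lie_proj C v = lie_proj C u" if "v \<in> lie_proj B u" for v
    using that lie_ideal_mono[OF assms] unfolding mem_lie_proj lie_proj_eq_iff by (rule subsetD[rotated])
  then have "(\<Union>v\<in>lie_proj B u. lie_proj C v) = lie_proj C u"
    using lie_proj_self[of u B] by blast
  then show ?thesis
    by (simp only: lie_incl_def lie_proj_def)
qed

lemma lookup_br_mult_Gen: "Poly_Mapping.lookup (p \<star> q) (Gen b) = 0"
  by (simp add: magma_mult_lin lin_def lookup_sum lookup_single)

text \<open>Relators are sums of products, and so is everything absorbed; hence linear coefficients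
  are well defined on the quotient.\<close>

lemma lookup_lie_ideal_Gen:
  assumes "p \<in> lie_ideal B"
  shows "Poly_Mapping.lookup (p :: 'b bracketing \<Rightarrow>\<^sub>0 'r::comm_ring_1) (Gen b) = 0"
proof -
  have "lie_ideal B \<subseteq> {p :: 'b bracketing \<Rightarrow>\<^sub>0 'r. Poly_Mapping.lookup p (Gen b) = 0}"
    by (rule lie_ideal_minimal) (simp_all add: pscale.subspace_def lookup_add lookup_br_mult_Gen)
  with assms show ?thesis by blast
qed

interpretation Lie: integral_free_quotients pscale "(\<star>)" "\<lambda>i. word (Gen i)" Lie "\<lambda>n. lie_proj {1..n}"
  "\<lambda>n. lie_incl {1..Suc n}" "\<lambda>i p. Poly_Mapping.lookup p (Gen i)"
proof unfold_locales
  fix n :: nat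
  show "{1..n} \<subseteq> {1..Suc n}" by auto
  show "lie_proj {1..n} ` trees.gen {1..n} = carrier (Lie n)"
    "lie_proj {1..n} 0 = \<zero>\<^bsub>Lie n\<^esub>"
    by (simp_all add: Lie_def free_lie_sel)
next
  fix n and u v :: "nat bracketing \<Rightarrow>\<^sub>0 int" and r
  assume u: "u \<in> trees.gen {1..n}"
  show "lie_proj {1..n} (pscale r u) = r \<odot>\<^bsub>Lie n\<^esub> lie_proj {1..n} u"
    using u by (simp add: Lie_def free_lie_sel)
  show "lie_incl {1..Suc n} (lie_proj {1..n} u) = lie_proj {1..Suc n} u"
    by (rule lie_incl_lie_proj) auto
  assume v: "v \<in> trees.gen {1..n}"
  show "lie_proj {1..n} (u + v) = lie_proj {1..n} u \<oplus>\<^bsub>Lie n\<^esub> lie_proj {1..n} v"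
    "lie_proj {1..n} (u \<star> v) = lie_proj {1..n} u \<otimes>\<^bsub>Lie n\<^esub> lie_proj {1..n} v"
    using u v by (simp_all add: Lie_def free_lie_sel)
  fix F :: "(nat bracketing \<Rightarrow>\<^sub>0 int) \<Rightarrow> nat bracketing \<Rightarrow>\<^sub>0 int"
  assume F: "F \<in> trees.DD {1..n}" and "lie_proj {1..n} u = lie_proj {1..n} v"
  then show "lie_proj {1..n} (F u) = lie_proj {1..n} (F v)"
    using lie_ideal_deriv[OF F, of "u - v"]
    by (simp add: lie_proj_eq_iff trees.deriv_diff[OF trees.DD_deriv[OF F]])
next
  fix i n and u :: "nat bracketing \<Rightarrow>\<^sub>0 int"
  assume "lie_proj {1..n} u = \<zero>\<^bsub>Lie n\<^esub>"
  then show "Poly_Mapping.lookup u (Gen i) = 0"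
    by (intro lookup_lie_ideal_Gen[of _ "{1..n}"]) (simp add: Lie_def free_lie_sel lie_proj_eq_iff)
qed (simp_all add: lookup_add lookup_br_mult_Gen lookup_single when_def)

theorem direct_limit_Der_Lie:
  "direct_limit (\<lambda>n. H1 Z_ring (Der_Lie n)) (\<lambda>n. H1_map Z_ring (Der_Lie (Suc n)) (Der_Lie_embed n)) \<cong> integer_group"
proof -
  have "{1..Suc n} - {1..n} = {Suc n}" for n by auto
  then show ?thesis
    using Lie.direct_limit_Der by (simp add: Der_Lie_def Der_Lie_embed_def lie_gen_def lie_proj_def)
qed

section \<open>Cyclic words modulo brackets\<close>

text \<open>The sum of \<open>k p y s\<close> over all factorizations \<open>w = p @ y # s\<close>,
  that is, over the occurrences of letters in \<open>w\<close>.\<close>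

primrec split_sum :: "('b list \<Rightarrow> 'b \<Rightarrow> 'b list \<Rightarrow> 'c) \<Rightarrow> 'b list \<Rightarrow> 'c::comm_monoid_add" where
  "split_sum k [] = 0"
| "split_sum k (y # w) = k [] y w + split_sum (\<lambda>p. k (y # p)) w"

lemma split_sum_append:
  "split_sum k (u @ v) = split_sum (\<lambda>p y s. k p y (s @ v)) u + split_sum (\<lambda>p. k (u @ p)) v"
  by (induction u arbitrary: k) (simp_all add: add.assoc)

lemma split_sum_cong:
  "(\<And>p y s. w = p @ y # s \<Longrightarrow> k p y s = l p y s) \<Longrightarrow> split_sum k w = split_sum l w"
proof (induction w arbitrary: k l)
  case (Cons y w)
  have "k [] y w = l [] y w" by (rule Cons.prems) simp
  moreover have "split_sum (\<lambda>p. k (y # p)) w = split_sum (\<lambda>p. l (y # p)) w"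
    by (rule Cons.IH) (simp add: Cons.prems)
  ultimately show ?case by simp
qed simp

lemma split_sum_const_zero [simp]: "split_sum (\<lambda>p y s. 0) w = 0"
  by (induction w) auto

lemma split_sum_zero: "(\<And>p y s. w = p @ y # s \<Longrightarrow> k p y s = 0) \<Longrightarrow> split_sum k w = 0"
  using split_sum_cong[of w k "\<lambda>_ _ _. 0"] by simp

section \<open>Letters, the symplectic form and chord diagrams\<close>

primrec mu :: "symp_index \<Rightarrow> symp_index \<Rightarrow> rat" where
  "mu (a_ix i) y = (if y = b_ix i then 1 else 0)"
| "mu (b_ix i) y = (if y = a_ix i then - 1 else 0)"

primrec idx :: "symp_index \<Rightarrow> nat" where
  "idx (a_ix i) = i"
| "idx (b_ix i) = i"

abbreviation ix :: "symp_index list \<Rightarrow> nat set" where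
  "ix w \<equiv> idx ` set w"

lemma mu_eq_0: "idx x \<noteq> idx y \<Longrightarrow> mu x y = 0"
  by (cases x; cases y) auto

lemma mu_split_sum_zero: "idx u \<notin> ix V \<Longrightarrow> split_sum (\<lambda>p v s. mu u v * h p v s) V = 0"
  by (rule split_sum_zero) (auto simp: mu_eq_0 image_iff)

lemma notin_ix: "i \<notin> ix V \<Longrightarrow> a_ix i \<notin> set V \<and> b_ix i \<notin> set V"
  by force

lemma if_split_sum_zero:
  "y \<notin> set V \<Longrightarrow> split_sum (\<lambda>p v s. (if v = y then c else 0) * h p v s) V = (0 :: rat)"
  by (rule split_sum_zero) auto

lemma fresh_index: "finite A \<Longrightarrow> \<exists>k::nat. k \<notin> A"
  using ex_new_if_finite[OF infinite_UNIV_nat] by blast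

text \<open>
  \<open>X @ rest [i\<^sub>1, \<dots>, i\<^sub>r] Y\<close> is a chord diagram in which the chord \<open>i\<^sub>1\<close> crosses the pair \<open>X, Y\<close>, and
  every other chord \<open>i\<^sub>j\<close> crosses exactly \<open>i\<^sub>j\<^sub>-\<^sub>1\<close> and \<open>i\<^sub>j\<^sub>+\<^sub>1\<close>.
\<close>

primrec rest :: "nat list \<Rightarrow> symp_index list \<Rightarrow> symp_index list" where
  "rest [] Q = Q"
| "rest (i # is) Q = a_ix i # Q @ rest is [b_ix i]"

lemma ix_rest: "ix (rest is Q) = set is \<union> ix Q"
  by (induction "is" arbitrary: Q) (simp_all add: image_Un Un_commute insert_def[symmetric])

text \<open>In the recursion of \<open>rest\<close> the block \<open>Q\<close> is
  \<open>[b_ix i]\<close>; locating it exposes the chord \<open>i\<close> for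
  \<open>rename\<close>.\<close>

lemma rest_decomp: "\<exists>s t. (\<forall>Q. rest is Q = s @ Q @ t) \<and> ix s \<subseteq> set is \<and> ix t \<subseteq> set is"
proof (cases "is")
  case Nil
  then show ?thesis by (intro exI[of _ "[]"]) auto
next
  case (Cons i is')
  then show ?thesis
    by (intro exI[of _ "[a_ix i]"] exI[of _ "rest is' [b_ix i]"]) (auto simp: ix_rest)
qed

text \<open>A linear functional on symplectic derivations that kills brackets, written as a function
  of cyclic words. Lengths at least two reflect the absence of constant terms: removing one letter
  must leave a nonempty word. Indices are unbounded, so fresh chords always exist.\<close>

locale bracket_functional =
  fixes F :: "symp_index list \<Rightarrow> rat"
  assumes cyclic: "F (u @ v) = F (v @ u)"
    and bracket: "2 \<le> length U \<Longrightarrow> 2 \<le> length V \<Longrightarrow>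
      split_sum (\<lambda>p u s. split_sum (\<lambda>q v t. mu u v * F (s @ p @ t @ q)) V) U = 0"
begin

text \<open>The bracket relation for \<open>W b\<^sub>k\<close> and \<open>a\<^sub>k V\<close>, solved for the term that contracts the fresh chord \<open>k\<close>.\<close>

lemma expand:
  assumes "W \<noteq> []" "V \<noteq> []" "k \<notin> ix W" "k \<notin> ix V"
  shows "F (W @ V) =
    split_sum (\<lambda>p u s. split_sum (\<lambda>q v t. mu u v * F (s @ [b_ix k] @ p @ t @ [a_ix k] @ q)) V) W"
proof -
  have "split_sum (\<lambda>p u s. split_sum (\<lambda>q v t. mu u v * F (s @ p @ t @ q)) (a_ix k # V)) (W @ [b_ix k]) = 0"
    using assms(1,2) by (intro bracket) (cases W; cases V; simp)+
  moreover have "split_sum (\<lambda>p u s. split_sum (\<lambda>q v t. mu u v * F ((s @ [b_ix k]) @ p @ t @ q)) (a_ix k # V)) W =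
      split_sum (\<lambda>p u s. split_sum (\<lambda>q v t. mu u v * F (s @ [b_ix k] @ p @ t @ [a_ix k] @ q)) V) W"
  proof (rule split_sum_cong)
    fix p u s assume "W = p @ u # s"
    then have "mu u (a_ix k) = 0" using assms(3) by (intro mu_eq_0) auto
    then show "split_sum (\<lambda>q v t. mu u v * F ((s @ [b_ix k]) @ p @ t @ q)) (a_ix k # V) =
        split_sum (\<lambda>q v t. mu u v * F (s @ [b_ix k] @ p @ t @ [a_ix k] @ q)) V"
      by simp
  qed
  moreover have "split_sum (\<lambda>q v t. mu (b_ix k) v * F (W @ t @ a_ix k # q)) V = 0"
    using assms(4) by (intro mu_split_sum_zero) auto
  ultimately show ?thesis
    by (simp add: split_sum_append)
qed

text \<open>Every term of \<open>expand\<close> contracts a letter of \<open>W\<close> with one of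
  \<open>V\<close>, and letters with different indices are orthogonal.\<close>

lemma disjoint_words:
  assumes "W \<noteq> []" "V \<noteq> []" "ix W \<inter> ix V = {}"
  shows "F (W @ V) = 0"
proof -
  obtain k where k: "k \<notin> ix W \<union> ix V"
    using fresh_index[of "ix W \<union> ix V"] by auto
  have "F (W @ V) =
    split_sum (\<lambda>p u s. split_sum (\<lambda>q v t. mu u v * F (s @ [b_ix k] @ p @ t @ [a_ix k] @ q)) V) W"
    using assms k by (intro expand) auto
  also have "\<dots> = 0"
    using assms(3) by (intro split_sum_zero mu_split_sum_zero) auto
  finally show ?thesis .
qed

text \<open>Splitting off \<open>a\<close> as a word of its own leaves the single contraction with
  \<open>a'\<close>. Besides changing the label, this turns a chord around at the cost of the sign
  of \<open>mu\<close>.\<close>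

lemma rename:
  assumes "idx a = idx a'" "idx a \<notin> ix (X @ Y @ Z)" "k \<notin> ix (a # X @ Y @ Z)"
  shows "F (X @ a # Y @ a' # Z) = mu a a' * F (X @ a_ix k # Y @ b_ix k # Z)"
proof -
  have "F (X @ a # Y @ a' # Z) = F ([a] @ (Y @ a' # Z @ X))"
    using cyclic[of X "a # Y @ a' # Z"] by simp
  also have "\<dots> = split_sum (\<lambda>p u s. split_sum (\<lambda>q v t. mu u v * F (s @ [b_ix k] @ p @ t @ [a_ix k] @ q))
      (Y @ a' # Z @ X)) [a]"
    using assms by (intro expand) auto
  also have "\<dots> = split_sum (\<lambda>q v t. mu a v * F (b_ix k # t @ a_ix k # q)) (Y @ a' # Z @ X)"
    by simp
  also have "\<dots> = mu a a' * F (b_ix k # Z @ X @ a_ix k # Y)"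
    using assms(2) by (simp add: split_sum_append mu_split_sum_zero image_Un)
  also have "F (b_ix k # Z @ X @ a_ix k # Y) = F (X @ a_ix k # Y @ b_ix k # Z)"
    using cyclic[of "b_ix k # Z" "X @ a_ix k # Y"] by simp
  finally show ?thesis .
qed

text \<open>Letters of \<open>W\<close> can contract only with letters of \<open>W'\<close>. After
  expanding, the fresh chord \<open>k\<close> gives the new pair \<open>X @ [a_ix k] @ Y\<close> and
  \<open>[b_ix k]\<close>, and what remains of \<open>W\<close> and \<open>W'\<close> is regrouped
  as \<open>q @ s\<close> and \<open>p @ t\<close>: the same configuration with two letters fewer.
  The list in \<open>rest\<close> records the chords created on the way.\<close>

lemma reduce_to_rest:
  assumes "X @ Y \<noteq> []" "ix (X @ Y) \<inter> ix (W @ W') = {}"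
    and "\<And>is. distinct is \<Longrightarrow> set is \<inter> ix (X @ Y) = {} \<Longrightarrow> F (X @ rest is Y) = 0"
  shows "F (X @ W @ Y @ W') = 0"
  using assms
proof (induction "length (W @ W')" arbitrary: X Y W W' rule: less_induct)
  case less
  show ?case
  proof (cases "W = []")
    case True
    show ?thesis
    proof (cases "W' = []")
      case True
      then show ?thesis using \<open>W = []\<close> less.prems(3)[of "[]"] by simp
    next
      case False
      then show ?thesis
        using \<open>W = []\<close> disjoint_words[of "X @ Y" W'] less.prems(1,2) by simp
    qed
  next
    case False
    obtain k where k: "k \<notin> ix (X @ Y @ W @ W')"
      using fresh_index[of "ix (X @ Y @ W @ W')"] by blast
    have "F (X @ W @ Y @ W') = F (W @ (Y @ W' @ X))"
      using cyclic[of X "W @ Y @ W'"] by simp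
    also have "\<dots> = split_sum (\<lambda>p u s. split_sum (\<lambda>q v t. mu u v * F (s @ [b_ix k] @ p @ t @ [a_ix k] @ q))
        (Y @ W' @ X)) W"
      using False less.prems(1) k by (intro expand) auto
    also have "\<dots> = 0"
    proof (rule split_sum_zero)
      fix p u s assume W: "W = p @ u # s"
      then have u: "idx u \<notin> ix Y" "idx u \<notin> ix X" using less.prems(2) by auto
      have "mu u v * F (s @ [b_ix k] @ p @ (t @ X) @ [a_ix k] @ (Y @ q)) = 0" if W': "W' = q @ v # t" for q v t
      proof -
        have "F ((X @ [a_ix k] @ Y) @ (q @ s) @ [b_ix k] @ (p @ t)) = 0"
        proof (rule less.hyps)
          show "length ((q @ s) @ p @ t) < length (W @ W')" using W W' by simp
          show "ix ((X @ [a_ix k] @ Y) @ [b_ix k]) \<inter> ix ((q @ s) @ p @ t) = {}"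
            using less.prems(2) k W W' by auto
          \<comment> \<open>This word is \<open>X @ rest (k # is) Y\<close>; the recursion of
            \<open>rest\<close> is made for this step.\<close>
          show "F ((X @ [a_ix k] @ Y) @ rest is [b_ix k]) = 0"
            if "distinct is" "set is \<inter> ix ((X @ [a_ix k] @ Y) @ [b_ix k]) = {}" for "is"
            using less.prems(3)[of "k # is"] that k by auto
        qed simp
        moreover have "F (s @ [b_ix k] @ p @ (t @ X) @ [a_ix k] @ (Y @ q)) =
            F ((X @ [a_ix k] @ Y) @ (q @ s) @ [b_ix k] @ (p @ t))"
          using cyclic[of "s @ [b_ix k] @ p @ t" "X @ [a_ix k] @ Y @ q"] by simp
        ultimately show ?thesis by simp
      qed
      then have "split_sum (\<lambda>q v t. mu u v * F (s @ [b_ix k] @ p @ (t @ X) @ [a_ix k] @ (Y @ q))) W' = 0"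
        by (rule split_sum_zero)
      then show "split_sum (\<lambda>q v t. mu u v * F (s @ [b_ix k] @ p @ t @ [a_ix k] @ q)) (Y @ W' @ X) = 0"
        using mu_split_sum_zero[OF u(1)] mu_split_sum_zero[OF u(2)] by (simp add: split_sum_append)
    qed
    finally show ?thesis .
  qed
qed

section \<open>Values on paths of chords\<close>

lemma rest_cong_disjoint:
  assumes "length is = length js" "distinct is" "distinct js" "set is \<inter> set js = {}"
    and "(set is \<union> set js) \<inter> ix (X @ Y) = {}"
  shows "F (X @ rest is Y) = F (X @ rest js Y)"
  using assms
proof (induction "is" js arbitrary: X Y rule: list_induct2)
  case (Cons i "is" j js)
  obtain s t where st: "\<And>Q. rest is Q = s @ Q @ t" "ix s \<subseteq> set is" "ix t \<subseteq> set is"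
    using rest_decomp[of "is"] by blast
  have "F (X @ a_ix i # (Y @ s) @ b_ix i # t) = mu (a_ix i) (b_ix i) * F (X @ a_ix j # (Y @ s) @ b_ix j # t)"
    using Cons.prems st(2,3) by (intro rename) auto
  then have "F (X @ rest (i # is) Y) = F ((X @ a_ix j # Y) @ rest is [b_ix j])"
    by (simp add: st(1))
  also have "\<dots> = F ((X @ a_ix j # Y) @ rest js [b_ix j])"
    using Cons.prems by (intro Cons.IH) auto
  finally show ?case by simp
qed simp

lemma rest_cong:
  assumes "length is = length js" "distinct is" "distinct js"
  shows "F (rest is []) = F (rest js [])"
proof -
  \<comment> \<open>\<open>M\<close> exceeds all labels, so \<open>ks\<close> is disjoint from both
    lists, which may overlap, and serves as an intermediate renaming.\<close>
  define M where "M = Suc (Max (insert 0 (set is \<union> set js)))"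
  define ks where "ks = [M..<M + length is]"
  have M: "i < M" if "i \<in> set is \<union> set js" for i
    using that by (simp add: M_def less_Suc_eq_le)
  then have disj: "set is \<inter> set ks = {}" "set js \<inter> set ks = {}"
    by (fastforce simp: ks_def)+
  have "F ([] @ rest is []) = F ([] @ rest ks [])" "F ([] @ rest js []) = F ([] @ rest ks [])"
    using assms disj by (intro rest_cong_disjoint; simp add: ks_def)+
  then show ?thesis by simp
qed

text \<open>Expanding at the adjacent ends \<open>b_ix k, a_ix z\<close> contracts one of the two
  chords; the other one then has cyclically adjacent ends and splits off as a disjoint word.\<close>

lemma parallel_chords:
  assumes "k \<noteq> z" "k \<notin> ix (X @ Y)" "z \<notin> ix (X @ Y)"
  shows "F (a_ix k # X @ [b_ix k, a_ix z] @ Y @ [b_ix z]) = 0"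
proof -
  obtain f where f: "f \<notin> insert k (insert z (ix (X @ Y)))"
    using fresh_index[of "insert k (insert z (ix (X @ Y)))"] by blast
  have "F (a_ix k # X @ [b_ix k, a_ix z] @ Y @ [b_ix z]) = F ([b_ix k, a_ix z] @ (Y @ b_ix z # a_ix k # X))"
    using cyclic[of "a_ix k # X" "[b_ix k, a_ix z] @ Y @ [b_ix z]"] by simp
  also have "\<dots> = split_sum (\<lambda>p u s. split_sum (\<lambda>q v t. mu u v * F (s @ [b_ix f] @ p @ t @ [a_ix f] @ q))
      (Y @ b_ix z # a_ix k # X)) [b_ix k, a_ix z]"
    using f by (intro expand) auto
  also have "\<dots> = - F (a_ix z # b_ix f # X @ a_ix f # Y @ [b_ix z]) + F (b_ix f # b_ix k # a_ix k # X @ a_ix f # Y)"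
    using assms notin_ix[of k X] notin_ix[of k Y] notin_ix[of z X] notin_ix[of z Y]
    by (simp add: split_sum_append if_split_sum_zero image_Un)
  also have "F (a_ix z # b_ix f # X @ a_ix f # Y @ [b_ix z]) = F ((b_ix f # X @ a_ix f # Y) @ [b_ix z, a_ix z])"
    using cyclic[of "[a_ix z]" "b_ix f # X @ a_ix f # Y @ [b_ix z]"] by simp
  also have "\<dots> = 0"
    using assms f by (intro disjoint_words) auto
  also have "F (b_ix f # b_ix k # a_ix k # X @ a_ix f # Y) = F ([b_ix k, a_ix k] @ (X @ a_ix f # Y @ [b_ix f]))"
    using cyclic[of "[b_ix f]" "b_ix k # a_ix k # X @ a_ix f # Y"] by simp
  also have "\<dots> = 0"
    using assms f by (intro disjoint_words) auto
  finally show ?thesis by simp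
qed

text \<open>The expansion of \<open>parallel_chords\<close>, now with \<open>z\<close> crossing
  \<open>r\<close>. Contracting \<open>k\<close> makes the word split into disjoint pieces;
  contracting \<open>z\<close> leaves one term, in which the fresh chord \<open>f\<close> has
  replaced \<open>z\<close> and crosses \<open>r\<close>.\<close>

lemma slide:
  assumes "distinct (k # z # r # f # is)" "set (k # z # r # f # is) \<inter> ix (X @ Y) = {}"
  shows "F (a_ix k # X @ b_ix k # rest (z # r # is) Y) =
    F (a_ix k # (X @ a_ix f # Y @ [a_ix r, b_ix f]) @ b_ix k # rest is [b_ix r])"
proof -
  define R where "R = rest is [b_ix r]"
  have R: "ix R = insert r (set is)" by (simp add: R_def ix_rest)
  have "F (a_ix k # X @ b_ix k # rest (z # r # is) Y) =
      F ([b_ix k, a_ix z] @ (Y @ a_ix r # b_ix z # R @ a_ix k # X))"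
    using cyclic[of "a_ix k # X" "b_ix k # rest (z # r # is) Y"] by (simp add: R_def)
  also have "\<dots> = split_sum (\<lambda>p u s. split_sum (\<lambda>q v t. mu u v * F (s @ [b_ix f] @ p @ t @ [a_ix f] @ q))
      (Y @ a_ix r # b_ix z # R @ a_ix k # X)) [b_ix k, a_ix z]"
    using assms R by (intro expand) auto
  also have "\<dots> = - F (a_ix z # b_ix f # X @ a_ix f # Y @ a_ix r # b_ix z # R)
      + F (b_ix f # b_ix k # R @ a_ix k # X @ a_ix f # Y @ [a_ix r])"
    using assms R notin_ix[of k X] notin_ix[of k Y] notin_ix[of z X] notin_ix[of z Y] notin_ix[of k R] notin_ix[of z R]
    by (simp add: split_sum_append if_split_sum_zero image_Un)
  also have "F (a_ix z # b_ix f # X @ a_ix f # Y @ a_ix r # b_ix z # R) =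
      F ((b_ix f # X @ a_ix f # Y) @ (a_ix r # b_ix z # R @ [a_ix z]))"
    using cyclic[of "[a_ix z]" "b_ix f # X @ a_ix f # Y @ a_ix r # b_ix z # R"] by simp
  also have "\<dots> = 0"
    using assms R by (intro disjoint_words) auto
  also have "F (b_ix f # b_ix k # R @ a_ix k # X @ a_ix f # Y @ [a_ix r]) =
      F (a_ix k # (X @ a_ix f # Y @ [a_ix r, b_ix f]) @ b_ix k # R)"
    using cyclic[of "b_ix f # b_ix k # R" "a_ix k # X @ a_ix f # Y @ [a_ix r]"] by simp
  finally show ?thesis by (simp add: R_def)
qed

text \<open>
  Each \<open>slide\<close> removes two chords from the path and stores them in the pair \<open>X, Y\<close>; when all are used up,
  they form a path again, and the remaining chord \<open>k\<close> has changed its orientation.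
\<close>

lemma unroll:
  assumes "distinct (k # is)" "set (k # is) \<inter> ix (X @ Y) = {}"
  shows "(odd (length is) \<longrightarrow> F (a_ix k # X @ b_ix k # rest is Y) = 0) \<and>
    (even (length is) \<longrightarrow> (\<exists>js. distinct js \<and> length js = Suc (length is) \<and> set js \<inter> ix (X @ Y) = {} \<and>
       F (a_ix k # X @ b_ix k # rest is Y) = - F (X @ rest js Y)))"
  using assms
proof (induction "is" arbitrary: X Y rule: induct_list012)
  case 1
  obtain j where j: "j \<notin> insert k (ix (X @ Y))"
    using fresh_index[of "insert k (ix (X @ Y))"] by blast
  have "F (a_ix k # X @ b_ix k # rest [] Y) = F (X @ b_ix k # Y @ a_ix k # [])"
    using cyclic[of "[a_ix k]" "X @ b_ix k # Y"] by simp
  \<comment> \<open>Here \<open>mu (b_ix k) (a_ix k)\<close> is -1: turning the last chord around is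
    where the sign comes from.\<close>
  also have "\<dots> = mu (b_ix k) (a_ix k) * F (X @ a_ix j # Y @ b_ix j # [])"
    using 1 j by (intro rename) auto
  finally show ?case
    using j by (auto intro!: exI[of _ "[j]"])
next
  case (2 z)
  then show ?case
    using parallel_chords[of k z X Y] by auto
next
  case (3 z r "is")
  obtain f where f: "f \<notin> set (k # z # r # is) \<union> ix (X @ Y)"
    using fresh_index[of "set (k # z # r # is) \<union> ix (X @ Y)"] by blast
  let ?X = "X @ a_ix f # Y @ [a_ix r, b_ix f]"
  have eq: "F (a_ix k # X @ b_ix k # rest (z # r # is) Y) = F (a_ix k # ?X @ b_ix k # rest is [b_ix r])"
    using 3(3,4) f by (intro slide) auto
  have IH: "(odd (length is) \<longrightarrow> F (a_ix k # ?X @ b_ix k # rest is [b_ix r]) = 0) \<and>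
    (even (length is) \<longrightarrow> (\<exists>js. distinct js \<and> length js = Suc (length is) \<and> set js \<inter> ix (?X @ [b_ix r]) = {} \<and>
       F (a_ix k # ?X @ b_ix k # rest is [b_ix r]) = - F (?X @ rest js [b_ix r])))"
    using 3(3,4) f by (intro 3(1)) auto
  show ?case
  proof (intro conjI impI)
    assume "odd (length (z # r # is))"
    then show "F (a_ix k # X @ b_ix k # rest (z # r # is) Y) = 0"
      using IH eq by simp
  next
    assume "even (length (z # r # is))"
    then obtain js where js: "distinct js" "length js = Suc (length is)" "set js \<inter> ix (?X @ [b_ix r]) = {}"
      "F (a_ix k # ?X @ b_ix k # rest is [b_ix r]) = - F (?X @ rest js [b_ix r])"
      using IH by auto
    show "\<exists>js. distinct js \<and> length js = Suc (length (z # r # is)) \<and> set js \<inter> ix (X @ Y) = {} \<and>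
       F (a_ix k # X @ b_ix k # rest (z # r # is) Y) = - F (X @ rest js Y)"
    proof (intro exI conjI)
      \<comment> \<open>The two stored chords lead the new path:
        \<open>X @ rest (f # r # js) Y\<close> unfolds to
        \<open>?X @ rest js [b_ix r]\<close>.\<close>
      show "distinct (f # r # js)" using js f 3(4) by auto
      show "set (f # r # js) \<inter> ix (X @ Y) = {}" using js f 3(4) by auto
      show "F (a_ix k # X @ b_ix k # rest (z # r # is) Y) = - F (X @ rest (f # r # js) Y)"
        unfolding eq js(4) by simp
    qed (simp add: js)
  qed
qed

text \<open>By \<open>rest_cong\<close> the value depends only on the number of chords, and
  \<open>unroll\<close> makes it zero or equal to its negative. A single chord is treated apart, as
  there is no second chord \<open>p\<close> to provide the pair \<open>[a_ix p]\<close>,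
  \<open>[b_ix p]\<close>.\<close>

lemma rest_zero:
  assumes "distinct is" "is \<noteq> []"
  shows "F (rest is []) = 0"
proof (cases "is")
  case (Cons k ks)
  show ?thesis
  proof (cases ks)
    case Nil
    obtain js where js: "distinct js" "length js = 1" "F (a_ix k # [] @ b_ix k # rest [] []) = - F ([] @ rest js [])"
      using unroll[of k "[]" "[]" "[]"] by auto
    have "F (rest [k] []) = F (rest js [])"
      using js by (intro rest_cong) auto
    then show ?thesis using js(3) Cons Nil by simp
  next
    case (Cons p ps)
    note is_eq = \<open>is = k # ks\<close>[unfolded Cons]
    have U: "(odd (length ps) \<longrightarrow> F (a_ix k # [a_ix p] @ b_ix k # rest ps [b_ix p]) = 0) \<and>
      (even (length ps) \<longrightarrow> (\<exists>js. distinct js \<and> length js = Suc (length ps) \<and> set js \<inter> ix ([a_ix p] @ [b_ix p]) = {} \<and>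
       F (a_ix k # [a_ix p] @ b_ix k # rest ps [b_ix p]) = - F ([a_ix p] @ rest js [b_ix p])))"
      using assms is_eq by (intro unroll) auto
    have rest_is: "rest is [] = a_ix k # [a_ix p] @ b_ix k # rest ps [b_ix p]" by (simp add: is_eq)
    show ?thesis
    proof (cases "odd (length ps)")
      case True
      then show ?thesis using U rest_is by simp
    next
      case False
      then obtain js where js: "distinct js" "length js = Suc (length ps)" "p \<notin> set js"
        "F (rest is []) = - F ([a_ix p] @ rest js [b_ix p])"
        using U unfolding rest_is by auto
      have "F (rest is []) = F (rest (p # js) [])"
        using assms is_eq js by (intro rest_cong) auto
      then show ?thesis using js(4) by simp
    qed
  qed
qed (use assms in simp)

text \<open>Contracting the first letter with a letter \<open>y\<close> replaces both by a fresh
  chord \<open>k\<close> that separates the other letters into \<open>q\<close> and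
  \<open>t\<close>; \<open>reduce_to_rest\<close> then leaves only paths of chords beginning with
  \<open>k\<close>.\<close>

theorem vanishes:
  assumes "2 \<le> length w"
  shows "F w = 0"
proof -
  obtain x v where w: "w = [x] @ v" and v: "v \<noteq> []"
    using assms that[of "hd w" "tl w"] by (cases w; cases "tl w") auto
  obtain k where k: "k \<notin> ix w"
    using fresh_index[of "ix w"] by blast
  have "F ([x] @ v) = split_sum (\<lambda>p u s. split_sum (\<lambda>q v t. mu u v * F (s @ [b_ix k] @ p @ t @ [a_ix k] @ q)) v) [x]"
    using v k w by (intro expand) auto
  also have "\<dots> = split_sum (\<lambda>q y t. mu x y * F ([b_ix k] @ t @ [a_ix k] @ q)) v"
    by simp
  also have "\<dots> = 0"
  proof (rule split_sum_zero)
    fix q y t assume qt: "v = q @ y # t"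
    have "F ([a_ix k] @ q @ [b_ix k] @ t) = 0"
    proof (rule reduce_to_rest)
      show "ix ([a_ix k] @ [b_ix k]) \<inter> ix (q @ t) = {}" using k w qt by auto
      show "F ([a_ix k] @ rest is [b_ix k]) = 0"
        if "distinct is" "set is \<inter> ix ([a_ix k] @ [b_ix k]) = {}" for "is"
        using rest_zero[of "k # is"] that by simp
    qed simp
    then show "mu x y * F ([b_ix k] @ t @ [a_ix k] @ q) = 0"
      using cyclic[of "[b_ix k] @ t" "[a_ix k] @ q"] by simp
  qed
  finally show ?thesis using w by simp
qed

end

section \<open>Symplectic derivations\<close>

lemma split_sum_add: "split_sum (\<lambda>p y s. k p y s + l p y s) w = split_sum k w + split_sum l w"
  by (induction w arbitrary: k l) (simp_all add: algebra_simps)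

lemma split_sum_hom:
  assumes "g 0 = 0" "\<And>u v. g (u + v) = g u + g v"
  shows "g (split_sum k w) = split_sum (\<lambda>p y s. g (k p y s)) w"
  by (induction w arbitrary: k) (simp_all add: assms)

lemma split_sum_swap:
  "split_sum (\<lambda>p u s. split_sum (\<lambda>q v t. k p u s q v t) V) U =
   split_sum (\<lambda>q v t. split_sum (\<lambda>p u s. k p u s q v t) U) V"
  by (induction U arbitrary: k) (simp_all add: split_sum_add)

text \<open>Both sides enumerate the ordered pairs of positions in \<open>V\<close>, choosing the
  left or the right one first.\<close>

lemma split_sum_split_sum:
  "split_sum (\<lambda>p y s. split_sum (\<lambda>q z t. k p y q z t) s) V =
   split_sum (\<lambda>q z t. split_sum (\<lambda>p y s. k p y s z t) q) V"
proof (induction V arbitrary: k)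
  case (Cons a V)
  show ?case
    by (simp add: Cons.IH[of "\<lambda>p. k (a # p)"] split_sum_add)
qed simp

lemma split_sum_map: "split_sum k (map f w) = split_sum (\<lambda>p y s. k (map f p) (f y) (map f s)) w"
  by (induction w arbitrary: k) simp_all

lemma split_sum_induct:
  assumes "P 0" "\<And>a b. P a \<Longrightarrow> P b \<Longrightarrow> P (a + b)" "\<And>p y s. w = p @ y # s \<Longrightarrow> P (k p y s)"
  shows "P (split_sum k w)"
  using assms(3)
proof (induction w arbitrary: k)
  case (Cons y w)
  have "P (k [] y w)" by (rule Cons.prems) simp
  moreover have "P (split_sum (\<lambda>p. k (y # p)) w)"
    by (rule Cons.IH) (simp add: Cons.prems)
  ultimately show ?case by (simp add: assms(2))
qed (simp add: assms(1))

text \<open>Cutting a cyclic word at each letter lists its rotations; in the induction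
  \<open>q\<close> collects the letters already moved to the end.\<close>

lemma split_sum_rotations:
  "split_sum (\<lambda>p y s. h (y # s @ q @ p)) w = (\<Sum>j<length w. h (rotate j (w @ q)))"
proof (induction w arbitrary: q)
  case (Cons y w)
  have "split_sum (\<lambda>p z s. h (z # s @ q @ y # p)) w = (\<Sum>j<length w. h (rotate j (w @ q @ [y])))"
    using Cons.IH[of "q @ [y]"] by simp
  also have "\<dots> = (\<Sum>j<length w. h (rotate (Suc j) ((y # w) @ q)))"
    by (simp add: rotate1_rotate_swap)
  finally show ?case
    by (simp add: sum.lessThan_Suc_shift del: rotate_Suc sum.lessThan_Suc)
qed simp

abbreviation pure :: "symp_index list \<Rightarrow> symp_tensor" where
  "pure \<equiv> word"

lemma deriv_pure:
  assumes "words.deriv F"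
  shows "F (pure w) = split_sum (\<lambda>p y s. pure p * F (pure [y]) * pure s) w"
proof (induction w)
  case Nil
  have "F (1 * 1) = F 1 * 1 + 1 * F 1" using assms by (rule words.deriv_m)
  then show ?case by (simp add: word_Nil)
next
  case (Cons y w)
  have "F (pure (y # w)) = F (pure [y] * pure w)" by simp
  also have "\<dots> = F (pure [y]) * pure w + pure [y] * F (pure w)"
    using assms by (rule words.deriv_m)
  also have "pure [y] * F (pure w) = split_sum (\<lambda>p z s. pure [y] * (pure p * F (pure [z]) * pure s)) w"
    unfolding Cons by (rule split_sum_hom) (simp_all add: distrib_left)
  finally show ?case
    by (simp add: word_Nil mult.assoc[symmetric])
qed

text \<open>The symplectic derivation attached to the cyclic word \<open>w\<close>: it contracts each letter of \<open>w\<close> in turn.\<close>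

definition contraction :: "symp_index list \<Rightarrow> symp_index \<Rightarrow> symp_tensor" where
  "contraction w x = split_sum (\<lambda>p y s. pscale (mu y x) (pure (s @ p))) w"

definition N :: "symp_index list \<Rightarrow> symp_tensor \<Rightarrow> symp_tensor" where
  "N w = words.d (contraction w)"

lemma N_gen [simp]: "N w (pure [x]) = contraction w x"
  by (simp add: N_def)

lemma deriv_N: "words.deriv (N w)"
  by (simp add: N_def words.deriv_d)

lemma N_pure: "N U (pure w) = split_sum (\<lambda>p y s. pure p * contraction U y * pure s) w"
  using deriv_pure[OF deriv_N, of U w] by (simp only: N_gen)

lemma contraction_append:
  "contraction (u @ v) x = split_sum (\<lambda>p y s. pscale (mu y x) (pure (s @ v @ p))) u +
     split_sum (\<lambda>p y s. pscale (mu y x) (pure (s @ u @ p))) v"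
  by (simp add: contraction_def split_sum_append)

lemma N_cyclic: "N (u @ v) = N (v @ u)"
proof -
  have "contraction (u @ v) = contraction (v @ u)"
    by (rule ext) (simp only: contraction_append add.commute)
  then show ?thesis by (simp only: N_def)
qed

text \<open>The terms of the bracket in which the derivation \<open>N U\<close> is applied to the values of \<open>N V\<close>.\<close>

definition half_bracket :: "symp_index list \<Rightarrow> symp_index list \<Rightarrow> symp_index \<Rightarrow> symp_tensor" where
  "half_bracket U V x = split_sum (\<lambda>p u s. split_sum (\<lambda>q v t. pscale (mu u v)
      (split_sum (\<lambda>a y b. pscale (mu y x) (pure (b @ q @ s @ p @ a))) t +
       split_sum (\<lambda>a y b. pscale (mu y x) (pure (b @ s @ p @ t @ a))) q)) V) U"

lemma split_sum_pscale: "pscale c (split_sum k w) = split_sum (\<lambda>p y s. pscale c (k p y s)) w"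
  by (rule split_sum_hom) (simp_all add: pscale.scale_right_distrib)

text \<open>The letter of \<open>V\<close> that \<open>N U\<close> replaces lies before or after the
  letter removed by \<open>contraction\<close>. The two double sums are reordered so that the
  contracted pair comes first, as in \<open>half_bracket\<close>.\<close>

lemma N_contraction: "N U (contraction V x) = half_bracket U V x"
proof -
  let ?W = "\<lambda>c w. pscale c (pure w)"
  have lin: "N U (split_sum k w) = split_sum (\<lambda>p y s. N U (k p y s)) w" for k :: "symp_index list \<Rightarrow> _" and w
    by (rule split_sum_hom) (simp_all add: words.deriv_zero[OF deriv_N] words.deriv_add[OF deriv_N])
  have mid: "pure a * contraction U z * pure b = split_sum (\<lambda>p u s. ?W (mu u z) (a @ s @ p @ b)) U" for a z b
    unfolding contraction_def
    by (subst split_sum_hom[where g = "\<lambda>c. pure a * c * pure b"])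
      (simp_all add: distrib_left distrib_right pscale_times_left pscale_times_right del: pscale_single)
  have "N U (contraction V x) = split_sum (\<lambda>p y s. pscale (mu y x) (N U (pure (s @ p)))) V"
    by (simp add: contraction_def lin words.deriv_scale[OF deriv_N] del: pscale_single)
  also have "\<dots> = split_sum (\<lambda>p y s. split_sum (\<lambda>q z t. split_sum (\<lambda>p' u s'. ?W (mu y x * mu u z) (q @ s' @ p' @ t @ p)) U) s) V
      + split_sum (\<lambda>p y s. split_sum (\<lambda>q z t. split_sum (\<lambda>p' u s'. ?W (mu y x * mu u z) (s @ q @ s' @ p' @ t)) U) p) V"
    by (simp only: N_pure split_sum_append mid split_sum_add pscale.scale_right_distrib
        split_sum_pscale pscale.scale_scale append_assoc)
  also have "split_sum (\<lambda>p y s. split_sum (\<lambda>q z t. split_sum (\<lambda>p' u s'. ?W (mu y x * mu u z) (q @ s' @ p' @ t @ p)) U) s) V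
      = split_sum (\<lambda>q z t. split_sum (\<lambda>p y s. split_sum (\<lambda>p' u s'. ?W (mu y x * mu u z) (s @ s' @ p' @ t @ p)) U) q) V"
    by (rule split_sum_split_sum)
  also have "split_sum (\<lambda>p y s. split_sum (\<lambda>q z t. split_sum (\<lambda>p' u s'. ?W (mu y x * mu u z) (s @ q @ s' @ p' @ t)) U) p) V
      = split_sum (\<lambda>q z t. split_sum (\<lambda>p y s. split_sum (\<lambda>p' u s'. ?W (mu y x * mu u z) (s @ q @ s' @ p' @ p)) U) t) V"
    by (rule split_sum_split_sum[symmetric])
  finally have "N U (contraction V x) =
      split_sum (\<lambda>q z t. split_sum (\<lambda>p y s. split_sum (\<lambda>p' u s'. ?W (mu y x * mu u z) (s @ s' @ p' @ t @ p)) U) q) V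
    + split_sum (\<lambda>q z t. split_sum (\<lambda>p y s. split_sum (\<lambda>p' u s'. ?W (mu y x * mu u z) (s @ q @ s' @ p' @ p)) U) t) V" .
  moreover have "split_sum (\<lambda>p u s. pscale (mu u v)
      (split_sum (\<lambda>a y b. ?W (mu y x) (b @ q @ s @ p @ a)) t + split_sum (\<lambda>a y b. ?W (mu y x) (b @ s @ p @ t @ a)) q)) U
    = split_sum (\<lambda>a y b. split_sum (\<lambda>p u s. ?W (mu y x * mu u v) (b @ q @ s @ p @ a)) U) t
    + split_sum (\<lambda>a y b. split_sum (\<lambda>p u s. ?W (mu y x * mu u v) (b @ s @ p @ t @ a)) U) q" for q v t
  proof -
    have comm: "pscale a (pscale b c) = pscale (b * a) c" for a b :: rat and c :: symp_tensor
      by (simp add: mult.commute del: pscale_single)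
    show ?thesis
      by (simp only: pscale.scale_right_distrib split_sum_pscale comm split_sum_add
          split_sum_swap[where U = U and V = t] split_sum_swap[where U = U and V = q])
  qed
  ultimately show ?thesis
    unfolding half_bracket_def
    by (subst split_sum_swap) (simp only: split_sum_add add.commute)
qed

lemma split_sum_apply: "split_sum k w z = split_sum (\<lambda>p y s. k p y s z) w"
  by (induction w arbitrary: k) simp_all

lemma mu_antisym: "mu x y = - mu y x"
  by (cases x; cases y) auto

text \<open>Contracting the joined cyclic word at the letters coming from \<open>V\<close> gives
  \<open>half_bracket U V\<close>; at those from \<open>U\<close>, antisymmetry of \<open>mu\<close>
  gives minus \<open>half_bracket V U\<close>.\<close>

lemma br_N:
  "words.br (N U) (N V) =
     split_sum (\<lambda>p u s. split_sum (\<lambda>q v t. words.scF (mu u v) (N (s @ p @ t @ q))) V) U"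
proof (rule words.deriv_eqI)
  show "words.deriv (words.br (N U) (N V))"
    by (intro words.deriv_br deriv_N)
  show "words.deriv (split_sum (\<lambda>p u s. split_sum (\<lambda>q v t. words.scF (mu u v) (N (s @ p @ t @ q))) V) U)"
    by (intro split_sum_induct[where P = words.deriv] words.deriv_0 words.deriv_plus words.deriv_scF deriv_N)
  fix x
  have contr: "contraction (s @ p @ t @ q) x =
      (split_sum (\<lambda>a y b. pscale (mu y x) (pure (b @ q @ s @ p @ a))) t +
       split_sum (\<lambda>a y b. pscale (mu y x) (pure (b @ s @ p @ t @ a))) q) +
      (split_sum (\<lambda>a y b. pscale (mu y x) (pure (b @ p @ t @ q @ a))) s +
       split_sum (\<lambda>a y b. pscale (mu y x) (pure (b @ t @ q @ s @ a))) p)" for s p t q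
    by (simp add: contraction_def split_sum_append add_ac del: pscale_single)
  have "half_bracket V U x = - split_sum (\<lambda>p u s. split_sum (\<lambda>q v t. pscale (mu u v)
      (split_sum (\<lambda>a y b. pscale (mu y x) (pure (b @ p @ t @ q @ a))) s +
       split_sum (\<lambda>a y b. pscale (mu y x) (pure (b @ t @ q @ s @ a))) p)) V) U"
  proof -
    have neg: "split_sum (\<lambda>p y s. - k p y s) w = - split_sum k w"
      for k :: "symp_index list \<Rightarrow> symp_index \<Rightarrow> symp_index list \<Rightarrow> symp_tensor" and w
      by (rule split_sum_hom[symmetric]) simp_all
    have "half_bracket V U x = split_sum (\<lambda>q v t. split_sum (\<lambda>p u s. - pscale (mu u v)
      (split_sum (\<lambda>a y b. pscale (mu y x) (pure (b @ p @ t @ q @ a))) s +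
       split_sum (\<lambda>a y b. pscale (mu y x) (pure (b @ t @ q @ s @ a))) p)) U) V"
      unfolding half_bracket_def
      by (intro split_sum_cong) (subst mu_antisym, rule pscale.scale_minus_left)
    then show ?thesis
      by (subst split_sum_swap) (simp only: neg)
  qed
  then show "words.br (N U) (N V) (word [x]) =
      split_sum (\<lambda>p u s. split_sum (\<lambda>q v t. words.scF (mu u v) (N (s @ p @ t @ q))) V) U (word [x])"
    by (simp add: words.br_def N_contraction split_sum_apply words.scF_def contr half_bracket_def[of U V]
        pscale.scale_right_distrib split_sum_add add_ac del: pscale_single)
qed

section \<open>Symplectic derivations as combinations of cyclic words\<close>

lemma symp_basis_iff: "x \<in> symp_basis g \<longleftrightarrow> idx x \<in> {1..g}"
  by (cases x) (auto simp: symp_basis_def)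

lemma symp_basis_mono: "g \<le> h \<Longrightarrow> symp_basis g \<subseteq> symp_basis h"
  by (auto simp: symp_basis_iff)

lemma symp_basis_Suc: "symp_basis (Suc g) - symp_basis g = {a_ix (Suc g), b_ix (Suc g)}"
proof -
  have "x \<in> symp_basis (Suc g) - symp_basis g \<longleftrightarrow> x = a_ix (Suc g) \<or> x = b_ix (Suc g)" for x
    by (cases x) (auto simp: symp_basis_iff)
  then show ?thesis by auto
qed

lemma omega0_eq: "omega0 g = (\<Sum>i=1..g. pure [a_ix i] * pure [b_ix i] - pure [b_ix i] * pure [a_ix i])"
  by (simp add: omega0_def TQ_def tensor_algebra_def magma_algebra_sel tensor_gen_def)

interpretation Q: free_quotients pscale "(*)" "\<lambda>x. pure [x]" symp_basis TQ "\<lambda>n p. p" "\<lambda>n p. p"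
  unfolding TQ_def by (rule free_quotients_words) (simp add: symp_basis_mono)

definition symp_derivs :: "nat \<Rightarrow> (symp_tensor \<Rightarrow> symp_tensor) set" where
  "symp_derivs g = {F \<in> words.DD (symp_basis g). F (omega0 g) = 0}"

lemma deriv_omega0:
  assumes "words.deriv F"
  shows "F (omega0 g) = (\<Sum>i=1..g. (F (pure [a_ix i]) * pure [b_ix i] + pure [a_ix i] * F (pure [b_ix i]))
    - (F (pure [b_ix i]) * pure [a_ix i] + pure [b_ix i] * F (pure [a_ix i])))"
proof -
  have "F (\<Sum>i\<in>I. f i) = (\<Sum>i\<in>I. F (f i))" if "finite I" for I and f :: "nat \<Rightarrow> symp_tensor"
    using that by (induction I rule: finite_induct) (simp_all add: words.deriv_zero[OF assms] words.deriv_add[OF assms])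
  then show ?thesis
    by (simp only: omega0_eq finite_atLeastAtMost words.deriv_diff[OF assms] words.deriv_m[OF assms])
qed

lemma omega0_gen: "omega0 g \<in> words.gen (symp_basis g)"
proof -
  have "pscale.subspace (words.gen (symp_basis g) :: symp_tensor set)"
    by (auto simp: pscale.subspace_def intro: words.gen.intros)
  then show ?thesis
    unfolding omega0_eq
    by (rule pscale.subspace_sum) (intro words.gen_diff words.gen_m words.gen_x; simp add: symp_basis_iff)
qed

lemma contraction_gen:
  assumes "set w \<subseteq> B" "2 \<le> length w"
  shows "contraction w x \<in> words.gen B"
  unfolding contraction_def
proof (rule split_sum_induct[where P = "\<lambda>u. u \<in> words.gen B"])
  fix p y s assume "w = p @ y # s"
  then have "pure (s @ p) \<in> words.gen B"
    using assms by (auto simp: gen_words)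
  then show "pscale (mu y x) (pure (s @ p)) \<in> words.gen B"
    by (rule words.gen_scale)
qed (rule words.gen_zero words.gen_add; assumption)+

lemma contraction_zero:
  assumes "idx x \<notin> ix w"
  shows "contraction w x = 0"
  unfolding contraction_def
  using assms by (intro split_sum_zero) (auto simp: mu_eq_0)

text \<open>The word subtracted at one position is the word added at the next.\<close>

lemma split_sum_telescope:
  fixes h :: "'b list \<Rightarrow> 'c::ab_group_add"
  shows "split_sum (\<lambda>p y s. h (y # s @ q @ p) - h (s @ q @ p @ [y])) w = h (w @ q) - h (q @ w)"
proof (induction w arbitrary: q)
  case (Cons y w)
  show ?case
    using Cons.IH[of "q @ [y]"] by simp
qed simp

lemma sum_split_sum: "(\<Sum>i\<in>I. split_sum (\<lambda>p y s. k p y s i) w) = split_sum (\<lambda>p y s. \<Sum>i\<in>I. k p y s i) w"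
  by (induction w arbitrary: k) (simp_all add: sum.distrib)

text \<open>Evaluation at \<open>omega0\<close> restores each contracted letter, once in front and
  once at the end with the opposite sign; around the cyclic word these terms telescope.\<close>

lemma N_symp_derivs:
  assumes w: "set w \<subseteq> symp_basis g" "2 \<le> length w"
  shows "N w \<in> symp_derivs g"
proof -
  have "N w \<in> words.DD (symp_basis g)"
    unfolding N_def
  proof (rule words.d_DD)
    fix x assume "x \<notin> symp_basis g"
    then have "idx x \<notin> ix w" using w(1) by (auto simp: symp_basis_iff)
    then show "contraction w x = 0" by (rule contraction_zero)
  qed (rule contraction_gen[OF w])
  moreover have "N w (omega0 g) = 0"
  proof -
    let ?k = "\<lambda>p y s i. pscale (mu y (a_ix i)) (pure (s @ p @ [b_ix i]) - pure (b_ix i # s @ p))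
        - pscale (mu y (b_ix i)) (pure (s @ p @ [a_ix i]) - pure (a_ix i # s @ p))"
    have "N w (omega0 g) = (\<Sum>i=1..g. split_sum (\<lambda>p y s. ?k p y s i) w)"
    proof -
      have "contraction w (a_ix i) * pure [b_ix i] + pure [a_ix i] * contraction w (b_ix i)
          - (contraction w (b_ix i) * pure [a_ix i] + pure [b_ix i] * contraction w (a_ix i))
        = split_sum (\<lambda>p y s. ?k p y s i) w" for i
      proof -
        have mult: "split_sum k w * q = split_sum (\<lambda>p y s. k p y s * q) w"
          "q * split_sum k w = split_sum (\<lambda>p y s. q * k p y s) w"
          for k :: "symp_index list \<Rightarrow> symp_index \<Rightarrow> symp_index list \<Rightarrow> symp_tensor" and q w
          by (rule split_sum_hom[where g = "\<lambda>c. c * q"], simp_all add: distrib_right)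
            (rule split_sum_hom[where g = "\<lambda>c. q * c"], simp_all add: distrib_left)
        have diff: "split_sum k w - split_sum l w = split_sum (\<lambda>p y s. k p y s - l p y s) w"
          for k l :: "symp_index list \<Rightarrow> symp_index \<Rightarrow> symp_index list \<Rightarrow> symp_tensor" and w
          by (induction w arbitrary: k l) (simp_all add: algebra_simps)
        have eq: "pscale c (pure (s @ p)) * pure [b_ix i] + pure [a_ix i] * pscale c' (pure (s @ p))
            - (pscale c' (pure (s @ p)) * pure [a_ix i] + pure [b_ix i] * pscale c (pure (s @ p)))
          = pscale c (pure (s @ p @ [b_ix i]) - pure (b_ix i # s @ p))
            - pscale c' (pure (s @ p @ [a_ix i]) - pure (a_ix i # s @ p))" for c c' :: rat and p s
          by (simp add: pscale_times_left pscale_times_right pscale.scale_right_diff_distrib del: pscale_single)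
        show ?thesis
          unfolding contraction_def mult split_sum_add[symmetric] diff eq ..
      qed
      then show ?thesis
        by (simp add: deriv_omega0[OF deriv_N])
    qed
    also have "\<dots> = split_sum (\<lambda>p y s. \<Sum>i=1..g. ?k p y s i) w"
      by (rule sum_split_sum)
    also have "\<dots> = split_sum (\<lambda>p y s. pure (y # s @ [] @ p) - pure (s @ [] @ p @ [y])) w"
    proof (rule split_sum_cong)
      fix p y s assume "w = p @ y # s"
      then have "idx y \<in> {1..g}" using w(1) by (auto simp: symp_basis_iff)
      then have "(\<Sum>i=1..g. ?k p y s i) = (\<Sum>i=1..g. if i = idx y then ?k p y s i else 0)"
        by (intro sum.cong) (auto simp: mu_eq_0)
      also have "\<dots> = ?k p y s (idx y)"
        using \<open>idx y \<in> {1..g}\<close> by simp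
      also have "\<dots> = pure (y # s @ [] @ p) - pure (s @ [] @ p @ [y])"
        by (cases y) (simp_all add: single_uminus)
      finally show "(\<Sum>i=1..g. ?k p y s i) = pure (y # s @ [] @ p) - pure (s @ [] @ p @ [y])" .
    qed
    also have "\<dots> = 0"
      using split_sum_telescope[of pure "[]" w] by simp
    finally show ?thesis .
  qed
  ultimately show ?thesis
    by (simp add: symp_derivs_def)
qed

lemma lookup_word_times:
  "Poly_Mapping.lookup (word [x] * p) (y # v) = (if y = x then Poly_Mapping.lookup p v else (0 :: 'r::comm_ring_1))"
  by (induction p rule: word_induct[OF subset_UNIV])
    (auto simp: lookup_add distrib_left pscale_times_right lookup_single when_def)

lemma lookup_times_word:
  "Poly_Mapping.lookup (p * word [x]) (v @ [y]) = (if y = x then Poly_Mapping.lookup p v else (0 :: 'r::comm_ring_1))"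
  by (induction p rule: word_induct[OF subset_UNIV])
    (auto simp: lookup_add distrib_right pscale_times_left lookup_single when_def)

lemma lin_diff: "lin h (p - q) = lin h p - lin h q"
  using lin_add[of h "p - q" q] by simp

lemma lin_sum: "lin h (\<Sum>i\<in>I. f i) = (\<Sum>i\<in>I. lin h (f i))"
  by (induction I rule: infinite_finite_induct) (simp_all add: lin_add)

text \<open>By invariance of \<open>t\<close> each rotation permutes its words and can be undone in
  the sum; every word is then counted as often as it has letters, which the division
  compensates.\<close>

lemma lin_rotation_average:
  fixes t :: "'b list \<Rightarrow>\<^sub>0 rat"
  assumes inv: "\<And>w. Poly_Mapping.lookup t (rotate1 w) = Poly_Mapping.lookup t w"
    and Nil: "[] \<notin> Poly_Mapping.keys t"
  shows "(\<Sum>w\<in>Poly_Mapping.keys t. pscale (Poly_Mapping.lookup t w / of_nat (length w)) (\<Sum>j<length w. h (rotate j w)))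
    = lin h t"
proof -
  let ?K = "Poly_Mapping.keys t"
  define c where "c w = Poly_Mapping.lookup t w / of_nat (length w)" for w
  have lookup_rotate: "Poly_Mapping.lookup t (rotate j w) = Poly_Mapping.lookup t w" for j w
    by (induction j) (simp_all add: inv)
  then have c_rotate: "c (rotate j w) = c w" for j w
    by (simp add: c_def)
  have inj: "inj (rotate j :: 'b list \<Rightarrow> 'b list)" for j
    unfolding rotate_def using inj_rotate1 by (rule inj_fn)
  have bij: "bij_betw (rotate j) ?K ?K" for j
  proof -
    have "rotate j ` ?K \<subseteq> ?K" by (auto simp: in_keys_iff lookup_rotate)
    then have "rotate j ` ?K = ?K"
      using inj_on_subset[OF inj subset_UNIV] by (intro endo_inj_surj) auto
    then show ?thesis
      using inj_on_subset[OF inj subset_UNIV] by (simp add: bij_betw_def)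
  qed
  \<comment> \<open>A common bound on the lengths makes the double sum rectangular, so that words
    and rotations can be exchanged.\<close>
  define M where "M = Suc (Max (insert 0 (length ` ?K)))"
  have M: "length w < M" if "w \<in> ?K" for w
    using that by (simp add: M_def less_Suc_eq_le)
  define k where "k j w = (if j < length w then pscale (c w) (h w) else 0)" for j :: nat and w
  have "(\<Sum>w\<in>?K. pscale (c w) (\<Sum>j<length w. h (rotate j w))) = (\<Sum>w\<in>?K. \<Sum>j<M. k j (rotate j w))"
  proof (rule sum.cong)
    fix w assume w: "w \<in> ?K"
    have "(\<Sum>j<M. k j (rotate j w)) = (\<Sum>j<length w. k j (rotate j w))"
      using M[OF w] by (intro sum.mono_neutral_right) (auto simp: k_def)
    then show "pscale (c w) (\<Sum>j<length w. h (rotate j w)) = (\<Sum>j<M. k j (rotate j w))"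
      by (simp add: k_def c_rotate pscale.scale_sum_right)
  qed simp
  also have "\<dots> = (\<Sum>j<M. \<Sum>w\<in>?K. k j (rotate j w))"
    by (rule sum.swap)
  also have "\<dots> = (\<Sum>j<M. \<Sum>w\<in>?K. k j w)"
    by (intro sum.cong sum.reindex_bij_betw bij refl)
  also have "\<dots> = (\<Sum>w\<in>?K. \<Sum>j<M. k j w)"
    by (rule sum.swap)
  also have "\<dots> = lin h t"
    unfolding lin_def
  proof (rule sum.cong)
    fix w assume w: "w \<in> ?K"
    then have "w \<noteq> []" using Nil by auto
    have "(\<Sum>j<M. k j w) = (\<Sum>j<length w. pscale (c w) (h w))"
      using M[OF w] by (intro sum.mono_neutral_cong_right) (auto simp: k_def)
    also have "\<dots> = pscale (of_nat (length w) * c w) (h w)"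
      by (simp add: pscale.scale_sum_left[symmetric])
    also have "of_nat (length w) * c w = Poly_Mapping.lookup t w"
      using \<open>w \<noteq> []\<close> by (simp add: c_def)
    finally show "(\<Sum>j<M. k j w) = pscale (Poly_Mapping.lookup t w) (h w)" .
  qed simp
  finally show ?thesis by (simp add: c_def)
qed

text \<open>The form identifies \<open>F\<close> with a tensor \<open>t\<close>, and
  \<open>F (omega0 g) = 0\<close> says that \<open>t\<close> is invariant under rotation. Averaging
  over rotations then expresses \<open>F\<close> through the \<open>N w\<close>.\<close>

lemma symp_deriv_eq_sum:
  assumes F: "F \<in> symp_derivs g"
  obtains K c where "finite K" "\<And>w. w \<in> K \<Longrightarrow> set w \<subseteq> symp_basis g \<and> 2 \<le> length w"
    "F = (\<Sum>w\<in>K. words.scF (c w) (N w))"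
proof
  have FD: "F \<in> words.DD (symp_basis g)" and dF: "words.deriv F"
    using F by (auto simp: symp_derivs_def words.DD_def)
  define f where "f x = F (pure [x])" for x
  have f_gen: "f x \<in> words.gen (symp_basis g)" for x
    using FD words.gen_zero[of "symp_basis g"] by (cases "x \<in> symp_basis g") (auto simp: f_def words.DD_def)
  define t where "t = (\<Sum>i=1..g. pure [a_ix i] * f (b_ix i) - pure [b_ix i] * f (a_ix i))"
  \<comment> \<open>\<open>t'\<close> is \<open>t\<close> with the first letter of each word moved
    to the end.\<close>
  define t' where "t' = (\<Sum>i=1..g. f (b_ix i) * pure [a_ix i] - f (a_ix i) * pure [b_ix i])"
  have "t - t' = F (omega0 g)"
    by (simp add: deriv_omega0[OF dF] t_def t'_def f_def sum_subtractf[symmetric] algebra_simps)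
  then have tt': "t = t'"
    using F by (simp add: symp_derivs_def)
  have "Poly_Mapping.lookup t (y # v) = Poly_Mapping.lookup t' (v @ [y])" for y v
    by (simp add: t_def t'_def lookup_sum lookup_minus lookup_word_times lookup_times_word)
  then have inv: "Poly_Mapping.lookup t (rotate1 w) = Poly_Mapping.lookup t w" for w
    by (cases w) (simp_all add: tt')
  have "pscale.subspace (words.gen (symp_basis g) :: symp_tensor set)"
    by (auto simp: pscale.subspace_def intro: words.gen.intros)
  then have t_gen: "t \<in> words.gen (symp_basis g)"
    unfolding t_def
    by (rule pscale.subspace_sum) (intro words.gen_diff words.gen_m words.gen_x f_gen; simp add: symp_basis_iff)
  \<comment> \<open>Values of \<open>f\<close> have no constant term, so \<open>t\<close> contains
    no words of length one.\<close>
  have "Poly_Mapping.lookup t [y] = 0" for y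
  proof -
    have "Poly_Mapping.lookup (f x) [] = 0" for x
      using f_gen[of x] by (auto simp: gen_words in_keys_iff)
    then show ?thesis
      by (auto simp: t_def lookup_sum lookup_minus lookup_word_times intro!: sum.neutral)
  qed
  then have short: "[y] \<notin> Poly_Mapping.keys t" for y
    by (simp add: in_keys_iff)
  show "finite (Poly_Mapping.keys t)" by simp
  show "set w \<subseteq> symp_basis g \<and> 2 \<le> length w" if "w \<in> Poly_Mapping.keys t" for w
  proof -
    have "w \<noteq> []" "set w \<subseteq> symp_basis g" using t_gen that by (auto simp: gen_words)
    moreover have "length w \<noteq> 1" using short[of "hd w"] that by (cases w) auto
    ultimately show ?thesis by (cases w; cases "tl w") auto
  qed
  show "F = (\<Sum>w\<in>Poly_Mapping.keys t. words.scF (Poly_Mapping.lookup t w / of_nat (length w)) (N w))"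
  proof (rule words.deriv_eqI[OF dF])
    have "words.F.subspace {E :: symp_tensor \<Rightarrow> symp_tensor. words.deriv E}"
      by (auto simp: words.F.subspace_def words.deriv_closed)
    then have "(\<Sum>w\<in>Poly_Mapping.keys t. words.scF (Poly_Mapping.lookup t w / of_nat (length w)) (N w))
        \<in> {E. words.deriv E}"
      by (rule words.F.subspace_sum) (simp add: words.deriv_scF deriv_N)
    then show "words.deriv (\<Sum>w\<in>Poly_Mapping.keys t. words.scF (Poly_Mapping.lookup t w / of_nat (length w)) (N w))"
      by simp
  next
    fix x
    \<comment> \<open>Contraction of the first letter with \<open>x\<close>: summed over rotations
      it gives \<open>contraction w x\<close>, and extended linearly to \<open>t\<close> it recovers
      \<open>f x\<close>.\<close>
    define h where "h w = (case w of [] \<Rightarrow> 0 | y # r \<Rightarrow> pscale (mu y x) (pure r))" for w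
    have contr: "contraction w x = (\<Sum>j<length w. h (rotate j w))" for w
      using split_sum_rotations[of h "[]" w] by (simp add: contraction_def h_def)
    have lin_h: "lin h (pure [y] * p) = pscale (mu y x) p" for y p
      by (induction p rule: word_induct[OF subset_UNIV])
        (simp_all add: h_def distrib_left lin_add pscale.scale_right_distrib pscale_times_right lin_pscale
          mult.commute)
    have "(\<Sum>w\<in>Poly_Mapping.keys t. words.scF (Poly_Mapping.lookup t w / of_nat (length w)) (N w)) (pure [x]) = lin h t"
      unfolding sum_fun_apply words.scF_def N_gen contr
      using t_gen by (intro lin_rotation_average inv) (auto simp: gen_words)
    also have "\<dots> = (\<Sum>i=1..g. pscale (mu (a_ix i) x) (f (b_ix i)) - pscale (mu (b_ix i) x) (f (a_ix i)))"
      by (simp add: t_def lin_sum lin_diff lin_h)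
    also have "\<dots> = (\<Sum>i=1..g. if i = idx x then f x else 0)"
      by (intro sum.cong refl) (cases x; auto)
    also have "\<dots> = f x"
      using FD by (auto simp: f_def words.DD_def symp_basis_iff)
    finally show "F (pure [x]) =
        (\<Sum>w\<in>Poly_Mapping.keys t. words.scF (Poly_Mapping.lookup t w / of_nat (length w)) (N w)) (pure [x])"
      by (simp add: f_def)
  qed
qed

section \<open>Passage to the limit over the genus\<close>

lemma symp_derivs_Suc: "symp_derivs g \<subseteq> symp_derivs (Suc g)"
proof
  fix F assume F: "F \<in> symp_derivs g"
  then have FD: "F \<in> words.DD (symp_basis g)" and dF: "words.deriv F"
    by (auto simp: symp_derivs_def words.DD_def)
  have "F (pure [a_ix (Suc g)]) = 0" "F (pure [b_ix (Suc g)]) = 0"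
    using FD by (auto simp: words.DD_def symp_basis_iff)
  then have "F (omega0 (Suc g)) = F (omega0 g)"
    by (simp add: deriv_omega0[OF dF])
  then show "F \<in> symp_derivs (Suc g)"
    using F FD words.DD_mono[OF symp_basis_mono[of g "Suc g"]] by (auto simp: symp_derivs_def)
qed

interpretation DS: derivation_system words.scF symp_derivs words.br symp_der Q.e Q.\<Phi>
proof -
  have "Q.\<Phi> g ` symp_derivs g = {D \<in> derivations Q_ring (TQ g). D (omega0 g) = \<zero>\<^bsub>TQ g\<^esub>}" for g
  proof -
    have "Q.\<Phi> g F (omega0 g) = F (omega0 g)" if "F \<in> words.DD (symp_basis g)" for F
      using Q.\<Phi>_\<pi>[OF that omega0_gen] .
    moreover have "\<zero>\<^bsub>TQ g\<^esub> = 0"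
      by (simp add: TQ_def tensor_algebra_def magma_algebra_sel)
    ultimately show ?thesis
      unfolding Q.\<Phi>_onto[symmetric] symp_derivs_def by auto
  qed
  then have "symp_der = (\<lambda>n. Der Q_ring (TQ n)\<lparr>carrier := Q.\<Phi> n ` symp_derivs n\<rparr>)"
    by (simp add: fun_eq_iff symp_der_def)
  moreover have "derivation_system words.scF symp_derivs words.br
      (\<lambda>n. Der Q_ring (TQ n)\<lparr>carrier := Q.\<Phi> n ` symp_derivs n\<rparr>) Q.e Q.\<Phi>"
  proof (rule Q.derivation_system_restrict)
    show "words.F.subspace (symp_derivs n)" for n
      using words.subspace_DD[of "symp_basis n"]
      by (auto simp: words.F.subspace_def symp_derivs_def) (simp add: words.scF_def)
    show "words.br F H \<in> symp_derivs n" if "F \<in> symp_derivs n" "H \<in> symp_derivs n" for n F H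
      using that words.br_DD
      by (auto simp: symp_derivs_def words.br_def words.deriv_zero[OF words.DD_deriv])
  qed (auto simp: symp_derivs_def symp_derivs_Suc[unfolded symp_derivs_def])
  ultimately show "derivation_system words.scF symp_derivs words.br symp_der Q.e Q.\<Phi>"
    by simp
qed

lemma subspace_UN_derived: "words.F.subspace (\<Union>g. DS.D' g)"
  unfolding words.F.subspace_def
proof (intro conjI ballI allI)
  show "0 \<in> (\<Union>g. DS.D' g)"
    using words.F.subspace_0[OF DS.subspace_D'] by blast
next
  fix E F assume "E \<in> (\<Union>g. DS.D' g)" "F \<in> (\<Union>g. DS.D' g)"
  then obtain g h where "E \<in> DS.D' g" "F \<in> DS.D' h" by blast
  then have "E \<in> DS.D' (max g h)" "F \<in> DS.D' (max g h)"
    using DS.D'_mono[of g "max g h"] DS.D'_mono[of h "max g h"] by auto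
  then show "E + F \<in> (\<Union>g. DS.D' g)"
    using words.F.subspace_add[OF DS.subspace_D'] by blast
next
  fix c E assume "E \<in> (\<Union>g. DS.D' g)"
  then show "words.scF c E \<in> (\<Union>g. DS.D' g)"
    using words.F.subspace_scale[OF DS.subspace_D'] by blast
qed

text \<open>
  \<open>bracket_functional\<close> ranges over words in all letters, whereas the indices in \<open>symp_basis\<close> start at \<open>1\<close>.
\<close>

primrec shift :: "symp_index \<Rightarrow> symp_index" where
  "shift (a_ix i) = a_ix (Suc i)"
| "shift (b_ix i) = b_ix (Suc i)"

lemma mu_shift: "mu (shift x) (shift y) = mu x y"
  by (cases x; cases y) auto

lemma N_shift_symp_derivs:
  assumes "2 \<le> length w" "ix w \<subseteq> {..<g}"
  shows "N (map shift w) \<in> symp_derivs g"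
proof (rule N_symp_derivs)
  have "idx (shift x) = Suc (idx x)" for x by (cases x) auto
  then show "set (map shift w) \<subseteq> symp_basis g"
    using assms(2) by (auto simp: symp_basis_iff)
qed (use assms in simp)

text \<open>
  A linear functional that vanishes on all derived algebras but not on \<open>N w\<close> would restrict to a nonzero
  \<open>bracket_functional\<close>.
\<close>

lemma N_derived:
  assumes w: "2 \<le> length w"
  shows "N (map shift w) \<in> (\<Union>g. DS.D' g)"
proof (rule ccontr)
  let ?U = "\<Union>g. DS.D' g" and ?w = "map shift w"
  assume N: "N ?w \<notin> ?U"
  interpret VS: vector_space_pair "words.scF :: rat \<Rightarrow> (symp_tensor \<Rightarrow> symp_tensor) \<Rightarrow> _" "(*) :: rat \<Rightarrow> rat \<Rightarrow> rat"
    by unfold_locales (simp_all add: words.F.scale_right_distrib words.F.scale_left_distrib algebra_simps)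
  obtain B where B: "B \<subseteq> ?U" "words.F.independent B" "?U \<subseteq> words.F.span B"
    using VS.vs1.maximal_independent_subset[of ?U] by blast
  have "words.F.span B \<subseteq> ?U"
    using words.F.span_minimal[OF B(1)] subspace_UN_derived by blast
  \<comment> \<open>The union of the derived algebras is the span of \<open>B\<close>, so a
    functional may be prescribed as 0 on \<open>B\<close> and 1 on \<open>N ?w\<close>.\<close>
  then have "words.F.independent (insert (N ?w) B)"
    using N B(2) by (intro VS.vs1.independent_insertI) auto
  then obtain l where l: "Vector_Spaces.linear words.scF (*) l"
      "\<forall>E\<in>insert (N ?w) B. l E = (if E = N ?w then 1 else 0)"
    using VS.linear_independent_extend[of "insert (N ?w) B" "\<lambda>E. if E = N ?w then 1 else 0"] by blast
  interpret l: Vector_Spaces.linear words.scF "(*)" l by (rule l(1))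
  have "l E = 0" if "E \<in> B" for E
    using l(2) that B(1) N by auto
  then have l_U: "l E = 0" if "E \<in> ?U" for E
    using VS.linear_eq_0_on_span[OF l(1)] that B(3) by blast
  have "bracket_functional (\<lambda>u. l (N (map shift u)))"
  proof
    show "l (N (map shift (u @ v))) = l (N (map shift (v @ u)))" for u v
      using N_cyclic[of "map shift u" "map shift v"] by simp
  next
    fix U V :: "symp_index list"
    assume UV: "2 \<le> length U" "2 \<le> length V"
    \<comment> \<open>Strictly above every index, since \<open>shift\<close> raises indices by
      one.\<close>
    define g where "g = Suc (Max (ix (U @ V) \<union> {0}))"
    have "i < g" if "i \<in> ix (U @ V)" for i
      using that by (simp add: g_def less_Suc_eq_le)
    then have "words.br (N (map shift U)) (N (map shift V)) \<in> DS.D' g"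
      using UV by (intro DS.br_in_D' N_shift_symp_derivs) auto
    then have "l (words.br (N (map shift U)) (N (map shift V))) = 0"
      using l_U by blast
    moreover have "l (split_sum k u) = split_sum (\<lambda>p y s. l (k p y s)) u"
      for k :: "symp_index list \<Rightarrow> symp_index \<Rightarrow> symp_index list \<Rightarrow> symp_tensor \<Rightarrow> symp_tensor" and u
      by (rule split_sum_hom[where g = l]) (simp_all only: l.zero l.add)
    ultimately show "split_sum (\<lambda>p u s. split_sum (\<lambda>q v t. mu u v * l (N (map shift (s @ p @ t @ q)))) V) U = 0"
      by (simp add: br_N l.scale split_sum_map mu_shift)
  qed
  then have "l (N ?w) = 0"
    using w by (rule bracket_functional.vanishes)
  then show False
    using l(2) by simp
qed

theorem direct_limit_symp_der:
  "trivial_group (direct_limit (\<lambda>g. H1 Q_ring (symp_der g)) (\<lambda>g. H1_map Q_ring (symp_der (Suc g)) (symp_der_embed g)))"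
proof -
  have derived: "\<exists>m\<ge>g. F \<in> DS.D' m" if F: "F \<in> symp_derivs g" for g F
  proof -
    obtain K c where K: "finite K" "\<And>w. w \<in> K \<Longrightarrow> set w \<subseteq> symp_basis g \<and> 2 \<le> length w"
      "F = (\<Sum>w\<in>K. words.scF (c w) (N w))"
      using symp_deriv_eq_sum[OF F] by blast
    have "N w \<in> (\<Union>g. DS.D' g)" if "w \<in> K" for w
    proof -
      have "\<exists>y. x = shift y" if "x \<in> set w" for x
      proof -
        have "idx x \<noteq> 0" using that \<open>w \<in> K\<close> K(2) by (fastforce simp: symp_basis_iff)
        then obtain i where "idx x = Suc i" by (cases "idx x") auto
        then show ?thesis
          by (cases x) (auto intro: exI[of _ "a_ix i"] exI[of _ "b_ix i"])
      qed
      then have "w \<in> lists (range shift)" by auto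
      then obtain v where v: "w = map shift v"
        unfolding lists_image by auto
      then show ?thesis
        using N_derived[of v] K(2)[OF that] by simp
    qed
    then have "F \<in> (\<Union>g. DS.D' g)"
      unfolding K(3)
      by (intro words.F.subspace_sum[OF subspace_UN_derived] words.F.subspace_scale[OF subspace_UN_derived])
    then obtain m where "F \<in> DS.D' m" by blast
    then show ?thesis
      using DS.D'_mono[of m "max m g"] by (intro exI[of _ "max m g"]) auto
  qed
  \<comment> \<open>With the trivial group as target, the kernel condition says that every
    symplectic derivation eventually lies in \<open>DS.D'\<close>.\<close>
  let ?K = "singleton_group ()"
  have "\<exists>t. direct_system (\<lambda>g. H1 Q_ring (symp_der g)) (\<lambda>g. H1_map Q_ring (symp_der (Suc g)) (Q.e g)) ?K t"
  proof (rule DS.direct_system_H1[where \<tau> = "\<lambda>_ _. ()"])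
    show "\<exists>n. \<exists>F\<in>symp_derivs n. () = k" for k
      using DS.D_zero[of 0] by auto
  qed (use derived in \<open>auto simp: singleton_group_def[of "()"] intro!: singleton_group[unfolded singleton_group_def]\<close>)
  moreover have e: "Q.e g = symp_der_embed g" for g
    by (simp add: symp_der_embed_def symp_basis_Suc tensor_gen_def)
  ultimately obtain t where
    t: "direct_system (\<lambda>g. H1 Q_ring (symp_der g)) (\<lambda>g. H1_map Q_ring (symp_der (Suc g)) (symp_der_embed g)) ?K t"
    unfolding e by blast
  show ?thesis
    using isomorphic_group_triviality1[OF direct_system.iso_direct_limit[OF t]
        direct_system.group_direct_limit[OF t] trivial_singleton_group] .
qed

theorem theorem1p1:
  shows "(direct_limit (\<lambda>n. H1 Z_ring (Der_T n))
            (\<lambda>n. H1_map Z_ring (Der_T (Suc n)) (Der_T_embed n)) \<cong> integer_group) \<and>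
         (direct_limit (\<lambda>n. H1 Z_ring (Der_Lie n))
            (\<lambda>n. H1_map Z_ring (Der_Lie (Suc n)) (Der_Lie_embed n)) \<cong> integer_group) \<and>
         trivial_group (direct_limit (\<lambda>g. H1 Q_ring (symp_der g))
            (\<lambda>g. H1_map Q_ring (symp_der (Suc g)) (symp_der_embed g)))"
  using direct_limit_Der_T direct_limit_Der_Lie direct_limit_symp_der by blast

end
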